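(* Let $A$ be a complex $C^*$-algebra with grading $\gamma$ and real structure $\mathfrak f$ commuting with $\gamma$, such that the Gelfand spectrum $\mathcal X(A)$ of the center $\mathcal Z(A)$ of the multiplier algebra $\mathcal M(A)$ is connected, and such that $\gamma$ is either balanced or trivial. Let $\mathfrak r$ be a second real structure on $(A,\gamma)$ which is inner related to $\mathfrak f$. Assume that either (A1) and (A2) hold, or (B2) holds, where: (A1) the map $a\mapsto\mathfrak f(a^* )$ and $\gamma$ act trivially on $\mathcal Z(A)$; (A2) there is a generator $\Theta$ for $\mathfrak r\circ\mathfrak f$ and $z\in S^1$ such that $z$ and $-z$ both lie in the complement of the spectrum of $\Theta$; (B2) there is a locally homogeneous generator $\Theta$ for $\mathfrak r\circ\mathfrak f$ with finite spectrum. Let $\eta_{\mathfrak r,\mathfrak f}=(\eta^1_{\mathfrak r,\mathfrak f},\eta^2_{\mathfrak r,\mathfrak f})$ be the relative signs. (1) $(M_2(A),\gamma_2,\mathfrak r_2)$ is inner conjugate to $(A\hat\otimes M_2(\mathbb{C}),\gamma\otimes\gamma',\mathfrak f'\otimes\mathfrak r')$, where $\gamma',\mathfrak f',\mathfrak r'$ and the resulting graded real subalgebra $(M_2(A)^{\mathfrak r_2},\gamma_2)$ (up to isomorphism) are: - $\eta_{\mathfrak r,\mathfrak f}=(+1,+1)$: $\gamma'=\mathrm{id}$, $\mathfrak f'=\mathfrak f$, $\mathfrak r'=\mathfrak l_{1,1}$, real subalgebra $(A^{\mathfrak f}\hat\otimes M_2(\mathbb{R}),\gamma\otimes\mathrm{id})$;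 - $\eta_{\mathfrak r,\mathfrak f}=(-1,+1)$: $\gamma'=\mathrm{id}$, $\mathfrak f'=\mathfrak f$, $\mathfrak r'=\mathfrak l_{0,2}$, real subalgebra $(A^{\mathfrak f}\hat\otimes\mathbb{H},\gamma\otimes\mathrm{id})$; - $\eta_{\mathfrak r,\mathfrak f}=(+1,-1)$: $\gamma'=\mathrm{st}$, $\mathfrak f'=\mathfrak f\circ\gamma$, $\mathfrak r'=\mathfrak l_{2,0}$, real subalgebra $(A^{\mathfrak f\circ\gamma}\hat\otimes Cl_{2,0},\gamma\otimes\mathrm{st})$; - $\eta_{\mathfrak r,\mathfrak f}=(-1,-1)$: $\gamma'=\mathrm{st}$, $\mathfrak f'=\mathfrak f\circ\gamma$, $\mathfrak r'=\mathfrak l_{0,2}$, real subalgebra $(A^{\mathfrak f\circ\gamma}\hat\otimes Cl_{0,2},\gamma\otimes\mathrm{st})$. If $\eta_{\mathfrak r,\mathfrak f}=(+1,+1)$ then already $(A,\gamma,\mathfrak r)$ is inner conjugate to $(A,\gamma,\mathfrak f)$. (2) Let $\mathfrak s\in\{\mathfrak l_{1,0},\mathfrak l_{0,1}\}$ be a real structure on $(\mathbb{C}l_1,\mathrm{st})$. Then $(M_2(A)\hat\otimes\mathbb{C}l_1,\gamma_2\otimes\mathrm{st},\mathfrak r_2\otimes\mathfrak s)$ is inner conjugate to $(A\hat\otimes\mathbb{C}l_3,\gamma\otimes\mathrm{st},\mathfrak f'\otimes\mathfrak r'')$, where $\mathfrak f',\mathfrak r''$ and the real subalgebra (up to isomorphism)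 are: - $(+1,+1)$, $\mathfrak s=\mathfrak l_{1,0}$: $\mathfrak f'=\mathfrak f$, $\mathfrak r''=\mathfrak l_{2,1}$, $(A^{\mathfrak f}\hat\otimes Cl_{2,1},\gamma\otimes\mathrm{st})$; - $(-1,+1)$, $\mathfrak s=\mathfrak l_{1,0}$: $\mathfrak f'=\mathfrak f$, $\mathfrak r''=\mathfrak l_{0,3}$, $(A^{\mathfrak f}\hat\otimes Cl_{0,3},\gamma\otimes\mathrm{st})$; - $(+1,+1)$, $\mathfrak s=\mathfrak l_{0,1}$: $\mathfrak f'=\mathfrak f$, $\mathfrak r''=\mathfrak l_{1,2}$, $(A^{\mathfrak f}\hat\otimes Cl_{1,2},\gamma\otimes\mathrm{st})$; - $(-1,+1)$, $\mathfrak s=\mathfrak l_{0,1}$: $\mathfrak f'=\mathfrak f$, $\mathfrak r''=\mathfrak l_{3,0}$, $(A^{\mathfrak f}\hat\otimes Cl_{3,0},\gamma\otimes\mathrm{st})$; - $(+1,-1)$, $\mathfrak s=\mathfrak l_{1,0}$: $\mathfrak f'=\mathfrak f\circ\gamma$, $\mathfrak r''=\mathfrak l_{3,0}$, $(A^{\mathfrak f\circ\gamma}\hat\otimes Cl_{3,0},\gamma\otimes\mathrm{st})$; - $(-1,-1)$, $\mathfrak s=\mathfrak l_{1,0}$: $\mathfrak f'=\mathfrak f\circ\gamma$, $\mathfrak r''=\mathfrak l_{1,2}$, $(A^{\mathfrak f\circ\gamma}\hat\otimes Cl_{1,2},\gamma\otimes\mathrm{st})$; - $(+1,-1)$, $\mathfrak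 s=\mathfrak l_{0,1}$: $\mathfrak f'=\mathfrak f\circ\gamma$, $\mathfrak r''=\mathfrak l_{2,1}$, $(A^{\mathfrak f\circ\gamma}\hat\otimes Cl_{2,1},\gamma\otimes\mathrm{st})$; - $(-1,-1)$, $\mathfrak s=\mathfrak l_{0,1}$: $\mathfrak f'=\mathfrak f\circ\gamma$, $\mathfrak r''=\mathfrak l_{0,3}$, $(A^{\mathfrak f\circ\gamma}\hat\otimes Cl_{0,3},\gamma\otimes\mathrm{st})$. If $\eta_{\mathfrak r,\mathfrak f}=(+1,+1)$ then $(A\hat\otimes\mathbb{C}l_1,\gamma\otimes\mathrm{st},\mathfrak r\otimes\mathfrak s)$ is inner conjugate to $(A\hat\otimes\mathbb{C}l_1,\gamma\otimes\mathrm{st},\mathfrak f\otimes\mathfrak s)$.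
   Context: A grading on a $C^*$-algebra is a $*$-automorphism $\gamma$ with $\gamma^2=\mathrm{id}$ (even: $\gamma(a)=a$; odd: $\gamma(a)=-a$). A real structure on a graded complex $C^*$-algebra is an anti-linear $*$-automorphism of order two commuting with the grading; $A^{\mathfrak r}$ is its real fixed point algebra. All (anti-)automorphisms extend to the multiplier algebra $\mathcal M(A)$; $\mathcal Z(A)$ is the center of $\mathcal M(A)$, and $\mathcal Z(A)\cong C(\mathcal X(A))$. The grading of $(A,\gamma,\mathfrak f)$ is balanced if $\mathcal M(A)$ contains an odd self-adjoint unitary which is $\mathfrak f$-invariant. $\mathrm{Ad}_u(a)=uau^*$. Two real structures $\mathfrak r,\mathfrak f$ on $(A,\gamma)$ are inner related if $\mathfrak r\circ\mathfrak f=\mathrm{Ad}_\Theta$ for some unitary $\Theta\in\mathcal M(A)$, called a generator for $\mathfrak r\circ\mathfrak f$ (so $\mathfrak r=\mathrm{Ad}_\Theta\circ\mathfrak f$). A unitary $u\in\mathcal M(A)$ is locally homogeneous if $u\gamma(u^* )\in\mathcal Z(A)$ and $(u\gamma(u^* ))^2=1$. Relative signs: $\eta_{\mathfrak r,\mathfrak f}=(\Theta\,\mathfrak f(\Theta),\ \Theta\,\gamma(\Theta^* ))$, where $\Theta$ is any generator under (A1), respectively any generator with finite spectrum under (B2). Under the given hypotheses this does not depend on the choice and, since $\mathcal X(A)$ is connected, both entries are $+1$ or $-1$. Inner conjugacy: real structures $\mathfrak r,\mathfrak s$ on one graded algebra $B$ are inner conjugate if there is a unitary $w\in\mathcal M(B)$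 with $\mathfrak s=\mathrm{Ad}_w\circ\mathfrak r\circ\mathrm{Ad}_w^{-1}$ and such that $\mathrm{Ad}_w$ commutes with the grading. When the two triples are written on different graded algebras, the statement means that there is an isomorphism of graded $C^*$-algebras carrying the first real structure to one which is inner conjugate to the second. $\gamma_2,\mathfrak r_2$ are the entrywise extensions to $M_2(A)$. $\hat\otimes$ is the graded tensor product, with product $(a_1\hat\otimes b_1)(a_2\hat\otimes b_2)=(-1)^{|a_2||b_1|}a_1a_2\hat\otimes b_1b_2$. $Cl_{r,s}$ is the real $C^*$-algebra generated by $r$ self-adjoint generators of square $1$ and $s$ anti-self-adjoint generators of square $-1$, pairwise anticommuting, with grading $\mathrm{st}$ for which the generators are odd; $\mathbb{C}l_{r+s}$ is its complexification. $\mathfrak l_{r,s}$ denotes a real structure on $(\mathbb{C}l_{r+s},\mathrm{st})$ whose real subalgebra is $(Cl_{r,s},\mathrm{st})$. Explicitly, $\mathbb{C}l_1=\mathbb{C}\oplus\mathbb{C}$ with $\mathrm{st}(a,b)=(b,a)$, $\mathfrak l_{1,0}(a,b)=(\bar a,\bar b)$, $\mathfrak l_{0,1}(a,b)=(\bar b,\bar a)$; and $(\mathbb{C}l_2,\mathrm{st})=(M_2(\mathbb{C}),\mathrm{Ad}_{\sigma_z})$ with $\mathfrak l_{1,1}=\mathfrak c$ (entrywise complex conjugation), $\mathfrak l_{2,0}=\mathrm{Ad}_{\sigma_x}\circ\mathfrak c$, $\mathfrak l_{0,2}=\mathrm{Ad}_{\sigma_y}\circ\mathfrak c$, where $\sigma_x,\sigma_y,\sigma_z$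 are the Pauli matrices. In (1), $\gamma'=\mathrm{id}$ or $\gamma'=\mathrm{st}=\mathrm{Ad}_{\sigma_z}$ on $M_2(\mathbb{C})$. $\mathbb{H}=M_2(\mathbb{C})^{\mathfrak l_{0,2}}$ are the quaternions. *)

theory Defs
  imports "HOL-Analysis.Analysis" "HOL-Library.Multiset"
begin

section \<open>Complex C*-algebras\<close>

text \<open>Not necessarily unital. The given algebra \<open>A\<close> is a type of this class.\<close>

class cstar_algebra = real_normed_algebra + banach +
  fixes scaleC :: "complex \<Rightarrow> 'a \<Rightarrow> 'a"
    and star :: "'a \<Rightarrow> 'a"
  assumes scaleC_add_right: "scaleC c (x + y) = scaleC c x + scaleC c y"
    and scaleC_add_left: "scaleC (c + d) x = scaleC c x + scaleC d x"
    and scaleC_scaleC: "scaleC c (scaleC d x) = scaleC (c * d) x"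
    and scaleC_of_real: "scaleC (complex_of_real t) x = t *\<^sub>R x"
    and mult_scaleC_left: "scaleC c x * y = scaleC c (x * y)"
    and mult_scaleC_right: "x * scaleC c y = scaleC c (x * y)"
    and norm_scaleC: "norm (scaleC c x) = cmod c * norm x"
    and star_add: "star (x + y) = star x + star y"
    and star_scaleC: "star (scaleC c x) = scaleC (cnj c) (star x)"
    and star_mult: "star (x * y) = star y * star x"
    and star_star: "star (star x) = x"
    and cstar_identity: "norm (star x * x) = (norm x)\<^sup>2"

instantiation complex :: cstar_algebra
begin

definition scaleC_complex :: "complex \<Rightarrow> complex \<Rightarrow> complex"
  where "scaleC_complex c x = c * x"

definition star_complex :: "complex \<Rightarrow> complex"
  where "star_complex x = cnj x"

instance
  by standard
    (auto simp: scaleC_complex_def star_complex_def algebra_simps norm_mult power2_eq_square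
      scaleR_conv_of_real)

end


section \<open>Graded *-algebras\<close>

text \<open>
  The algebras built from \<open>A\<close> (multiplier algebra, matrices, graded tensor products, real fixed
  point algebras) are handled as *-algebras on a carrier set, over the scalars \<open>'k\<close> (the
  complex or the real numbers), together with a grading automorphism. No norm is recorded: the
  C*-norm of a C*-algebra is determined by its *-algebra structure, and *-isomorphisms between
  C*-algebras are isometric.
\<close>

record ('a, 'k) galg =
  carr :: "'a set"
  nul :: 'a
  add :: "'a \<Rightarrow> 'a \<Rightarrow> 'a"
  scl :: "'k \<Rightarrow> 'a \<Rightarrow> 'a"
  mul :: "'a \<Rightarrow> 'a \<Rightarrow> 'a"
  adj :: "'a \<Rightarrow> 'a"
  grd :: "'a \<Rightarrow> 'a"

definition graded_alg :: "('a::cstar_algebra \<Rightarrow> 'a) \<Rightarrow> ('a, complex) galg"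
  where "graded_alg \<gamma> =
    \<lparr>carr = UNIV, nul = 0, add = (+), scl = scaleC, mul = (*), adj = star, grd = \<gamma>\<rparr>"

definition star_iso :: "('a, 'k) galg \<Rightarrow> ('b, 'k) galg \<Rightarrow> ('a \<Rightarrow> 'b) \<Rightarrow> bool"
  where "star_iso B C \<phi> \<longleftrightarrow>
    bij_betw \<phi> (carr B) (carr C) \<and>
    (\<forall>x\<in>carr B. \<forall>y\<in>carr B. \<phi> (add B x y) = add C (\<phi> x) (\<phi> y)) \<and>
    (\<forall>c. \<forall>x\<in>carr B. \<phi> (scl B c x) = scl C c (\<phi> x)) \<and>
    (\<forall>x\<in>carr B. \<forall>y\<in>carr B. \<phi> (mul B x y) = mul C (\<phi> x) (\<phi> y)) \<and>
    (\<forall>x\<in>carr B. \<phi> (adj B x) = adj C (\<phi> x))"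

definition graded_iso :: "('a, 'k) galg \<Rightarrow> ('b, 'k) galg \<Rightarrow> ('a \<Rightarrow> 'b) \<Rightarrow> bool"
  where "graded_iso B C \<phi> \<longleftrightarrow>
    star_iso B C \<phi> \<and> (\<forall>x\<in>carr B. \<phi> (grd B x) = grd C (\<phi> x))"

definition graded_isomorphic :: "('a, 'k) galg \<Rightarrow> ('b, 'k) galg \<Rightarrow> bool"
  where "graded_isomorphic B C \<longleftrightarrow> (\<exists>\<phi>. graded_iso B C \<phi>)"

definition grading :: "('a, 'k) galg \<Rightarrow> bool"
  where "grading B \<longleftrightarrow> star_iso B B (grd B) \<and> (\<forall>x\<in>carr B. grd B (grd B x) = x)"

definition real_structure :: "('a, complex) galg \<Rightarrow> ('a \<Rightarrow> 'a) \<Rightarrow> bool"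
  where "real_structure B f \<longleftrightarrow>
    bij_betw f (carr B) (carr B) \<and>
    (\<forall>x\<in>carr B. \<forall>y\<in>carr B. f (add B x y) = add B (f x) (f y)) \<and>
    (\<forall>c. \<forall>x\<in>carr B. f (scl B c x) = scl B (cnj c) (f x)) \<and>
    (\<forall>x\<in>carr B. \<forall>y\<in>carr B. f (mul B x y) = mul B (f x) (f y)) \<and>
    (\<forall>x\<in>carr B. f (adj B x) = adj B (f x)) \<and>
    (\<forall>x\<in>carr B. f (f x) = x) \<and>
    (\<forall>x\<in>carr B. f (grd B x) = grd B (f x))"

definition fixed_alg :: "('a, complex) galg \<Rightarrow> ('a \<Rightarrow> 'a) \<Rightarrow> ('a, real) galg"
  where "fixed_alg B f =
    \<lparr>carr = {x \<in> carr B. f x = x}, nul = nul B, add = add B,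
     scl = (\<lambda>t. scl B (complex_of_real t)), mul = mul B, adj = adj B, grd = grd B\<rparr>"


section \<open>The multiplier algebra\<close>

text \<open>
  Double centralizers \<open>(L, R)\<close>, where \<open>L a = m a\<close> and \<open>R a = a m\<close> for a multiplier \<open>m\<close>;
  boundedness of \<open>L\<close> and \<open>R\<close> is automatic for C*-algebras. The maps are
  extensional, so that equal multipliers are equal pairs of functions.
\<close>

definition linear_map_on :: "('a, 'k) galg \<Rightarrow> ('a \<Rightarrow> 'a) \<Rightarrow> bool"
  where "linear_map_on B T \<longleftrightarrow>
    (\<forall>x\<in>carr B. \<forall>y\<in>carr B. T (add B x y) = add B (T x) (T y)) \<and>
    (\<forall>c. \<forall>x\<in>carr B. T (scl B c x) = scl B c (T x))"

definition double_centralizers :: "('a, 'k) galg \<Rightarrow> (('a \<Rightarrow> 'a) \<times> ('a \<Rightarrow> 'a)) set"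
  where "double_centralizers B =
    {(L, R). L \<in> carr B \<rightarrow>\<^sub>E carr B \<and> R \<in> carr B \<rightarrow>\<^sub>E carr B \<and>
      linear_map_on B L \<and> linear_map_on B R \<and>
      (\<forall>a\<in>carr B. \<forall>b\<in>carr B.
        L (mul B a b) = mul B (L a) b \<and> R (mul B a b) = mul B a (R b) \<and>
        mul B a (L b) = mul B (R a) b)}"

text \<open>Extension of a (linear or anti-linear) multiplicative automorphism \<open>\<phi>\<close> to multipliers.\<close>

definition mext :: "('a, 'k) galg \<Rightarrow> ('a \<Rightarrow> 'a) \<Rightarrow>
    ('a \<Rightarrow> 'a) \<times> ('a \<Rightarrow> 'a) \<Rightarrow> ('a \<Rightarrow> 'a) \<times> ('a \<Rightarrow> 'a)"
  where "mext B \<phi> m =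
    ((\<lambda>a\<in>carr B. \<phi> (fst m (inv_into (carr B) \<phi> a))),
     (\<lambda>a\<in>carr B. \<phi> (snd m (inv_into (carr B) \<phi> a))))"

definition mult_alg :: "('a, 'k) galg \<Rightarrow> (('a \<Rightarrow> 'a) \<times> ('a \<Rightarrow> 'a), 'k) galg"
  where "mult_alg B =
    \<lparr>carr = double_centralizers B,
     nul = ((\<lambda>a\<in>carr B. nul B), (\<lambda>a\<in>carr B. nul B)),
     add = (\<lambda>m n. ((\<lambda>a\<in>carr B. add B (fst m a) (fst n a)),
                   (\<lambda>a\<in>carr B. add B (snd m a) (snd n a)))),
     scl = (\<lambda>c m. ((\<lambda>a\<in>carr B. scl B c (fst m a)), (\<lambda>a\<in>carr B. scl B c (snd m a)))),
     mul = (\<lambda>m n. (compose (carr B) (fst m) (fst n), compose (carr B) (snd n) (snd m))),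
     adj = (\<lambda>m. ((\<lambda>a\<in>carr B. adj B (snd m (adj B a))), (\<lambda>a\<in>carr B. adj B (fst m (adj B a))))),
     grd = mext B (grd B)\<rparr>"

definition mult_one :: "('a, 'k) galg \<Rightarrow> ('a \<Rightarrow> 'a) \<times> ('a \<Rightarrow> 'a)"
  where "mult_one B = ((\<lambda>a\<in>carr B. a), (\<lambda>a\<in>carr B. a))"

definition mult_unitary :: "('a, 'k) galg \<Rightarrow> ('a \<Rightarrow> 'a) \<times> ('a \<Rightarrow> 'a) \<Rightarrow> bool"
  where "mult_unitary B u \<longleftrightarrow> u \<in> carr (mult_alg B) \<and>
    mul (mult_alg B) u (adj (mult_alg B) u) = mult_one B \<and>
    mul (mult_alg B) (adj (mult_alg B) u) u = mult_one B"

text \<open>\<open>u a u\<^sup>*\<close>\<close>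

definition Ad :: "('a, 'k) galg \<Rightarrow> ('a \<Rightarrow> 'a) \<times> ('a \<Rightarrow> 'a) \<Rightarrow> 'a \<Rightarrow> 'a"
  where "Ad B u a = fst u (snd (adj (mult_alg B) u) a)"

definition mult_center :: "('a, 'k) galg \<Rightarrow> (('a \<Rightarrow> 'a) \<times> ('a \<Rightarrow> 'a)) set"
  where "mult_center B =
    {z \<in> carr (mult_alg B). \<forall>m\<in>carr (mult_alg B). mul (mult_alg B) z m = mul (mult_alg B) m z}"

definition mult_spectrum :: "('a, complex) galg \<Rightarrow> ('a \<Rightarrow> 'a) \<times> ('a \<Rightarrow> 'a) \<Rightarrow> complex set"
  where "mult_spectrum B m =
    {c. \<not> (\<exists>v\<in>carr (mult_alg B).
      let d = add (mult_alg B) (scl (mult_alg B) c (mult_one B)) (scl (mult_alg B) (-1) m)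
      in mul (mult_alg B) d v = mult_one B \<and> mul (mult_alg B) v d = mult_one B)}"

text \<open>
  The unital characters of the center of the multiplier algebra; they are automatically
  continuous and *-preserving. The weak-* topology is that of pointwise convergence.
\<close>

definition central_characters ::
    "('a, complex) galg \<Rightarrow> (('a \<Rightarrow> 'a) \<times> ('a \<Rightarrow> 'a) \<Rightarrow> complex) set"
  where "central_characters B =
    {\<phi> \<in> mult_center B \<rightarrow>\<^sub>E UNIV.
      (\<forall>y\<in>mult_center B. \<forall>z\<in>mult_center B.
        \<phi> (add (mult_alg B) y z) = \<phi> y + \<phi> z \<and> \<phi> (mul (mult_alg B) y z) = \<phi> y * \<phi> z) \<and>
      (\<forall>c. \<forall>z\<in>mult_center B. \<phi> (scl (mult_alg B) c z) = c * \<phi> z) \<and>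
      \<phi> (mult_one B) = 1}"

definition gelfand_spectrum ::
    "('a, complex) galg \<Rightarrow> (('a \<Rightarrow> 'a) \<times> ('a \<Rightarrow> 'a) \<Rightarrow> complex) topology"
  where "gelfand_spectrum B =
    subtopology (product_topology (\<lambda>_. euclidean) (mult_center B)) (central_characters B)"


section \<open>Inner related real structures, relative signs, inner conjugacy\<close>

definition balanced :: "('a, complex) galg \<Rightarrow> ('a \<Rightarrow> 'a) \<Rightarrow> bool"
  where "balanced B f \<longleftrightarrow>
    (\<exists>u. mult_unitary B u \<and> adj (mult_alg B) u = u \<and>
      grd (mult_alg B) u = scl (mult_alg B) (-1) u \<and> mext B f u = u)"

definition generator ::
    "('a, complex) galg \<Rightarrow> ('a \<Rightarrow> 'a) \<Rightarrow> ('a \<Rightarrow> 'a) \<Rightarrow> ('a \<Rightarrow> 'a) \<times> ('a \<Rightarrow> 'a) \<Rightarrow> bool"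
  where "generator B r f \<Theta> \<longleftrightarrow> mult_unitary B \<Theta> \<and> (\<forall>a\<in>carr B. r (f a) = Ad B \<Theta> a)"

definition inner_related :: "('a, complex) galg \<Rightarrow> ('a \<Rightarrow> 'a) \<Rightarrow> ('a \<Rightarrow> 'a) \<Rightarrow> bool"
  where "inner_related B r f \<longleftrightarrow> (\<exists>\<Theta>. generator B r f \<Theta>)"

definition locally_homogeneous ::
    "('a, complex) galg \<Rightarrow> ('a \<Rightarrow> 'a) \<times> ('a \<Rightarrow> 'a) \<Rightarrow> bool"
  where "locally_homogeneous B u \<longleftrightarrow>
    (let d = mul (mult_alg B) u (grd (mult_alg B) (adj (mult_alg B) u))
     in d \<in> mult_center B \<and> mul (mult_alg B) d d = mult_one B)"

definition condA1 :: "('a, complex) galg \<Rightarrow> ('a \<Rightarrow> 'a) \<Rightarrow> bool"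
  where "condA1 B f \<longleftrightarrow>
    (\<forall>z\<in>mult_center B. mext B f (adj (mult_alg B) z) = z \<and> grd (mult_alg B) z = z)"

definition condA2 :: "('a, complex) galg \<Rightarrow> ('a \<Rightarrow> 'a) \<Rightarrow> ('a \<Rightarrow> 'a) \<Rightarrow> bool"
  where "condA2 B r f \<longleftrightarrow>
    (\<exists>\<Theta> z. generator B r f \<Theta> \<and> cmod z = 1 \<and>
      z \<notin> mult_spectrum B \<Theta> \<and> - z \<notin> mult_spectrum B \<Theta>)"

definition condB2 :: "('a, complex) galg \<Rightarrow> ('a \<Rightarrow> 'a) \<Rightarrow> ('a \<Rightarrow> 'a) \<Rightarrow> bool"
  where "condB2 B r f \<longleftrightarrow>
    (\<exists>\<Theta>. generator B r f \<Theta> \<and> locally_homogeneous B \<Theta> \<and> finite (mult_spectrum B \<Theta>))"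

text \<open>
  \<open>(\<eta>1, \<eta>2)\<close> are the relative signs computed with some admissible generator: any generator under
  (A1), any generator with finite spectrum under (B2).
\<close>

definition relative_signs ::
    "('a, complex) galg \<Rightarrow> ('a \<Rightarrow> 'a) \<Rightarrow> ('a \<Rightarrow> 'a) \<Rightarrow> complex \<times> complex \<Rightarrow> bool"
  where "relative_signs B r f = (\<lambda>(\<eta>1, \<eta>2). \<exists>\<Theta>. generator B r f \<Theta> \<and>
    (condA1 B f \<or> condB2 B r f \<and> finite (mult_spectrum B \<Theta>)) \<and>
    mul (mult_alg B) \<Theta> (mext B f \<Theta>) = scl (mult_alg B) \<eta>1 (mult_one B) \<and>
    mul (mult_alg B) \<Theta> (grd (mult_alg B) (adj (mult_alg B) \<Theta>)) =
      scl (mult_alg B) \<eta>2 (mult_one B))"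

definition inner_conjugate :: "('a, complex) galg \<Rightarrow> ('a \<Rightarrow> 'a) \<Rightarrow> ('a \<Rightarrow> 'a) \<Rightarrow> bool"
  where "inner_conjugate B r s \<longleftrightarrow>
    (\<exists>w. mult_unitary B w \<and>
      (\<forall>a\<in>carr B. s a = Ad B w (r (inv_into (carr B) (Ad B w) a))) \<and>
      (\<forall>a\<in>carr B. Ad B w (grd B a) = grd B (Ad B w a)))"

text \<open>Inner conjugacy of real structures on possibly different graded algebras.\<close>

definition inner_conjugate_triples ::
    "('a, complex) galg \<Rightarrow> ('a \<Rightarrow> 'a) \<Rightarrow> ('b, complex) galg \<Rightarrow> ('b \<Rightarrow> 'b) \<Rightarrow> bool"
  where "inner_conjugate_triples B r C s \<longleftrightarrow>
    (\<exists>\<phi>. graded_iso B C \<phi> \<and> inner_conjugate C (\<lambda>c. \<phi> (r (inv_into (carr B) \<phi> c))) s)"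


section \<open>Graded tensor products\<close>

text \<open>
  The algebraic tensor product over \<open>'k\<close>; it is already complete when, as in all uses below, the
  second factor is finite-dimensional. The multiset of the pairs \<open>(a\<^sub>i, b\<^sub>i)\<close> stands for the
  sum of the \<open>a\<^sub>i \<otimes> b\<^sub>i\<close>, and \<open>tensor_eq\<close> is the congruence generated by bilinearity.
\<close>

inductive tensor_eq ::
    "('a, 'k) galg \<Rightarrow> ('b, 'k) galg \<Rightarrow> ('a \<times> 'b) multiset \<Rightarrow> ('a \<times> 'b) multiset \<Rightarrow> bool"
  for A :: "('a, 'k) galg" and B :: "('b, 'k) galg"
  where
    refl: "set_mset M \<subseteq> carr A \<times> carr B \<Longrightarrow> tensor_eq A B M M"
  | sym: "tensor_eq A B M N \<Longrightarrow> tensor_eq A B N M"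
  | trans: "tensor_eq A B M N \<Longrightarrow> tensor_eq A B N P \<Longrightarrow> tensor_eq A B M P"
  | plus: "tensor_eq A B M M' \<Longrightarrow> tensor_eq A B N N' \<Longrightarrow> tensor_eq A B (M + N) (M' + N')"
  | nul: "b \<in> carr B \<Longrightarrow> tensor_eq A B {#(nul A, b)#} {#}"
  | add_left: "a \<in> carr A \<Longrightarrow> a' \<in> carr A \<Longrightarrow> b \<in> carr B \<Longrightarrow>
      tensor_eq A B {#(add A a a', b)#} {#(a, b), (a', b)#}"
  | add_right: "a \<in> carr A \<Longrightarrow> b \<in> carr B \<Longrightarrow> b' \<in> carr B \<Longrightarrow>
      tensor_eq A B {#(a, add B b b')#} {#(a, b), (a, b')#}"
  | scl: "a \<in> carr A \<Longrightarrow> b \<in> carr B \<Longrightarrow>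
      tensor_eq A B {#(scl A c a, b)#} {#(a, scl B c b)#}"

definition tensor_class ::
    "('a, 'k) galg \<Rightarrow> ('b, 'k) galg \<Rightarrow> ('a \<times> 'b) multiset \<Rightarrow> ('a \<times> 'b) multiset set"
  where "tensor_class A B M = {N. tensor_eq A B M N}"

text \<open>
  Operations on classes induced by operations on formal sums that respect \<open>tensor_eq\<close> (the union
  is then over equal classes).
\<close>

definition tlift ::
    "('a, 'k) galg \<Rightarrow> ('b, 'k) galg \<Rightarrow> (('a \<times> 'b) multiset \<Rightarrow> ('a \<times> 'b) multiset) \<Rightarrow>
     ('a \<times> 'b) multiset set \<Rightarrow> ('a \<times> 'b) multiset set"
  where "tlift A B F X = (\<Union>M\<in>X. tensor_class A B (F M))"

definition tlift2 ::
    "('a, 'k) galg \<Rightarrow> ('b, 'k) galg \<Rightarrow>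
     (('a \<times> 'b) multiset \<Rightarrow> ('a \<times> 'b) multiset \<Rightarrow> ('a \<times> 'b) multiset) \<Rightarrow>
     ('a \<times> 'b) multiset set \<Rightarrow> ('a \<times> 'b) multiset set \<Rightarrow> ('a \<times> 'b) multiset set"
  where "tlift2 A B F X Y = (\<Union>M\<in>X. \<Union>N\<in>Y. tensor_class A B (F M N))"

text \<open>\<open>f \<otimes> g\<close>, for \<open>f\<close> and \<open>g\<close> both linear or both anti-linear.\<close>

definition tmap ::
    "('a, 'k) galg \<Rightarrow> ('b, 'k) galg \<Rightarrow> ('a \<Rightarrow> 'a) \<Rightarrow> ('b \<Rightarrow> 'b) \<Rightarrow>
     ('a \<times> 'b) multiset set \<Rightarrow> ('a \<times> 'b) multiset set"
  where "tmap A B f g = tlift A B (image_mset (map_prod f g))"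

definition even_part :: "('b, 'k::field) galg \<Rightarrow> 'b \<Rightarrow> 'b"
  where "even_part B b = scl B (1 / 2) (add B b (grd B b))"

definition odd_part :: "('b, 'k::field) galg \<Rightarrow> 'b \<Rightarrow> 'b"
  where "odd_part B b = scl B (1 / 2) (add B b (scl B (-1) (grd B b)))"

text \<open>
  The bilinear extension of \<open>(a \<otimes> b) (a' \<otimes> b') = (-1) ^ (|a'| |b|) a a' \<otimes> b b'\<close>: when \<open>b\<close> is odd,
  the factor \<open>(-1) ^ |a'|\<close> replaces \<open>a'\<close> by \<open>grd A a'\<close>. Likewise
  \<open>(a \<otimes> b)\<^sup>* = (-1) ^ (|a| |b|) a\<^sup>* \<otimes> b\<^sup>*\<close>, the involution for which \<open>a \<otimes> 1\<close> and \<open>1 \<otimes> b\<close>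
  have the adjoints \<open>a\<^sup>* \<otimes> 1\<close> and \<open>1 \<otimes> b\<^sup>*\<close>.
\<close>

definition gtensor_mul ::
    "('a, 'k) galg \<Rightarrow> ('b, 'k::field) galg \<Rightarrow>
     ('a \<times> 'b) multiset \<Rightarrow> ('a \<times> 'b) multiset \<Rightarrow> ('a \<times> 'b) multiset"
  where "gtensor_mul A B M N =
    (\<Sum>(a, b)\<in>#M. \<Sum>(a', b')\<in>#N.
      {#(mul A a a', mul B (even_part B b) b'),
        (mul A a (grd A a'), mul B (odd_part B b) b')#})"

definition gtensor_adj ::
    "('a, 'k) galg \<Rightarrow> ('b, 'k::field) galg \<Rightarrow> ('a \<times> 'b) multiset \<Rightarrow> ('a \<times> 'b) multiset"
  where "gtensor_adj A B M =
    (\<Sum>(a, b)\<in>#M. {#(adj A a, adj B (even_part B b)), (adj A (grd A a), adj B (odd_part B b))#})"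

definition gtensor ::
    "('a, 'k) galg \<Rightarrow> ('b, 'k::field) galg \<Rightarrow> (('a \<times> 'b) multiset set, 'k) galg"
    (infixl "\<otimes>\<^sub>g" 70)
  where "A \<otimes>\<^sub>g B =
    \<lparr>carr = tensor_class A B ` {M. set_mset M \<subseteq> carr A \<times> carr B},
     nul = tensor_class A B {#},
     add = tlift2 A B (+),
     scl = (\<lambda>c. tlift A B (image_mset (map_prod (scl A c) id))),
     mul = tlift2 A B (gtensor_mul A B),
     adj = tlift A B (gtensor_adj A B),
     grd = tmap A B (grd A) (grd B)\<rparr>"


section \<open>Two by two matrices\<close>

definition entrywise :: "('a \<Rightarrow> 'b) \<Rightarrow> 'a^2^2 \<Rightarrow> 'b^2^2"
  where "entrywise \<phi> x = (\<chi> i j. \<phi> (x $ i $ j))"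

text \<open>For \<open>'a = complex\<close> this is the algebra of complex matrices.\<close>

definition mat2_alg :: "('a::cstar_algebra^2^2 \<Rightarrow> 'a^2^2) \<Rightarrow> ('a^2^2, complex) galg"
  where "mat2_alg g =
    \<lparr>carr = UNIV, nul = 0, add = (+), scl = (\<lambda>c. entrywise (scaleC c)),
     mul = (\<lambda>x y. \<chi> i j. \<Sum>k\<in>UNIV. x $ i $ k * y $ k $ j),
     adj = (\<lambda>x. \<chi> i j. star (x $ j $ i)), grd = g\<rparr>"

definition real_mat2_alg :: "(real^2^2, real) galg"
  where "real_mat2_alg =
    \<lparr>carr = UNIV, nul = 0, add = (+), scl = scaleR, mul = (**), adj = transpose, grd = id\<rparr>"

definition sigma_x :: "complex^2^2"
  where "sigma_x = vector [vector [0, 1], vector [1, 0]]"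

definition sigma_y :: "complex^2^2"
  where "sigma_y = vector [vector [0, - \<i>], vector [\<i>, 0]]"

definition sigma_z :: "complex^2^2"
  where "sigma_z = vector [vector [1, 0], vector [0, -1]]"

definition Ad_mat :: "complex^2^2 \<Rightarrow> complex^2^2 \<Rightarrow> complex^2^2"
  where "Ad_mat u x = u ** x ** entrywise cnj (transpose u)"

definition l11 :: "complex^2^2 \<Rightarrow> complex^2^2"
  where "l11 = entrywise cnj"

definition l20 :: "complex^2^2 \<Rightarrow> complex^2^2"
  where "l20 = Ad_mat sigma_x \<circ> entrywise cnj"

definition l02 :: "complex^2^2 \<Rightarrow> complex^2^2"
  where "l02 = Ad_mat sigma_y \<circ> entrywise cnj"

text \<open>The complex Clifford algebra on two generators, and the quaternions (trivially graded).\<close>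

definition CCl2_alg :: "(complex^2^2, complex) galg"
  where "CCl2_alg = mat2_alg (Ad_mat sigma_z)"

definition quaternion_alg :: "(complex^2^2, real) galg"
  where "quaternion_alg = fixed_alg (mat2_alg id) l02"


section \<open>Clifford algebras\<close>

text \<open>
  The Clifford algebra with generators \<open>e 0, ..., e (r + s - 1)\<close>, of square \<open>1\<close> and
  self-adjoint for \<open>i < r\<close>, of square \<open>-1\<close> and anti-self-adjoint for \<open>i \<ge> r\<close>. A function
  \<open>x\<close> on the subsets of \<open>{..<r + s}\<close> stands for the linear combination with coefficients \<open>x S\<close>
  of the monomials \<open>e S\<close>, the products of the \<open>e i\<close> with \<open>i \<in> S\<close> in increasing order. In
  \<open>e S * e T\<close>, sorting contributes a sign for each pair \<open>i \<in> S\<close>, \<open>j \<in> T\<close> with \<open>j < i\<close>, and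
  each \<open>i \<in> S \<inter> T\<close> contributes the square of \<open>e i\<close>; the adjoint of \<open>e S\<close> is the reversed
  product of the \<open>\<plusminus>e i\<close>. The map \<open>cj\<close> is the conjugation of the scalars.
\<close>

definition clifford_alg ::
    "('k::field \<Rightarrow> 'k) \<Rightarrow> nat \<Rightarrow> nat \<Rightarrow> (nat set \<Rightarrow> 'k, 'k) galg"
  where "clifford_alg cj r s =
    \<lparr>carr = {x. \<forall>S. x S \<noteq> 0 \<longrightarrow> S \<subseteq> {..<r + s}},
     nul = (\<lambda>S. 0),
     add = (\<lambda>x y S. x S + y S),
     scl = (\<lambda>c x S. c * x S),
     mul = (\<lambda>x y U. \<Sum>S\<in>Pow {..<r + s}. \<Sum>T\<in>Pow {..<r + s}.
       if (S - T) \<union> (T - S) = U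
       then (-1) ^ (card {(i, j). i \<in> S \<and> j \<in> T \<and> j < i} + card (S \<inter> T \<inter> {r..})) * x S * y T
       else 0),
     adj = (\<lambda>x S. (-1) ^ (card S * (card S - 1) div 2 + card (S \<inter> {r..})) * cj (x S)),
     grd = (\<lambda>x S. (-1) ^ card S * x S)\<rparr>"

definition Cl_alg :: "nat \<Rightarrow> nat \<Rightarrow> (nat set \<Rightarrow> real, real) galg"
  where "Cl_alg r s = clifford_alg id r s"

definition CCl_alg :: "nat \<Rightarrow> (nat set \<Rightarrow> complex, complex) galg"
  where "CCl_alg n = clifford_alg cnj n 0"

text \<open>
  The real structure on \<open>CCl_alg (r + s)\<close> fixing \<open>e i\<close> for \<open>i < r\<close> and \<open>\<i> e i\<close> for \<open>i \<ge> r\<close>,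
  which are therefore the generators of its real subalgebra, isomorphic to \<open>Cl_alg r s\<close>.
\<close>

definition l_cl :: "nat \<Rightarrow> nat \<Rightarrow> (nat set \<Rightarrow> complex) \<Rightarrow> nat set \<Rightarrow> complex"
  where "l_cl r s x S = (-1) ^ card (S \<inter> {r..<r + s}) * cnj (x S)"

definition CCl1_alg :: "(complex \<times> complex, complex) galg"
  where "CCl1_alg =
    \<lparr>carr = UNIV, nul = 0, add = (+), scl = (\<lambda>c (a, b). (c * a, c * b)),
     mul = (\<lambda>(a, b) (a', b'). (a * a', b * b')), adj = (\<lambda>(a, b). (cnj a, cnj b)),
     grd = (\<lambda>(a, b). (b, a))\<rparr>"

definition l10 :: "complex \<times> complex \<Rightarrow> complex \<times> complex"
  where "l10 = (\<lambda>(a, b). (cnj a, cnj b))"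

definition l01 :: "complex \<times> complex \<Rightarrow> complex \<times> complex"
  where "l01 = (\<lambda>(a, b). (cnj b, cnj a))"


section \<open>The two parts of the conclusion, for given second factor\<close>

text \<open>
  \<open>M\<^sub>2(A)\<close> with \<open>\<gamma>\<^sub>2\<close> and \<open>r\<^sub>2\<close> is inner conjugate to \<open>A \<otimes>\<^sub>g C\<close> with \<open>f' \<otimes> r'\<close>, and its real
  subalgebra is isomorphic to \<open>A\<^sup>f\<^sup>' \<otimes>\<^sub>g D\<close>.
\<close>

definition mat2_conj_tensor ::
    "('a::cstar_algebra \<Rightarrow> 'a) \<Rightarrow> ('a \<Rightarrow> 'a) \<Rightarrow> ('a \<Rightarrow> 'a) \<Rightarrow>
     ('b, complex) galg \<Rightarrow> ('b \<Rightarrow> 'b) \<Rightarrow> ('d, real) galg \<Rightarrow> bool"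
  where "mat2_conj_tensor \<gamma> r f' C r' D \<longleftrightarrow>
    inner_conjugate_triples
      (mat2_alg (entrywise \<gamma>)) (entrywise r)
      (graded_alg \<gamma> \<otimes>\<^sub>g C) (tmap (graded_alg \<gamma>) C f' r') \<and>
    graded_isomorphic
      (fixed_alg (mat2_alg (entrywise \<gamma>)) (entrywise r))
      (fixed_alg (graded_alg \<gamma>) f' \<otimes>\<^sub>g D)"

text \<open>The same for \<open>M\<^sub>2(A) \<otimes>\<^sub>g CCl1_alg\<close> with \<open>r\<^sub>2 \<otimes> l\<close> in place of \<open>M\<^sub>2(A)\<close>.\<close>

definition mat2_Cl1_conj_tensor ::
    "('a::cstar_algebra \<Rightarrow> 'a) \<Rightarrow> ('a \<Rightarrow> 'a) \<Rightarrow> (complex \<times> complex \<Rightarrow> complex \<times> complex) \<Rightarrow>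
     ('a \<Rightarrow> 'a) \<Rightarrow> ('b, complex) galg \<Rightarrow> ('b \<Rightarrow> 'b) \<Rightarrow> ('d, real) galg \<Rightarrow> bool"
  where "mat2_Cl1_conj_tensor \<gamma> r l f' C r' D \<longleftrightarrow>
    inner_conjugate_triples
      (mat2_alg (entrywise \<gamma>) \<otimes>\<^sub>g CCl1_alg)
      (tmap (mat2_alg (entrywise \<gamma>)) CCl1_alg (entrywise r) l)
      (graded_alg \<gamma> \<otimes>\<^sub>g C) (tmap (graded_alg \<gamma>) C f' r') \<and>
    graded_isomorphic
      (fixed_alg (mat2_alg (entrywise \<gamma>) \<otimes>\<^sub>g CCl1_alg)
        (tmap (mat2_alg (entrywise \<gamma>)) CCl1_alg (entrywise r) l))
      (fixed_alg (graded_alg \<gamma>) f' \<otimes>\<^sub>g D)"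

end

theory Submission
  imports Defs "HOL-Library.Function_Algebras"
begin

text \<open>
  A generator \<open>\<theta>\<close> satisfies \<open>f \<theta> = \<eta>\<^sub>1 \<theta>\<^sup>*\<close> and \<open>\<gamma> \<theta> = \<eta>\<^sub>2 \<theta>\<close>, and after multiplication by a phase the points
  \<open>\<plusminus>\<i>\<close> lie outside its spectrum. Then \<open>\<theta> = \<epsilon> v\<^sup>2\<close>, where the symmetry \<open>\<epsilon>\<close> is the sign of the real
  part of \<open>\<theta>\<close> and \<open>v\<close> is the principal square root of \<open>\<epsilon> \<theta>\<close>; here \<open>f v = v\<^sup>*\<close> and \<open>\<gamma> v = v\<close>, so that
  conjugation by \<open>v\<^sup>*\<close> replaces \<open>\<theta>\<close> by \<open>\<epsilon>\<close>. If both signs are \<open>1\<close>, one may take \<open>\<epsilon> = 1\<close>. Otherwise \<open>f\<close> or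
  \<open>\<gamma>\<close> acts on the spectral projections \<open>P, Q\<close> of \<open>\<epsilon>\<close> in a known way, and an explicit two by two unitary
  \<open>P \<otimes> a + Q \<otimes> b\<close> with scalar \<open>a, b\<close> carries \<open>Ad \<epsilon> \<circ> f\<close> and \<open>\<gamma>\<close> to \<open>Ad \<sigma> \<circ> f\<close> and to \<open>\<gamma>\<close> or
  \<open>Ad \<sigma>\<^sub>z \<circ> \<gamma>\<close>, with a Pauli matrix \<open>\<sigma>\<close>. Functional calculus is only needed for the square roots,
  which are strong limits of an elementary iteration.

  The tensor products are identified with concrete algebras: with matrices over \<open>A\<close>, and with pairs
  \<open>x + y \<epsilon>\<close> for one further Clifford generator.
\<close>

section \<open>Multipliers of a C*-algebra\<close>

text \<open>Only \<open>\<theta> * \<theta>\<close> is free of the signs: \<open>f\<close> sends it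
  to its adjoint and \<open>\<gamma>\<close> fixes it. Its principal root \<open>q\<close> and the
  root \<open>v\<close> of \<open>q\<close> inherit both relations, and the signs are left to the
  symmetry \<open>\<epsilon>\<close>. This is why a gap at both \<open>\<i>\<close> and
  \<open>- \<i>\<close> is asked for. A sign \<open>-1\<close> makes \<open>f\<close> or
  \<open>\<gamma>\<close> exchange the two spectral projections of \<open>\<epsilon>\<close>, so a
  choice made on one projection dictates the choice on the other; scalar two by two matrices give
  the freedom to satisfy both.

  The real structure \<open>f \<circ> \<gamma>\<close> originates in the graded tensor product.
  There \<open>a\<close> becomes the diagonal matrix with entries \<open>a\<close> and
  \<open>\<gamma> a\<close>, since it has to obey the sign rule with off-diagonal matrices, and a
  Pauli matrix that exchanges the entries turns \<open>f\<close> into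
  \<open>f \<circ> \<gamma>\<close>.

  No norm is given on multipliers. Estimates concern the maps \<open>a \<mapsto> m a\<close> and
  \<open>a \<mapsto> a m\<close> on \<open>A\<close>, and limits are compatible with
  \<open>f\<close> and \<open>\<gamma>\<close> because these are isometric, which is itself derived
  from the algebraic axioms.\<close>

lemma scaleC_one [simp]: "scaleC 1 (x::'a::cstar_algebra) = x"
  using scaleC_of_real[of 1 x] by simp

lemma scaleC_zero_left [simp]: "scaleC 0 (x::'a::cstar_algebra) = 0"
  using scaleC_of_real[of 0 x] by simp

lemma scaleC_minus_one: "scaleC (-1) (x::'a::cstar_algebra) = - x"
  using scaleC_of_real[of "-1" x] by simp

lemma scaleC_zero_right [simp]: "scaleC c (0::'a::cstar_algebra) = 0"
  using scaleC_add_right[of c 0 "0::'a"] by simp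

lemma scaleC_minus_right: "scaleC c (- x) = - scaleC c (x::'a::cstar_algebra)"
  using scaleC_add_right[of c x "- x"] by (simp add: eq_neg_iff_add_eq_0 add.commute)

lemma scaleC_diff_right: "scaleC c (x - y) = scaleC c x - scaleC c (y::'a::cstar_algebra)"
  using scaleC_add_right[of c x "- y"] by (simp add: scaleC_minus_right)

lemma scaleC_minus_left: "scaleC (- c) x = - scaleC c (x::'a::cstar_algebra)"
  using scaleC_add_left[of c "- c" x] by (simp add: eq_neg_iff_add_eq_0 add.commute)

lemma star_zero [simp]: "star (0::'a::cstar_algebra) = 0"
  using star_add[of 0 "0::'a"] by simp

lemma star_minus: "star (- x) = - star (x::'a::cstar_algebra)"
  using star_add[of x "- x"] by (simp add: eq_neg_iff_add_eq_0 add.commute)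

lemma star_diff: "star (x - y) = star x - star (y::'a::cstar_algebra)"
  using star_add[of x "- y"] by (simp add: star_minus)

lemma star_star_simp [simp]: "star (star x) = (x::'a::cstar_algebra)"
  by (rule star_star)

lemma norm_star [simp]: "norm (star x) = norm (x::'a::cstar_algebra)"
proof -
  have le: "norm y \<le> norm (star y)" for y :: 'a
  proof (cases "norm y = 0")
    case False
    have "norm y * norm y \<le> norm (star y) * norm y"
      using norm_mult_ineq[of "star y" y] cstar_identity[of y] by (simp add: power2_eq_square)
    with False show ?thesis by simp
  qed simp
  show ?thesis using le[of x] le[of "star x"] by simp
qed

lemma star_mult_self_eq_0: "star x * x = 0 \<Longrightarrow> x = (0::'a::cstar_algebra)"
  using cstar_identity[of x] by simp

text \<open>The choice \<open>c = star (x - y)\<close> is enough. This takes the place of a unit: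
  \<open>A\<close> may have none, so identities are tested by multiplication with elements of
  \<open>A\<close>.\<close>

lemma left_faithful: "(\<And>c. c * x = c * y) \<Longrightarrow> x = (y::'a::cstar_algebra)"
  using star_mult_self_eq_0[of "x - y"] by (simp add: right_diff_distrib)

lemma right_faithful: "(\<And>c. x * c = y * c) \<Longrightarrow> x = (y::'a::cstar_algebra)"
  using left_faithful[of "star x" "star y"] by (metis star_mult star_star)

text \<open>Only the product rules are imposed; additivity, complex linearity and the determination
  of \<open>R\<close> by \<open>L\<close> follow because multiplication in \<open>A\<close> is
  faithful. A type in place of a carrier set makes ring arithmetic available.\<close>

typedef (overloaded) ('a::cstar_algebra) multiplier =
  "{(L, R). (\<forall>a b. L (a * b) = L a * (b::'a)) \<and> (\<forall>a b. R (a * b) = a * R b) \<and>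
      (\<forall>a b. a * L b = R a * b)}"
  by (rule exI[of _ "(\<lambda>x. x, \<lambda>x. x)"]) auto

setup_lifting type_definition_multiplier

lift_definition lm :: "'a::cstar_algebra multiplier \<Rightarrow> 'a \<Rightarrow> 'a" is fst .
lift_definition rm :: "'a::cstar_algebra multiplier \<Rightarrow> 'a \<Rightarrow> 'a" is snd .

lemma lm_mult: "lm m (a * b) = lm m a * b"
  by transfer auto

lemma rm_mult: "rm m (a * b) = a * rm m b"
  by transfer auto

lemma lm_rm: "a * lm m b = rm m a * b"
  by transfer auto

lemma rm_eqI: "(\<And>a b. a * lm m b = t a * b) \<Longrightarrow> rm m a = t a"
  by (rule right_faithful) (simp flip: lm_rm)

lemma multiplier_eqI:
  assumes "\<And>a. lm m a = lm n a" shows "m = n"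
proof -
  have "rm m = rm n"
    by (rule ext, rule rm_eqI) (metis assms lm_rm)
  moreover have "lm m = lm n" using assms by blast
  ultimately show ?thesis by transfer (auto simp: prod_eq_iff)
qed

lemma lm_add: "lm m (a + b) = lm m a + lm m b"
  by (rule left_faithful) (simp add: lm_rm distrib_left)

lemma lm_scaleC: "lm m (scaleC c a) = scaleC c (lm m a)"
  by (rule left_faithful) (metis lm_rm mult_scaleC_right)

lemma rm_add: "rm m (a + b) = rm m a + rm m b"
  by (rule right_faithful) (metis lm_rm distrib_right)

lemma rm_scaleC: "rm m (scaleC c a) = scaleC c (rm m a)"
  by (rule right_faithful) (metis lm_rm mult_scaleC_left)

lemma lm_zero [simp]: "lm m 0 = 0"
  using lm_add[of m 0 0] by simp

lemma lm_minus: "lm m (- a) = - lm m a"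
  using lm_scaleC[of m "-1" a] by (simp add: scaleC_minus_one)

lemma rm_minus: "rm m (- a) = - rm m a"
  using rm_scaleC[of m "-1" a] by (simp add: scaleC_minus_one)

lemma lm_diff: "lm m (a - b) = lm m a - lm m b"
  using lm_add[of m a "- b"] by (simp add: lm_minus)

lemma rm_diff: "rm m (a - b) = rm m a - rm m b"
  using rm_add[of m a "- b"] by (simp add: rm_minus)

instantiation multiplier :: (cstar_algebra) "{ring, monoid_mult}"
begin

lift_definition zero_multiplier :: "'a multiplier" is "(\<lambda>a. 0, \<lambda>a. 0)" by auto
lift_definition one_multiplier :: "'a multiplier" is "(\<lambda>a. a, \<lambda>a. a)" by auto
lift_definition plus_multiplier :: "'a multiplier \<Rightarrow> 'a multiplier \<Rightarrow> 'a multiplier"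
  is "\<lambda>m n. (\<lambda>a. fst m a + fst n a, \<lambda>a. snd m a + snd n a)"
  by (auto simp: distrib_left distrib_right)
lift_definition minus_multiplier :: "'a multiplier \<Rightarrow> 'a multiplier \<Rightarrow> 'a multiplier"
  is "\<lambda>m n. (\<lambda>a. fst m a - fst n a, \<lambda>a. snd m a - snd n a)"
  by (auto simp: left_diff_distrib right_diff_distrib)
lift_definition uminus_multiplier :: "'a multiplier \<Rightarrow> 'a multiplier"
  is "\<lambda>m. (\<lambda>a. - fst m a, \<lambda>a. - snd m a)" by auto
lift_definition times_multiplier :: "'a multiplier \<Rightarrow> 'a multiplier \<Rightarrow> 'a multiplier"
  is "\<lambda>m n. (\<lambda>a. fst m (fst n a), \<lambda>a. snd n (snd m a))"
  by auto

lemma lm_simps [simp]: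
  "lm 0 a = 0" "lm 1 a = a" "lm (m + n) a = lm m a + lm n a" "lm (m - n) a = lm m a - lm n a"
  "lm (- m) a = - lm m a" "lm (m * n) a = lm m (lm n a)"
  by (transfer, simp)+

lemma rm_simps [simp]:
  "rm 0 a = 0" "rm 1 a = a" "rm (m + n) a = rm m a + rm n a" "rm (m - n) a = rm m a - rm n a"
  "rm (- m) a = - rm m a" "rm (m * n) a = rm n (rm m a)"
  by (transfer, simp)+

instance
  by standard (auto intro!: multiplier_eqI simp: lm_add)

end

lift_definition mscl :: "complex \<Rightarrow> 'a::cstar_algebra multiplier \<Rightarrow> 'a multiplier"
  is "\<lambda>c m. (\<lambda>a. scaleC c (fst m a), \<lambda>a. scaleC c (snd m a))"
  by (auto simp: mult_scaleC_left mult_scaleC_right)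

lift_definition mstar :: "'a::cstar_algebra multiplier \<Rightarrow> 'a multiplier"
  is "\<lambda>m. (\<lambda>a. star (snd m (star a)), \<lambda>a. star (fst m (star a)))"
  by (auto simp: star_mult) (metis star_mult star_star)

lift_definition emb :: "'a::cstar_algebra \<Rightarrow> 'a multiplier"
  is "\<lambda>x. (\<lambda>a. x * a, \<lambda>a. a * x)" by (auto simp: mult.assoc)

lemma mscl_lm [simp]: "lm (mscl c m) a = scaleC c (lm m a)" by transfer simp
lemma mscl_rm [simp]: "rm (mscl c m) a = scaleC c (rm m a)" by transfer simp
lemma mstar_lm [simp]: "lm (mstar m) a = star (rm m (star a))" by transfer simp
lemma mstar_rm [simp]: "rm (mstar m) a = star (lm m (star a))" by transfer simp
lemma emb_lm [simp]: "lm (emb x) a = x * a" by transfer simp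
lemma emb_rm [simp]: "rm (emb x) a = a * x" by transfer simp

lemma mscl_simps [simp]:
  "mscl c (m + n) = mscl c m + mscl c n" "mscl c (m - n) = mscl c m - mscl c n"
  "mscl c (- m) = - mscl c m" "mscl c 0 = 0" "mscl 1 m = m" "mscl 0 m = 0"
  "mscl c (mscl d m) = mscl (c * d) m" "mscl c m * n = mscl c (m * n)" "m * mscl c n = mscl c (m * n)"
  by (auto intro!: multiplier_eqI
    simp: scaleC_add_right scaleC_diff_right scaleC_minus_right scaleC_scaleC lm_scaleC)

lemma mscl_add_left: "mscl (c + d) m = mscl c m + mscl d m"
  by (auto intro!: multiplier_eqI simp: scaleC_add_left)

lemma mscl_minus_left: "mscl (- c) m = - mscl c m"
  by (auto intro!: multiplier_eqI simp: scaleC_minus_left)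

lemma mstar_simps [simp]:
  "mstar (m + n) = mstar m + mstar n" "mstar (m - n) = mstar m - mstar n" "mstar (- m) = - mstar m"
  "mstar 0 = 0" "mstar 1 = 1" "mstar (m * n) = mstar n * mstar m"
  "mstar (mscl c m) = mscl (cnj c) (mstar m)" "mstar (mstar m) = m" "mstar (emb a) = emb (star a)"
  by (auto intro!: multiplier_eqI simp: star_add star_diff star_minus star_scaleC star_mult)

lemma emb_simps [simp]:
  "emb (a + b) = emb a + emb b" "emb 0 = 0" "emb (- a) = - emb a" "emb (a - b) = emb a - emb b"
  "emb (scaleC c a) = mscl c (emb a)" "emb (a * b) = emb a * emb b"
  by (auto intro!: multiplier_eqI simp: distrib_right left_diff_distrib mult_scaleC_left mult.assoc)

lemma emb_lm_rm: "emb (lm m a) = m * emb a" "emb (rm m a) = emb a * m"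
  by (auto intro!: multiplier_eqI simp: lm_mult lm_rm)

lemma emb_inject [simp]: "emb a = emb b \<longleftrightarrow> a = b"
  by (metis emb_lm right_faithful)

text \<open>\<open>A\<close> is an essential ideal: commuting with \<open>A\<close> says
  \<open>lm m = rm m\<close>, and then an auxiliary factor \<open>c\<close> lets \<open>m\<close>
  pass from one side of \<open>n\<close> to the other. Used to see that two generators of one
  automorphism differ by a central factor.\<close>

lemma emb_commute_imp:
  assumes "\<And>a. m * emb a = emb a * m" shows "m * n = n * m"
proof (rule multiplier_eqI)
  fix a
  have *: "lm m a = rm m a" for a
    by (metis assms emb_inject emb_lm_rm)
  show "lm (m * n) a = lm (n * m) a"
  proof (rule right_faithful)
    fix c
    have "lm m (lm n a) * c = rm m (lm n a) * c" by (simp add: *)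
    also have "\<dots> = lm n a * lm m c" by (simp add: lm_rm)
    also have "\<dots> = lm n (a * lm m c)" by (simp add: lm_mult)
    also have "\<dots> = lm n (rm m a) * c" by (simp add: lm_rm lm_mult)
    finally show "lm (m * n) a * c = lm (n * m) a * c" by (simp add: *)
  qed
qed

section \<open>Unitary and invertible multipliers\<close>

definition munitary :: "'a::cstar_algebra multiplier \<Rightarrow> bool"
  where "munitary u \<longleftrightarrow> u * mstar u = 1 \<and> mstar u * u = 1"

definition minvertible :: "'a::cstar_algebra multiplier \<Rightarrow> bool"
  where "minvertible m \<longleftrightarrow> (\<exists>n. m * n = 1 \<and> n * m = 1)"

text \<open>By the C*-identity it suffices that the factor \<open>mstar u * u\<close> cancels in
  \<open>star (lm u a) * lm u a\<close>.\<close>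

lemma munitary_isometric:
  assumes "munitary u" shows "norm (lm u a) = norm a"
proof -
  have "star (lm u a) * lm u a = rm (mstar u) (star a) * lm u a" by simp
  also have "\<dots> = star a * lm (mstar u * u) a"
    by (simp only: lm_rm[symmetric] lm_simps)
  also have "\<dots> = star a * a" using assms by (simp add: munitary_def)
  finally have "(norm (lm u a))\<^sup>2 = (norm a)\<^sup>2" by (metis cstar_identity)
  then show ?thesis by simp
qed

lemma munitary_mstar [simp]: "munitary (mstar u) = munitary u"
  by (auto simp: munitary_def)

lemma munitary_isometric_rm:
  assumes "munitary u" shows "norm (rm u a) = norm a"
proof -
  have "norm (lm (mstar u) (star a)) = norm (star a)"
    by (rule munitary_isometric) (simp add: assms)
  then show ?thesis by simp
qed

section \<open>Square roots\<close>

text \<open>Stands for norm at most \<open>1\<close>, expressed by the two actions on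
  \<open>A\<close>.\<close>

definition contractive :: "'a::cstar_algebra multiplier \<Rightarrow> bool"
  where "contractive m \<longleftrightarrow> (\<forall>a. norm (lm m a) \<le> norm a \<and> norm (rm m a) \<le> norm a)"

text \<open>The iteration \<open>y \<mapsto> (x + y\<^sup>2) / 2\<close> converges to \<open>1 - sqrt (1 - x)\<close> whenever \<open>norm x \<le> 1\<close>:
  it is dominated by the scalar iteration \<open>t \<mapsto> (1 + t\<^sup>2) / 2\<close>.\<close>

primrec rootseq :: "'a::cstar_algebra multiplier \<Rightarrow> nat \<Rightarrow> 'a multiplier" where
  "rootseq x 0 = 0"
| "rootseq x (Suc k) = mscl (1/2) (x + rootseq x k * rootseq x k)"

primrec rootbd :: "nat \<Rightarrow> real" where
  "rootbd 0 = 0"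
| "rootbd (Suc k) = (1 + rootbd k * rootbd k) / 2"

lemma rootbd_range: "0 \<le> rootbd k \<and> rootbd k \<le> 1"
  by (induction k) (auto simp: mult_le_one)

lemma rootbd_mono_Suc: "rootbd k \<le> rootbd (Suc k)"
  using zero_le_square[of "rootbd k - 1"] by (simp add: algebra_simps)

lemma rootbd_mono: "m \<le> n \<Longrightarrow> rootbd m \<le> rootbd n"
  using lift_Suc_mono_le[of rootbd, OF rootbd_mono_Suc] by blast

text \<open>The iterates are polynomials in \<open>x\<close>.\<close>

lemma rootseq_commute: "m * x = x * m \<Longrightarrow> m * rootseq x k = rootseq x k * m"
proof (induction k)
  case (Suc k)
  then have "m * (rootseq x k * rootseq x k) = rootseq x k * rootseq x k * m"
    by (metis mult.assoc)
  then show ?case using Suc.prems by (simp add: distrib_left distrib_right)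
qed simp

lemma rootseq_commute_rootseq: "rootseq x j * rootseq x k = rootseq x k * rootseq x j"
  by (rule rootseq_commute) (simp add: rootseq_commute)

lemma norm_half: "norm (scaleC (1/2) a) = norm (a::'a::cstar_algebra) / 2"
  by (simp add: norm_scaleC norm_divide)

context
  fixes x :: "'a::cstar_algebra multiplier"
  assumes x: "contractive x"
begin

lemma rootseq_bound:
  "norm (lm (rootseq x k) a) \<le> rootbd k * norm a \<and> norm (rm (rootseq x k) a) \<le> rootbd k * norm a"
proof (induction k arbitrary: a)
  case (Suc k)
  have *: "norm (lm (rootseq x k) (lm (rootseq x k) a)) \<le> rootbd k * rootbd k * norm a"
    "norm (rm (rootseq x k) (rm (rootseq x k) a)) \<le> rootbd k * rootbd k * norm a"
    using order_trans[OF conjunct1[OF Suc[of "lm (rootseq x k) a"]] mult_left_mono[OF conjunct1[OF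
        Suc[of a]]]]
      order_trans[OF conjunct2[OF Suc[of "rm (rootseq x k) a"]] mult_left_mono[OF conjunct2[OF Suc[of a]]]]
      rootbd_range[of k] by (simp_all add: mult.assoc)
  have **: "norm (lm x a) \<le> norm a" "norm (rm x a) \<le> norm a" using x by (auto simp: contractive_def)
  have "norm (lm x a + lm (rootseq x k) (lm (rootseq x k) a)) \<le> norm a + rootbd k * rootbd k * norm a"
    "norm (rm x a + rm (rootseq x k) (rm (rootseq x k) a)) \<le> norm a + rootbd k * rootbd k * norm a"
    by (rule order_trans[OF norm_triangle_ineq] add_mono * **)+
  then show ?case
    by (simp add: norm_half algebra_simps del: mscl_simps)
qed simp

text \<open>Iterates commute, so the difference of their squares factors. The increments of
  \<open>rootbd\<close> obey the same recursion, which is why they dominate those of the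
  iterates.\<close>

lemma rootseq_step: "rootseq x (Suc (Suc k)) - rootseq x (Suc k) =
    mscl (1/2) ((rootseq x (Suc k) + rootseq x k) * (rootseq x (Suc k) - rootseq x k))"
proof -
  have "mscl (1/2) (x + p * p) - mscl (1/2) (x + q * q) = mscl (1/2) ((p + q) * (p - q))"
    if "p * q = q * p" for p q :: "'a multiplier"
    using that by (simp add: algebra_simps)
  from this[OF rootseq_commute_rootseq[of x "Suc k" k]] show ?thesis
    by (simp only: rootseq.simps(2)[symmetric])
qed

lemma rootseq_diff_Suc:
  "norm (lm (rootseq x (Suc k) - rootseq x k) a) \<le> (rootbd (Suc k) - rootbd k) * norm a \<and>
   norm (rm (rootseq x (Suc k) - rootseq x k) a) \<le> (rootbd (Suc k) - rootbd k) * norm a"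
proof (induction k arbitrary: a)
  case 0
  show ?case using rootseq_bound[of 1 a] by simp
next
  case (Suc k)
  let ?s = "rootseq x (Suc k) + rootseq x k" and ?d = "rootseq x (Suc k) - rootseq x k"
  let ?S = "rootbd (Suc k) + rootbd k" and ?D = "rootbd (Suc k) - rootbd k"
  have D: "?D \<ge> 0" using rootbd_mono_Suc[of k] by simp
  have S: "?S \<ge> 0" using rootbd_range[of k] rootbd_range[of "Suc k"] by linarith
  have s: "norm (lm ?s b) \<le> ?S * norm b" "norm (rm ?s b) \<le> ?S * norm b" for b
    unfolding lm_simps rm_simps distrib_right
    by (rule order_trans[OF norm_triangle_ineq] add_mono rootseq_bound[THEN conjunct1]
      rootseq_bound[THEN conjunct2])+
  have e: "(rootbd (Suc (Suc k)) - rootbd (Suc k)) * norm a = (?S * (?D * norm a)) / 2"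
    by (simp add: field_simps)
  have l: "norm (lm ?s (lm ?d a)) \<le> ?S * (?D * norm a)"
    by (rule order_trans[OF s(1)]) (intro mult_left_mono Suc[THEN conjunct1] S)
  have r: "norm (rm ?d (rm ?s a)) \<le> ?S * (?D * norm a)"
    using order_trans[OF Suc[THEN conjunct2, of "rm ?s a"] mult_left_mono[OF s(2)[of a] D]]
    by (simp add: mult.left_commute)
  show ?case
    unfolding rootseq_step e mscl_lm mscl_rm norm_half lm_simps(6) rm_simps(6)
    using l r by simp
qed

lemma rootseq_diff:
  assumes "m \<le> n"
  shows "norm (lm (rootseq x n) a - lm (rootseq x m) a) \<le> (rootbd n - rootbd m) * norm a \<and>
   norm (rm (rootseq x n) a - rm (rootseq x m) a) \<le> (rootbd n - rootbd m) * norm a"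
  using assms
proof (induction n rule: dec_induct)
  case (step n)
  have "lm (rootseq x (Suc n)) a - lm (rootseq x m) a =
      lm (rootseq x (Suc n) - rootseq x n) a + (lm (rootseq x n) a - lm (rootseq x m) a)"
    "rm (rootseq x (Suc n)) a - rm (rootseq x m) a =
      rm (rootseq x (Suc n) - rootseq x n) a + (rm (rootseq x n) a - rm (rootseq x m) a)"
    by (simp_all del: rootseq.simps)
  then have "norm (lm (rootseq x (Suc n)) a - lm (rootseq x m) a) \<le>
      (rootbd (Suc n) - rootbd n) * norm a + (rootbd n - rootbd m) * norm a"
    "norm (rm (rootseq x (Suc n)) a - rm (rootseq x m) a) \<le>
      (rootbd (Suc n) - rootbd n) * norm a + (rootbd n - rootbd m) * norm a"
    using norm_triangle_mono[OF conjunct1[OF rootseq_diff_Suc[of n a]] conjunct1[OF step.IH]]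
      norm_triangle_mono[OF conjunct2[OF rootseq_diff_Suc[of n a]] conjunct2[OF step.IH]]
    by (simp_all del: rootseq.simps rootbd.simps)
  then show ?case by (simp add: algebra_simps)
qed simp

lemma rootbd_Cauchy: "Cauchy (\<lambda>k. rootbd k * c)"
proof -
  have "norm (rootbd k) \<le> 1" for k using rootbd_range[of k] by simp
  then have "convergent rootbd"
    by (intro Bseq_mono_convergent BseqI'[of _ 1]) (auto intro: rootbd_mono)
  then have "convergent (\<lambda>k. rootbd k * c)"
    by (intro convergent_mult convergent_const)
  then show ?thesis by (rule convergent_Cauchy)
qed

lemma rootseq_Cauchy: "Cauchy (\<lambda>k. lm (rootseq x k) a) \<and> Cauchy (\<lambda>k. rm (rootseq x k) a)"
proof -
  have *: "Cauchy X" if d: "\<And>m n. m \<le> n \<Longrightarrow> norm (X n - X m) \<le> (rootbd n - rootbd m) * norm a"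
    for X :: "nat \<Rightarrow> 'a"
  proof (rule CauchyI')
    fix e :: real assume "e > 0"
    then obtain M where M: "\<And>m n. m \<ge> M \<Longrightarrow> n \<ge> M \<Longrightarrow> dist (rootbd m * norm a) (rootbd n * norm a) < e"
      using rootbd_Cauchy[of "norm a"] unfolding Cauchy_def by metis
    show "\<exists>M. \<forall>m\<ge>M. \<forall>n>m. dist (X m) (X n) < e"
    proof (intro exI[of _ M] allI impI)
      fix m n assume mn: "M \<le> m" "m < n"
      have "dist (X m) (X n) \<le> (rootbd n - rootbd m) * norm a"
        using d[of m n] mn by (simp add: dist_norm norm_minus_commute)
      also have "\<dots> \<le> dist (rootbd m * norm a) (rootbd n * norm a)"
        by (simp add: dist_real_def algebra_simps)
      also have "\<dots> < e" using mn by (intro M) auto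
      finally show "dist (X m) (X n) < e" .
    qed
  qed
  show ?thesis using rootseq_diff by (intro conjI *) blast+
qed

text \<open>The identities defining a double centralizer involve only products with fixed elements
  of \<open>A\<close>, so they survive pointwise limits of both actions.\<close>

lemma rootseq_limit_exists:
  "\<exists>y. \<forall>a. (\<lambda>k. lm (rootseq x k) a) \<longlonglongrightarrow> lm y a \<and> (\<lambda>k. rm (rootseq x k) a) \<longlonglongrightarrow> rm y a"
proof -
  define L R where "L a = lim (\<lambda>k. lm (rootseq x k) a)" and "R a = lim (\<lambda>k. rm (rootseq x k) a)" for a
  have L: "(\<lambda>k. lm (rootseq x k) a) \<longlonglongrightarrow> L a" for a
    unfolding L_def by (rule convergent_LIMSEQ_iff[THEN iffD1, OF Cauchy_convergent]) (simp add:
        rootseq_Cauchy)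
  have R: "(\<lambda>k. rm (rootseq x k) a) \<longlonglongrightarrow> R a" for a
    unfolding R_def by (rule convergent_LIMSEQ_iff[THEN iffD1, OF Cauchy_convergent]) (simp add:
        rootseq_Cauchy)
  have LR: "L (a * b) = L a * b" "R (a * b) = a * R b" "a * L b = R a * b" for a b
  proof -
    show "L (a * b) = L a * b"
      by (rule LIMSEQ_unique[OF L]) (simp only: lm_mult, intro tendsto_intros L)
    show "R (a * b) = a * R b"
      by (rule LIMSEQ_unique[OF R]) (simp only: rm_mult, intro tendsto_intros R)
    have "(\<lambda>k. a * lm (rootseq x k) b) \<longlonglongrightarrow> a * L b" by (intro tendsto_intros L)
    moreover have "(\<lambda>k. rm (rootseq x k) a * b) \<longlonglongrightarrow> R a * b" by (intro tendsto_intros R)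
    ultimately show "a * L b = R a * b"
      unfolding lm_rm by (rule LIMSEQ_unique)
  qed
  then have "lm (Abs_multiplier (L, R)) = L" "rm (Abs_multiplier (L, R)) = R"
    by (auto simp: lm.rep_eq rm.rep_eq Abs_multiplier_inverse)
  then show ?thesis using L R by (intro exI[of _ "Abs_multiplier (L, R)"]) auto
qed

definition rootlim :: "'a multiplier"
  where "rootlim = (SOME y. \<forall>a. (\<lambda>k. lm (rootseq x k) a) \<longlonglongrightarrow> lm y a \<and>
    (\<lambda>k. rm (rootseq x k) a) \<longlonglongrightarrow> rm y a)"

lemma rootlim_lm: "(\<lambda>k. lm (rootseq x k) a) \<longlonglongrightarrow> lm rootlim a"
  and rootlim_rm: "(\<lambda>k. rm (rootseq x k) a) \<longlonglongrightarrow> rm rootlim a"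
  using someI_ex[OF rootseq_limit_exists] unfolding rootlim_def by blast+

lemma rootlim_contractive: "contractive rootlim"
  unfolding contractive_def
proof (intro allI conjI)
  fix a :: 'a
  have le: "rootbd k * norm a \<le> norm a" for k
    using rootbd_range[of k] by (simp add: mult_left_le_one_le)
  show "norm (lm rootlim a) \<le> norm a"
    by (rule LIMSEQ_le_const2[OF tendsto_norm[OF rootlim_lm]])
      (use rootseq_bound le order_trans in blast)
  show "norm (rm rootlim a) \<le> norm a"
    by (rule LIMSEQ_le_const2[OF tendsto_norm[OF rootlim_rm]])
      (use rootseq_bound le order_trans in blast)
qed

text \<open>Read as \<open>(1 - y) * (1 - y) = 1 - x\<close>: the limit is \<open>1\<close> minus a
  square root of \<open>1 - x\<close>.\<close>

lemma rootlim_eq: "rootlim + rootlim = x + rootlim * rootlim"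
proof (rule multiplier_eqI)
  fix a
  let ?y = rootlim
  have half: "scaleC (1/2) v = (1/2) *\<^sub>R v" for v :: 'a
    using scaleC_of_real[of "1/2" v] by simp
  \<comment> \<open>The left factor varies with \<open>k\<close> too; as a contraction it does not
    enlarge the error made in the right factor.\<close>
  have "(\<lambda>k. lm (rootseq x k) (lm (rootseq x k) a) - lm (rootseq x k) (lm ?y a)) \<longlonglongrightarrow> 0"
  proof (rule Lim_null_comparison)
    show "(\<lambda>k. norm (lm (rootseq x k) a - lm ?y a)) \<longlonglongrightarrow> 0"
      by (rule tendsto_norm_zero) (simp add: LIM_zero rootlim_lm)
    show "\<forall>\<^sub>F k in sequentially. norm (lm (rootseq x k) (lm (rootseq x k) a) - lm (rootseq x k) (lm ?y a))
        \<le> norm (lm (rootseq x k) a - lm ?y a)"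
    proof (intro always_eventually allI)
      fix k
      let ?d = "lm (rootseq x k) a - lm ?y a"
      have "norm (lm (rootseq x k) ?d) \<le> rootbd k * norm ?d" using rootseq_bound by blast
      also have "\<dots> \<le> norm ?d" using rootbd_range[of k] by (simp add: mult_left_le_one_le)
      finally show "norm (lm (rootseq x k) (lm (rootseq x k) a) - lm (rootseq x k) (lm ?y a)) \<le> norm ?d"
        by (simp add: lm_diff)
    qed
  qed
  then have "(\<lambda>k. lm (rootseq x k) (lm (rootseq x k) a)) \<longlonglongrightarrow> lm ?y (lm ?y a)"
    using tendsto_add[OF _ rootlim_lm[of "lm ?y a"]] by fastforce
  then have "(\<lambda>k. (1/2) *\<^sub>R (lm x a + lm (rootseq x k) (lm (rootseq x k) a)))
      \<longlonglongrightarrow> (1/2) *\<^sub>R (lm x a + lm ?y (lm ?y a))"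
    by (intro tendsto_intros)
  moreover have "(\<lambda>k. lm (rootseq x (Suc k)) a) \<longlonglongrightarrow> lm ?y a"
    using rootlim_lm by (rule LIMSEQ_Suc)
  ultimately have "lm ?y a = (1/2) *\<^sub>R (lm x a + lm ?y (lm ?y a))"
    by (intro LIMSEQ_unique) (simp_all add: half scaleR_add_right)
  then have "2 *\<^sub>R lm ?y a = 2 *\<^sub>R ((1/2) *\<^sub>R (lm x a + lm ?y (lm ?y a)))" by (rule arg_cong)
  also have "\<dots> = lm x a + lm ?y (lm ?y a)" by (simp del: scaleR_add_right)
  finally have "2 *\<^sub>R lm ?y a = lm x a + lm ?y (lm ?y a)" .
  then show "lm (?y + ?y) a = lm (x + ?y * ?y) a" by (simp add: scaleR_2)
qed

text \<open>Continuity of \<open>m\<close> is not at hand. After multiplication by \<open>c\<close>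
  from the left, \<open>m\<close> acts on \<open>c\<close> and thus stands outside the
  limit.\<close>

lemma rootlim_commute:
  assumes "m * x = x * m" shows "m * rootlim = rootlim * m"
proof (rule multiplier_eqI, rule left_faithful)
  fix a c
  have "(\<lambda>k. c * lm (rootseq x k) (lm m a)) \<longlonglongrightarrow> c * lm rootlim (lm m a)"
    by (intro tendsto_intros rootlim_lm)
  moreover have "(\<lambda>k. rm m c * lm (rootseq x k) a) \<longlonglongrightarrow> rm m c * lm rootlim a"
    by (intro tendsto_intros rootlim_lm)
  moreover have "rm m c * lm (rootseq x k) a = c * lm (rootseq x k) (lm m a)" for k
    using rootseq_commute[OF assms, of k] by (metis lm_rm lm_simps(6))
  ultimately have "rm m c * lm rootlim a = c * lm rootlim (lm m a)"
    using LIMSEQ_unique by simp blast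
  then show "c * lm (m * rootlim) a = c * lm (rootlim * m) a"
    by (simp add: lm_rm[of _ m])
qed

text \<open>The adjoint exchanges the two actions, so the convergence of the right actions is used,
  together with the isometry of \<open>star\<close>.\<close>

lemma rootlim_mstar:
  assumes "mstar x = x" shows "mstar rootlim = rootlim"
proof (rule multiplier_eqI)
  fix a :: 'a
  have "mstar (rootseq x k) = rootseq x k" for k
    by (induction k) (simp_all add: assms)
  then have e: "star (rm (rootseq x k) (star a)) = lm (rootseq x k) a" for k
    by (metis mstar_lm)
  have "(\<lambda>k. star (rm (rootseq x k) (star a))) \<longlonglongrightarrow> star (rm rootlim (star a))"
    using rootlim_rm[of "star a"]
    by (simp add: tendsto_iff dist_norm flip: star_diff)
  then show "lm (mstar rootlim) a = lm rootlim a"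
    using rootlim_lm[of a] unfolding e mstar_lm by (rule LIMSEQ_unique)
qed

end

section \<open>Involutive automorphisms\<close>

text \<open>For an involutive \<open>\<tau>\<close> the inverse occurring in \<open>mext\<close> is
  \<open>\<tau>\<close> itself.\<close>

definition mext_inv :: "('a::cstar_algebra \<Rightarrow> 'a) \<Rightarrow> 'a multiplier \<Rightarrow> 'a multiplier"
  where "mext_inv \<tau> m = Abs_multiplier (\<lambda>a. \<tau> (lm m (\<tau> a)), \<lambda>a. \<tau> (rm m (\<tau> a)))"

text \<open>Covers gradings, with \<open>\<kappa>\<close> the identity, and real structures, with
  \<open>\<kappa> = cnj\<close>, so that each limit argument is made once.\<close>

locale star_invol =
  fixes \<tau> :: "'a::cstar_algebra \<Rightarrow> 'a" and \<kappa> :: "complex \<Rightarrow> complex"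
  assumes add: "\<tau> (x + y) = \<tau> x + \<tau> y"
    and mult: "\<tau> (x * y) = \<tau> x * \<tau> y"
    and star: "\<tau> (star x) = star (\<tau> x)"
    and scale: "\<tau> (scaleC c x) = scaleC (\<kappa> c) (\<tau> x)"
    and kappa: "\<kappa> = (\<lambda>c. c) \<or> \<kappa> = cnj"
    and invol [simp]: "\<tau> (\<tau> x) = x"
begin

abbreviation "ext \<equiv> mext_inv \<tau>"

lemma kappa_real: "\<kappa> (complex_of_real t) = complex_of_real t" "\<kappa> 1 = 1" "\<kappa> (1/2) = 1/2"
  "\<kappa> (-1) = -1" "\<kappa> (1/4) = 1/4"
  using kappa by auto

lemma zero [simp]: "\<tau> 0 = 0" using add[of 0 0] by simp

lemma minus: "\<tau> (- x) = - \<tau> x" using scale[of "-1" x] by (simp add: scaleC_minus_one kappa_real)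

lemma diff: "\<tau> (x - y) = \<tau> x - \<tau> y" using add[of x "- y"] by (simp add: minus)

lemma scaleR: "\<tau> (t *\<^sub>R x) = t *\<^sub>R \<tau> x"
  using scale[of "complex_of_real t" x] by (simp add: scaleC_of_real kappa_real)

lemma ext_lm [simp]: "lm (ext m) a = \<tau> (lm m (\<tau> a))"
  and ext_rm [simp]: "rm (ext m) a = \<tau> (rm m (\<tau> a))"
proof -
  have "\<tau> (\<tau> a * lm m (\<tau> b)) = \<tau> (rm m (\<tau> a) * \<tau> b)" for a b by (simp add: lm_rm)
  then have "(\<lambda>a. \<tau> (lm m (\<tau> a)), \<lambda>a. \<tau> (rm m (\<tau> a))) \<in> {(L, R). (\<forall>a b. L (a * b) = L a * b) \<and>
      (\<forall>a b. R (a * b) = a * R b) \<and> (\<forall>a b. a * L b = R a * b)}"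
    by (auto simp: mult lm_mult rm_mult)
  then show "lm (ext m) a = \<tau> (lm m (\<tau> a))" "rm (ext m) a = \<tau> (rm m (\<tau> a))"
    by (simp_all add: mext_inv_def lm.rep_eq rm.rep_eq Abs_multiplier_inverse)
qed

lemma ext_simps [simp]:
  "ext (m + n) = ext m + ext n" "ext (m - n) = ext m - ext n" "ext (- m) = - ext m" "ext 0 = 0"
  "ext 1 = 1" "ext (m * n) = ext m * ext n" "ext (mscl c m) = mscl (\<kappa> c) (ext m)"
  "ext (mstar m) = mstar (ext m)" "ext (emb a) = emb (\<tau> a)" "ext (ext m) = m"
  by (auto intro!: multiplier_eqI simp: add diff minus mult scale star)

lemma isometric: "norm (\<tau> a) = norm a"
proof -
  \<comment> \<open>\<open>b = \<tau> a\<close> is the real part of the unitary \<open>b + \<i> \<tau> (sqrt (1 - a\<^sup>2))\<close>.\<close>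
  have selfadj: "norm (\<tau> a) \<le> 1" if a: "star a = a" "norm a \<le> 1" for a
  proof -
    let ?x = "emb (a * a)"
    have *: "norm (a * a * v) \<le> norm v" "norm (v * (a * a)) \<le> norm v" for v
    proof -
      have aa: "norm (a * a) \<le> 1"
        using a cstar_identity[of a] by (simp add: power_le_one)
      show "norm (a * a * v) \<le> norm v"
        by (rule order_trans[OF norm_mult_ineq]) (use aa in \<open>simp add: mult_left_le_one_le\<close>)
      show "norm (v * (a * a)) \<le> norm v"
        by (rule order_trans[OF norm_mult_ineq]) (use aa in \<open>simp add: mult_right_le_one_le\<close>)
    qed
    have x: "contractive ?x" by (simp add: contractive_def * del: emb_simps)
    define S where "S = 1 - rootlim ?x"
    have S2: "S * S = 1 - ?x"
      using rootlim_eq[OF x] unfolding S_def by (simp add: algebra_simps del: emb_simps)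
    have S_star: "mstar S = S"
      using rootlim_mstar[OF x] a by (simp add: S_def)
    have S_comm: "emb a * S = S * emb a"
      using rootlim_commute[OF x, of "emb a"] by (simp add: S_def algebra_simps)
    define b T where "b = emb (\<tau> a)" and "T = ext S"
    have b_star: "mstar b = b" using a by (simp add: b_def star[symmetric])
    have T_star: "mstar T = T" using S_star by (simp add: T_def ext_simps(8)[symmetric] del: ext_simps(8))
    have T2: "T * T = 1 - b * b"
      using arg_cong[OF S2, of ext] by (simp add: T_def b_def mult)
    have comm: "b * T = T * b"
      using arg_cong[OF S_comm, of ext] by (simp add: T_def b_def)
    define u where "u = b + mscl \<i> T"
    have us: "mstar u = b - mscl \<i> T"
      by (simp add: u_def b_star T_star mscl_minus_left)
    have u: "munitary u"
      unfolding munitary_def us unfolding u_def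
      by (simp add: algebra_simps comm T2 mscl_minus_left)
    have "norm (\<tau> a * v + \<tau> a * v) \<le> norm v + norm v" for v
    proof -
      have "\<tau> a * v + \<tau> a * v = lm u v + lm (mstar u) v" by (simp only: us) (simp add: u_def b_def)
      also have "norm \<dots> \<le> norm (lm u v) + norm (lm (mstar u) v)" by (rule norm_triangle_ineq)
      also have "\<dots> = norm v + norm v"
        using u by (simp only: munitary_isometric munitary_mstar)
      finally show ?thesis .
    qed
    \<comment> \<open>Twice \<open>\<tau> a\<close> is the sum of two unitaries; at
      \<open>v = \<tau> a\<close> this bounds the square of the norm of \<open>\<tau> a\<close> by
      the norm itself.\<close>
    from this[of "\<tau> a"] have "norm (2 *\<^sub>R (\<tau> a * \<tau> a)) \<le> 2 * norm (\<tau> a)"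
      by (simp add: scaleR_2)
    then have "norm (\<tau> a * \<tau> a) \<le> norm (\<tau> a)" by simp
    moreover have "norm (\<tau> a * \<tau> a) = norm (\<tau> a) * norm (\<tau> a)"
      using cstar_identity[of "\<tau> a"] a by (simp add: star[symmetric] power2_eq_square)
    ultimately show ?thesis by (cases "\<tau> a = 0") auto
  qed
  have le: "norm (\<tau> a) \<le> norm a" for a
  proof (cases "a = 0")
    case False
    \<comment> \<open>The C*-identity reduces the general case to the self-adjoint
      \<open>star a * a\<close>, normalised to norm \<open>1\<close>.\<close>
    define h where "h = (1 / (norm a)\<^sup>2) *\<^sub>R (star a * a)"
    have "star h = h"
      using star_scaleC[of "complex_of_real (1 / (norm a)\<^sup>2)" "star a * a"]
      by (simp add: h_def scaleC_of_real star_mult del: of_real_divide of_real_power)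
    moreover have "norm h \<le> 1" using False by (simp add: h_def cstar_identity)
    ultimately have "norm (\<tau> h) \<le> 1" by (rule selfadj)
    moreover have "\<tau> h = (1 / (norm a)\<^sup>2) *\<^sub>R (star (\<tau> a) * \<tau> a)"
      by (simp add: h_def scaleR mult star)
    ultimately have "(norm (\<tau> a))\<^sup>2 \<le> (norm a)\<^sup>2" using False by (simp add: cstar_identity divide_simps)
    then show ?thesis by (simp add: power2_le_iff_abs_le)
  qed simp
  show ?thesis using le[of a] le[of "\<tau> a"] by simp
qed

text \<open>The iterates have real coefficients, which \<open>\<kappa>\<close> fixes, and
  \<open>\<tau>\<close> passes to the limit because it is isometric.\<close>

lemma ext_rootlim:
  assumes x: "contractive x" and e: "ext x = x" shows "ext (rootlim x) = rootlim x"
proof (rule multiplier_eqI)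
  fix a
  have "ext (rootseq x k) = rootseq x k" for k
    by (induction k) (simp_all add: e kappa_real)
  then have e: "\<tau> (lm (rootseq x k) (\<tau> a)) = lm (rootseq x k) a" for k
    by (metis ext_lm)
  have "(\<lambda>k. \<tau> (lm (rootseq x k) (\<tau> a))) \<longlonglongrightarrow> \<tau> (lm (rootlim x) (\<tau> a))"
    using rootlim_lm[OF x, of "\<tau> a"]
    by (simp add: tendsto_iff dist_norm isometric flip: diff)
  then show "lm (ext (rootlim x)) a = lm (rootlim x) a"
    using rootlim_lm[OF x, of a] unfolding e ext_lm by (rule LIMSEQ_unique)
qed

end

section \<open>Roots of unitaries\<close>

lemma minvertibleI:
  assumes "l * m = 1" "m * r = 1" shows "minvertible m"
proof -
  have "l = r" by (metis assms mult.assoc mult_1_left mult_1_right)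
  with assms show ?thesis unfolding minvertible_def by auto
qed

lemma minvertible_mult_iff:
  assumes "m * n = n * m" "minvertible (m * n)" shows "minvertible m"
proof -
  obtain k where k: "m * n * k = 1" "k * (m * n) = 1" using assms(2) by (auto simp: minvertible_def)
  show ?thesis
  proof (rule minvertibleI)
    show "k * n * m = 1" using k(2) by (simp only: assms(1) mult.assoc)
    show "m * (n * k) = 1" using k(1) by (simp only: mult.assoc)
  qed
qed

lemma minvertible_mult: "minvertible m \<Longrightarrow> minvertible n \<Longrightarrow> minvertible (m * n)"
proof (unfold minvertible_def, elim exE conjE)
  fix k l assume *: "m * k = 1" "k * m = 1" "n * l = 1" "l * n = 1"
  have "m * n * (l * k) = m * (n * l) * k" "l * k * (m * n) = l * (k * m) * n"
    by (simp_all only: mult.assoc)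
  with * show "\<exists>k. m * n * k = 1 \<and> k * (m * n) = 1" by auto
qed

lemma minvertible_mscl: "c \<noteq> 0 \<Longrightarrow> minvertible m \<Longrightarrow> minvertible (mscl c m)"
  unfolding minvertible_def by (erule exE, rule_tac x = "mscl (1/c) n" in exI) simp

lemma minvertible_mstar: "minvertible m \<Longrightarrow> minvertible (mstar m)"
  unfolding minvertible_def by (metis mstar_simps(5,6))

lemma minverse_commute:
  assumes "k * n = 1" "n * k = 1" "m * k = k * m" shows "m * n = n * (m :: 'a::cstar_algebra multiplier)"
proof -
  have "m * n = n * (k * m) * n" using assms by (simp flip: mult.assoc)
  also have "\<dots> = n * m * (k * n)" by (simp only: assms(3)[symmetric] mult.assoc)
  finally show ?thesis using assms by simp
qed

text \<open>In place of a Neumann series: \<open>2 w - y w = v\<close> says that \<open>w\<close> is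
  a fixed point of \<open>w \<mapsto> (v + y w) / 2\<close>, a contraction with constant
  \<open>1/2\<close> on the Banach space \<open>A\<close>. The same holds for the right
  action.\<close>

lemma two_minus_contractive_minvertible:
  assumes y: "contractive y" shows "minvertible (1 + 1 - y)"
proof -
  let ?b = "1 + 1 - y"
  have uniq: "\<exists>!w. w + w - T w = v"
    if T: "\<And>a b. T (a - b) = T a - T b" "\<And>a. norm (T a) \<le> norm a" for T and v :: 'a
  proof -
    have "\<exists>!w. (1/2) *\<^sub>R (v + T w) = w"
    proof (rule banach_fix_type)
      show "\<forall>x z. dist ((1/2) *\<^sub>R (v + T x)) ((1/2) *\<^sub>R (v + T z)) \<le> 1/2 * dist x z"
        using T by (simp add: dist_norm flip: scaleR_diff_right) (metis T)
    qed auto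
    moreover have "(1/2) *\<^sub>R (v + T w) = w \<longleftrightarrow> w + w - T w = v" for w
    proof -
      have "(1/2) *\<^sub>R z = w \<longleftrightarrow> z = w + w" for z
        by (auto simp flip: scaleR_left_distrib)
      then have "(1/2) *\<^sub>R (v + T w) = w \<longleftrightarrow> v + T w = w + w" .
      also have "\<dots> \<longleftrightarrow> w + w - T w = v" by (metis add_diff_cancel_right' diff_add_cancel)
      finally show ?thesis .
    qed
    ultimately show ?thesis by simp
  qed
  have "\<exists>!w. lm ?b w = v" "\<exists>!w. rm ?b w = v" for v
    using uniq[of "lm y" v] uniq[of "rm y" v] y by (simp_all add: lm_diff rm_diff contractive_def)
  then obtain L R where L: "\<And>v. lm ?b (L v) = v" "\<And>v w. lm ?b w = v \<Longrightarrow> w = L v"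
    and R: "\<And>v. rm ?b (R v) = v" "\<And>v w. rm ?b w = v \<Longrightarrow> w = R v"
    by metis
  \<comment> \<open>Uniqueness of the solutions makes the two solution maps a double centralizer:
    for example \<open>L a * b\<close> solves the equation for \<open>a * b\<close>.\<close>
  have "L (a * b) = L a * b" "R (a * b) = a * R b" "a * L b = R a * b" for a b
    using L R by (metis lm_mult, metis rm_mult, metis lm_rm)
  then have lr: "lm (Abs_multiplier (L, R)) = L" "rm (Abs_multiplier (L, R)) = R"
    by (auto simp: lm.rep_eq rm.rep_eq Abs_multiplier_inverse)
  have "L (lm ?b v) = v" for v using L(2)[OF HOL.refl] by simp
  then have "?b * Abs_multiplier (L, R) = 1" "Abs_multiplier (L, R) * ?b = 1"
    using L(1) lr(1) by (auto intro!: multiplier_eqI simp del: lm_simps(3,4) simp: lm_simps)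
  then show ?thesis by (auto simp: minvertible_def)
qed

text \<open>The principal square root of a unitary \<open>\<theta>\<close> with \<open>- 1\<close> outside its spectrum is the unitary
  part of \<open>1 + \<theta>\<close>. Its real part is a square root of \<open>(2 + \<theta> + \<theta>\<^sup>*) / 4\<close>, hence positive.\<close>

lemma principal_root:
  fixes \<theta> :: "'a::cstar_algebra multiplier"
  assumes u: "munitary \<theta>" and inv: "minvertible (1 + \<theta>)"
  obtains v where "munitary v" "v * v = \<theta>" "minvertible (1 + v)"
    "\<And>m. m * \<theta> = \<theta> * m \<Longrightarrow> m * v = v * m"
    "\<And>\<tau> \<kappa>. star_invol \<tau> \<kappa> \<Longrightarrow> mext_inv \<tau> \<theta> = \<theta> \<Longrightarrow> mext_inv \<tau> v = v"
    "\<And>\<tau> \<kappa>. star_invol \<tau> \<kappa> \<Longrightarrow> mext_inv \<tau> \<theta> = mstar \<theta> \<Longrightarrow> mext_inv \<tau> v = mstar v"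
proof -
  let ?h = "1 + \<theta> + mstar \<theta> + 1"
  \<comment> \<open>Chosen so that \<open>1 - x\<close> is a quarter of
    \<open>?h = (1 + \<theta>) * (1 + mstar \<theta>)\<close>, the squared modulus of
    \<open>(1 + \<theta>) / 2\<close>. Up to signs \<open>x\<close> is an average of four
    isometries, hence contractive.\<close>
  define x where "x = mscl (1/4) (1 - \<theta> - mstar \<theta> + 1)"
  have th: "\<theta> * mstar \<theta> = 1" "mstar \<theta> * \<theta> = 1" using u by (auto simp: munitary_def)
  have x: "contractive x"
  proof -
    have four: "norm (a - b - c + a) \<le> 4 * norm a" if "norm b = norm a" "norm c = norm a" for a b c :: 'a
    proof -
      have "norm (a - b - c + a) \<le> norm a + norm b + norm c + norm a"
        by (intro order_trans[OF norm_triangle_ineq] add_right_mono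
          order_trans[OF norm_triangle_ineq4] order_refl)
      with that show ?thesis by simp
    qed
    have "norm (scaleC (1/4) (a - b - c + a)) \<le> norm a" if "norm b = norm a" "norm c = norm a" for a
        b c :: 'a
      using four[OF that] by (simp add: norm_scaleC norm_divide)
    moreover have "norm (lm (mstar \<theta>) a) = norm a" "norm (rm (mstar \<theta>) a) = norm a" for a
      using u by (simp_all only: munitary_isometric munitary_isometric_rm munitary_mstar)
    ultimately show ?thesis
      unfolding contractive_def x_def mscl_lm mscl_rm lm_simps rm_simps
      using u by (simp only: munitary_isometric munitary_isometric_rm) blast
  qed
  define S where "S = 1 - rootlim x"
  have S2: "S * S = mscl (1/4) ?h"
  proof -
    have "S * S = 1 - x"
      using rootlim_eq[OF x] unfolding S_def by (simp add: algebra_simps)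
    also have "\<dots> = mscl (1/4) ?h"
    proof -
      have "(1 :: 'a multiplier) = mscl (1/4 + 1/4 + 1/4 + 1/4) 1" by simp
      also have "\<dots> = mscl (1/4) 1 + mscl (1/4) 1 + mscl (1/4) 1 + mscl (1/4) 1"
        by (simp only: mscl_add_left)
      finally show ?thesis unfolding x_def by (simp add: algebra_simps)
    qed
    finally show ?thesis .
  qed
  have h: "?h = (1 + \<theta>) * (1 + mstar \<theta>)" "?h = (1 + mstar \<theta>) * (1 + \<theta>)"
    using th by (simp_all add: algebra_simps)
  have "mstar x = x" by (simp add: x_def algebra_simps)
  then have S_star: "mstar S = S" using rootlim_mstar[OF x] by (simp add: S_def)
  have comm_star: "m * mstar \<theta> = mstar \<theta> * m" if "m * \<theta> = \<theta> * m" for m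
    by (rule minverse_commute[of \<theta>]) (use th that in auto)
  have S_comm: "m * S = S * m" if "m * \<theta> = \<theta> * m" for m
  proof -
    have "m * x = x * m" using that comm_star[OF that] by (simp add: x_def algebra_simps)
    from rootlim_commute[OF x this] show ?thesis by (simp add: S_def algebra_simps)
  qed
  have "minvertible (mscl (1/4) ?h)"
    unfolding h(1) using minvertible_mstar[OF inv]
    by (intro minvertible_mscl minvertible_mult inv) simp_all
  then have "minvertible S"
    using S2 by (intro minvertible_mult_iff[of S S]) auto
  then obtain K where K: "S * K = 1" "K * S = 1" by (auto simp: minvertible_def)
  have K_comm: "m * K = K * m" if "m * \<theta> = \<theta> * m" for m
    by (rule minverse_commute[of S]) (use K S_comm[OF that] in auto)
  have K_star: "mstar K = K"
  proof -
    have "mstar K * S = 1" using arg_cong[OF K(1), of mstar] S_star by simp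
    then have "mstar K * (S * K) = K" by (simp flip: mult.assoc)
    then show ?thesis using K by simp
  qed
  have SSKK: "mscl (1/4) ?h * (K * K) = 1"
    unfolding S2[symmetric] using K by (metis mult.assoc mult_1_left)
  \<comment> \<open>Polar decomposition: \<open>S\<close> is the modulus of
    \<open>(1 + \<theta>) / 2\<close> and \<open>K\<close> is its inverse.\<close>
  define v where "v = mscl (1/2) ((1 + \<theta>) * K)"
  have K1: "\<theta> * K = K * \<theta>" "mstar \<theta> * K = K * mstar \<theta>"
    using K_comm[of \<theta>] K_comm[of "mstar \<theta>"] th by auto
  have vs: "mstar v = mscl (1/2) ((1 + mstar \<theta>) * K)"
    using K1 K_star by (simp add: v_def algebra_simps)
  have quarter: "mscl (1/2) (p * K) * mscl (1/2) (q * K) = mscl (1/4) (p * q) * (K * K)"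
    if "q * K = K * q" for p q
  proof -
    have "p * K * (q * K) = p * q * (K * K)"
      using that by (metis mult.assoc)
    then show ?thesis by simp
  qed
  have K2: "(1 + \<theta>) * K = K * (1 + \<theta>)" "(1 + mstar \<theta>) * K = K * (1 + mstar \<theta>)"
    using K1 by (simp_all add: algebra_simps)
  have v: "munitary v"
    unfolding munitary_def vs unfolding v_def quarter[OF K2(1)] quarter[OF K2(2)] h[symmetric]
    using SSKK by simp
  have vv: "v * v = \<theta>"
  proof -
    have "(1 + \<theta>) * (1 + \<theta>) = \<theta> * ?h" using th by (simp add: algebra_simps)
    moreover have "mscl c (m * n) * k = m * (mscl c n * k)" for c and m n k :: "'a multiplier"
      by (simp add: mult.assoc)
    ultimately have "v * v = \<theta> * (mscl (1/4) ?h * (K * K))"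
      unfolding v_def quarter[OF K2(1)] by (simp only:)
    then show ?thesis by (simp only: SSKK mult_1_right)
  qed
  have half: "mscl (1/2) (m + m) = m" for m :: "'a multiplier"
    by (simp flip: mscl_add_left)
  \<comment> \<open>The real part of \<open>v\<close> is \<open>S = 1 - rootlim x\<close>. Hence
    \<open>(1 + v) * (1 + mstar v)\<close> is twice \<open>2 - rootlim x\<close>, which is
    invertible.\<close>
  have "v + mstar v = mscl (1/2) (?h * K)"
    unfolding vs unfolding v_def by (simp add: algebra_simps)
  also have "\<dots> = mscl 2 (mscl (1/4) ?h * K)"
    by (simp only: mscl_simps(7,8)) simp
  also have "\<dots> = mscl 2 (S * (S * K))" by (simp only: S2[symmetric] mult.assoc)
  also have "\<dots> = mscl 2 S" by (simp add: K)
  finally have vvs: "v + mstar v = S + S" by (simp add: mscl_add_left[of 1 1, simplified])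
  have w: "minvertible (1 + v)"
  proof (rule minvertible_mult_iff)
    have p: "(1 + v) * (1 + mstar v) = 1 + 1 + (S + S)" "(1 + mstar v) * (1 + v) = 1 + 1 + (S + S)"
      using v unfolding vvs[symmetric] by (simp_all add: algebra_simps munitary_def)
    then show "(1 + v) * (1 + mstar v) = (1 + mstar v) * (1 + v)" by simp
    have "1 + 1 + (S + S) = mscl 2 (1 + 1 - rootlim x)"
      by (simp add: S_def mscl_add_left[of 1 1, simplified] algebra_simps)
    then show "minvertible ((1 + v) * (1 + mstar v))"
      unfolding p using two_minus_contractive_minvertible[OF rootlim_contractive[OF x]]
      by (simp add: minvertible_mscl del: mscl_simps)
  qed
  \<comment> \<open>Inverses are unique, so \<open>K\<close> inherits the invariance of
    \<open>S\<close>.\<close>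
  have nat: "mext_inv \<tau> K = K" if "star_invol \<tau> \<kappa>" "mext_inv \<tau> x = x" for \<tau> \<kappa>
  proof -
    interpret star_invol \<tau> \<kappa> by fact
    have "ext S = S" using ext_rootlim[OF x that(2)] by (simp add: S_def)
    then have "ext K * S = 1" using arg_cong[OF K(2), of ext] by simp
    then have "ext K * (S * K) = K" by (simp flip: mult.assoc)
    then show ?thesis using K by simp
  qed
  show ?thesis
  proof
    show "munitary v" "v * v = \<theta>" "minvertible (1 + v)" by fact+
    show "m * v = v * m" if "m * \<theta> = \<theta> * m" for m
    proof -
      have "m * (1 + \<theta>) * K = (1 + \<theta>) * m * K" using that by (simp add: algebra_simps)
      also have "\<dots> = (1 + \<theta>) * K * m" using K_comm[OF that] by (simp add: mult.assoc)
      finally show ?thesis by (simp add: v_def mult.assoc)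
    qed
    show "mext_inv \<tau> v = v" if "star_invol \<tau> \<kappa>" "mext_inv \<tau> \<theta> = \<theta>" for \<tau> \<kappa>
    proof -
      interpret star_invol \<tau> \<kappa> by fact
      have "ext x = x" using that by (simp add: x_def kappa_real)
      then show ?thesis using nat[OF that(1)] that by (simp add: v_def kappa_real)
    qed
    show "mext_inv \<tau> v = mstar v" if "star_invol \<tau> \<kappa>" "mext_inv \<tau> \<theta> = mstar \<theta>" for \<tau> \<kappa>
    proof -
      interpret star_invol \<tau> \<kappa> by fact
      have "ext x = x" using that by (simp add: x_def kappa_real algebra_simps)
      then show ?thesis using nat[OF that(1)] that unfolding vs by (simp add: v_def kappa_real)
    qed
  qed
qed

text \<open>\<open>\<epsilon>\<close> is the sign of the real part of \<open>\<theta>\<close>, and \<open>\<epsilon> \<theta>\<close> is the principal root of \<open>\<theta>\<^sup>2\<close>.\<close>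

lemma phase_root:
  fixes \<theta> :: "'a::cstar_algebra multiplier"
  assumes f: "star_invol f cnj" and g: "star_invol \<gamma> (\<lambda>c. c)"
    and u: "munitary \<theta>" and inv: "minvertible (1 + \<theta> * \<theta>)"
    and fs: "mext_inv f \<theta> = mscl s (mstar \<theta>)" and gt: "mext_inv \<gamma> \<theta> = mscl t \<theta>"
    and st: "s = 1 \<or> s = -1" "t = 1 \<or> t = -1"
  obtains v \<epsilon> where "munitary v" "\<epsilon> * \<epsilon> = 1" "mstar \<epsilon> = \<epsilon>" "\<epsilon> * v = v * \<epsilon>" "\<theta> = \<epsilon> * v * v"
    "mext_inv f v = mstar v" "mext_inv \<gamma> v = v" "mext_inv f \<epsilon> = mscl s \<epsilon>" "mext_inv \<gamma> \<epsilon> = mscl t \<epsilon>"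
proof -
  interpret f: star_invol f cnj by fact
  interpret g: star_invol \<gamma> "\<lambda>c. c" by fact
  have th: "\<theta> * mstar \<theta> = 1" "mstar \<theta> * \<theta> = 1" using u by (auto simp: munitary_def)
  have th': "\<theta> * (mstar \<theta> * m) = m" "mstar \<theta> * (\<theta> * m) = m" for m
    using th by (simp_all flip: mult.assoc)
  \<comment> \<open>\<open>1 + \<theta> * \<theta>\<close> is the product of
    \<open>\<i> - \<theta>\<close> and \<open>- \<i> - \<theta>\<close>; its invertibility puts
    \<open>-1\<close> outside the spectrum of \<open>\<theta> * \<theta>\<close>.\<close>
  have "munitary (\<theta> * \<theta>)" by (simp add: munitary_def mult.assoc th th')
  from principal_root[OF this inv]
  obtain q where q: "munitary q" "q * q = \<theta> * \<theta>" "minvertible (1 + q)"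
    "\<And>m. m * (\<theta> * \<theta>) = \<theta> * \<theta> * m \<Longrightarrow> m * q = q * m"
    "\<And>\<tau> \<kappa>. star_invol \<tau> \<kappa> \<Longrightarrow> mext_inv \<tau> (\<theta> * \<theta>) = \<theta> * \<theta> \<Longrightarrow> mext_inv \<tau> q = q"
    "\<And>\<tau> \<kappa>. star_invol \<tau> \<kappa> \<Longrightarrow> mext_inv \<tau> (\<theta> * \<theta>) = mstar (\<theta> * \<theta>) \<Longrightarrow> mext_inv \<tau> q = mstar q"
    by metis
  have qq: "q * mstar q = 1" "mstar q * q = 1" using q(1) by (auto simp: munitary_def)
  \<comment> \<open>The signs enter \<open>\<theta> * \<theta>\<close> squared and
    disappear.\<close>
  have "s * s = 1" "t * t = 1" using st by auto
  then have fq: "mext_inv f q = mstar q" and gq: "mext_inv \<gamma> q = q"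
    by (simp_all add: q(6)[OF f] q(5)[OF g] fs gt)
  have \<theta>q: "\<theta> * q = q * \<theta>" "mstar \<theta> * q = q * mstar \<theta>"
    by (rule q(4); simp add: mult.assoc th th')+
  \<comment> \<open>A second root exists because \<open>1 + q\<close> is invertible. It is taken
    because one factor \<open>v\<close> is absorbed on each side of \<open>f\<close>.\<close>
  from principal_root[OF q(1,3)]
  obtain v where v: "munitary v" "v * v = q" "\<And>m. m * q = q * m \<Longrightarrow> m * v = v * m"
    "\<And>\<tau> \<kappa>. star_invol \<tau> \<kappa> \<Longrightarrow> mext_inv \<tau> q = q \<Longrightarrow> mext_inv \<tau> v = v"
    "\<And>\<tau> \<kappa>. star_invol \<tau> \<kappa> \<Longrightarrow> mext_inv \<tau> q = mstar q \<Longrightarrow> mext_inv \<tau> v = mstar v"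
    by metis
  \<comment> \<open>As \<open>q * q = \<theta> * \<theta>\<close>, this equals
    \<open>\<theta> * mstar q\<close>; comparing the two forms gives a self-adjoint element of
    square \<open>1\<close>.\<close>
  define \<epsilon> where "\<epsilon> = mstar \<theta> * q"
  have \<epsilon>': "\<epsilon> = \<theta> * mstar q"
  proof -
    have "\<epsilon> = mstar \<theta> * (q * q) * mstar q" by (simp add: \<epsilon>_def mult.assoc qq)
    then show ?thesis by (simp add: q(2) mult.assoc th')
  qed
  show ?thesis
  proof
    show "munitary v" by fact
    have "mstar q * \<theta> = \<theta> * mstar q" using arg_cong[OF \<theta>q(2), of mstar] by simp
    then show "mstar \<epsilon> = \<epsilon>" by (subst \<epsilon>_def) (simp add: \<epsilon>')
    show "\<epsilon> * \<epsilon> = 1"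
    proof -
      have "\<epsilon> * \<epsilon> = (\<theta> * mstar q) * (q * mstar \<theta>)"
        using \<epsilon>' by (simp add: \<epsilon>_def \<theta>q)
      also have "\<dots> = \<theta> * (mstar q * q) * mstar \<theta>" by (simp only: mult.assoc)
      finally have "\<epsilon> * \<epsilon> = \<theta> * (mstar q * q) * mstar \<theta>" .
      then show ?thesis using qq th by simp
    qed
    show "\<epsilon> * v = v * \<epsilon>"
      by (rule v(3)) (metis \<epsilon>_def \<theta>q(2) mult.assoc)
    show "\<theta> = \<epsilon> * v * v" by (simp add: mult.assoc v(2) \<epsilon>' qq)
    show "mext_inv f v = mstar v" by (rule v(5)[OF f fq])
    show "mext_inv \<gamma> v = v" by (rule v(4)[OF g gq])
    show "mext_inv f \<epsilon> = mscl s \<epsilon>"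
      by (subst \<epsilon>', simp add: fs fq \<epsilon>_def)
    have "cnj t = t" using st by auto
    then show "mext_inv \<gamma> \<epsilon> = mscl t \<epsilon>" by (simp add: \<epsilon>_def gt gq)
  qed
qed

section \<open>Matrices of multipliers\<close>

definition mm :: "'b::ring^2^2 \<Rightarrow> 'b^2^2 \<Rightarrow> 'b^2^2"
  where "mm x y = (\<chi> i j. \<Sum>k\<in>UNIV. x $ i $ k * y $ k $ j)"

definition mst :: "'a::cstar_algebra multiplier^2^2 \<Rightarrow> 'a multiplier^2^2"
  where "mst x = (\<chi> i j. mstar (x $ j $ i))"

definition mone :: "'b::{zero,one}^2^2"
  where "mone = (\<chi> i j. if i = j then 1 else 0)"

definition mat22 :: "'b::zero \<Rightarrow> 'b \<Rightarrow> 'b \<Rightarrow> 'b \<Rightarrow> 'b^2^2"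
  where "mat22 a b c d = vector [vector [a, b], vector [c, d]]"

lemma mat22_nth [simp]:
  "mat22 a b c d $ 1 $ 1 = a" "mat22 a b c d $ 1 $ 2 = b"
  "mat22 a b c d $ 2 $ 1 = c" "mat22 a b c d $ 2 $ 2 = d"
  by (simp_all add: mat22_def)

lemma mat22_eq_iff: "(x :: 'b^2^2) = y \<longleftrightarrow>
    x $ 1 $ 1 = y $ 1 $ 1 \<and> x $ 1 $ 2 = y $ 1 $ 2 \<and> x $ 2 $ 1 = y $ 2 $ 1 \<and> x $ 2 $ 2 = y $ 2 $ 2"
  by (auto simp: vec_eq_iff forall_2)

lemma mm_nth [simp]: "mm x y $ i $ j = x $ i $ 1 * y $ 1 $ j + x $ i $ 2 * y $ 2 $ j"
  by (simp add: mm_def sum_2)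

lemma mst_nth [simp]: "mst x $ i $ j = mstar (x $ j $ i)"
  by (simp add: mst_def)

lemma mone_nth [simp]: "mone $ i $ j = (if i = j then 1 else 0)"
  by (simp add: mone_def)

lemma entrywise_nth [simp]: "entrywise f x $ i $ j = f (x $ i $ j)"
  by (simp add: entrywise_def)

lemma mm_assoc: "mm (mm x y) z = mm x (mm y (z :: 'b::ring^2^2))"
  by (simp add: mat22_eq_iff algebra_simps)

lemma mm_mone [simp]: "mm mone x = x" "mm x mone = (x :: 'b::{ring,monoid_mult}^2^2)"
  by (simp_all add: vec_eq_iff forall_2)

lemma mst_mm [simp]: "mst (mm x y) = mm (mst y) (mst x)"
  by (simp add: vec_eq_iff forall_2)

lemma mst_mst [simp]: "mst (mst x) = x"
  by (simp add: vec_eq_iff)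

lemma emb2_inject: "entrywise emb x = entrywise emb y \<longleftrightarrow> x = y"
  by (simp add: vec_eq_iff)

definition unitary2 :: "'a::cstar_algebra multiplier^2^2 \<Rightarrow> bool"
  where "unitary2 w \<longleftrightarrow> mm w (mst w) = mone \<and> mm (mst w) w = mone"

text \<open>Conjugation by \<open>w\<close>, written with the two actions so that the entries stay
  in \<open>A\<close>. Embedding \<open>A\<close> in its multipliers turns it into a matrix product,
  where \<open>w\<close> can be cancelled.\<close>

definition Ad2 :: "'a::cstar_algebra multiplier^2^2 \<Rightarrow> 'a^2^2 \<Rightarrow> 'a^2^2"
  where "Ad2 w x = (\<chi> i j. \<Sum>k\<in>UNIV. \<Sum>l\<in>UNIV. lm (w $ i $ k) (rm (mstar (w $ j $ l)) (x $ k $ l)))"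

lemma emb_Ad2: "entrywise emb (Ad2 w x) = mm (mm w (entrywise emb x)) (mst w)"
  by (simp add: vec_eq_iff forall_2 Ad2_def sum_2 emb_lm_rm algebra_simps del: mstar_rm)

lemma mat2_alg_simps [simp]:
  "carr (mat2_alg g) = UNIV" "nul (mat2_alg g) = 0" "add (mat2_alg g) = (+)"
  "scl (mat2_alg g) c = entrywise (scaleC c)" "mul (mat2_alg g) x y = mm x y"
  "adj (mat2_alg g) z = (\<chi> i j. star (z $ j $ i))" "grd (mat2_alg g) = g"
  by (simp_all add: mat2_alg_def mm_def)

lemma Ad2_graded_iso:
  fixes w :: "'a::cstar_algebra multiplier^2^2"
  assumes w: "unitary2 w" and g: "\<And>x. Ad2 w (h x) = g (Ad2 w x)"
  shows "graded_iso (mat2_alg h) (mat2_alg g) (Ad2 w)"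
proof -
  have w1: "mm w (mst w) = mone" "mm (mst w) w = mone" using w by (auto simp: unitary2_def)
  have w2: "mm w (mm (mst w) x) = x" "mm (mst w) (mm w x) = x" for x
    by (simp_all add: w1 flip: mm_assoc)
  have "bij (Ad2 w)"
    by (rule o_bij[of "Ad2 (mst w)"]; rule ext)
      (simp_all add: emb_Ad2 mm_assoc w1 w2 flip: emb2_inject)
  moreover have "Ad2 w (mm x y) = mm (Ad2 w x) (Ad2 w y)" for x y
  proof -
    have mul: "entrywise emb (mm x y) = mm (entrywise emb x) (entrywise emb y)" for x y :: "'a^2^2"
      by (simp add: vec_eq_iff)
    show ?thesis by (simp add: emb_Ad2 mul mm_assoc w2 flip: emb2_inject)
  qed
  moreover have "Ad2 w (\<chi> i j. star (x $ j $ i)) = (\<chi> i j. star (Ad2 w x $ j $ i))" for x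
  proof -
    have adj: "entrywise emb (\<chi> i j. star (x $ j $ i)) = mst (entrywise emb x)" for x :: "'a^2^2"
      by (simp add: vec_eq_iff)
    show ?thesis by (simp add: emb_Ad2 adj mm_assoc flip: emb2_inject)
  qed
  moreover have "Ad2 w (x + y) = Ad2 w x + Ad2 w y" for x y
    by (simp add: vec_eq_iff forall_2 Ad2_def sum_2 lm_add rm_add del: mstar_rm)
  moreover have "Ad2 w (entrywise (scaleC c) x) = entrywise (scaleC c) (Ad2 w x)" for c x
    by (simp add: vec_eq_iff forall_2 Ad2_def sum_2 lm_scaleC rm_scaleC scaleC_add_right del: mstar_rm)
  ultimately show ?thesis
    using g by (simp add: graded_iso_def star_iso_def)
qed

text \<open>With \<open>h = Ad p \<circ> \<tau>\<close> and \<open>k = Ad q \<circ> \<tau>\<close>,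
  the composite of \<open>k\<close> and \<open>Ad w\<close> is conjugation by
  \<open>q \<tau>(w)\<close> after \<open>\<tau>\<close>. If \<open>q \<tau>(w) = c w p\<close> this
  is \<open>Ad w \<circ> h\<close>, as a phase drops out of a conjugation.\<close>

lemma Ad2_intertwine:
  assumes "star_invol \<tau> \<kappa>"
    and h: "\<And>x. entrywise emb (h x) = mm (mm p (entrywise emb (entrywise \<tau> x))) (mst p)"
    and k: "\<And>x. entrywise emb (k x) = mm (mm q (entrywise emb (entrywise \<tau> x))) (mst q)"
    and w: "mm q (entrywise (mext_inv \<tau>) w) = entrywise (mscl c) (mm w p)" and c: "cmod c = 1"
  shows "Ad2 w (h x) = k (Ad2 w x)"
proof -
  interpret star_invol \<tau> \<kappa> by fact
  have E: "entrywise emb (entrywise \<tau> y) = entrywise ext (entrywise emb y)" for y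
    by (simp add: vec_eq_iff)
  have M: "entrywise ext (mm y z) = mm (entrywise ext y) (entrywise ext z)" for y z
    by (simp add: vec_eq_iff)
  have S: "entrywise ext (mst y) = mst (entrywise ext y)" for y
    by (simp add: vec_eq_iff)
  have c': "c * cnj c = 1" using c by (simp add: complex_norm_square[symmetric])
  have C: "mm (mm (entrywise (mscl c) y) z) (mst (entrywise (mscl c) y)) = mm (mm y z) (mst y)" for y z
    using c' by (simp add: mat22_eq_iff distrib_right mult.commute[of "cnj c"])
  have "entrywise emb (k (Ad2 w x)) =
      mm (mm (mm q (entrywise ext w)) (entrywise ext (entrywise emb x))) (mst (mm q (entrywise ext w)))"
    by (simp only: k E emb_Ad2 M S mst_mm mm_assoc)
  also have "\<dots> = mm (mm (mm w p) (entrywise ext (entrywise emb x))) (mst (mm w p))"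
    by (simp only: w C)
  also have "\<dots> = entrywise emb (Ad2 w (h x))"
    by (simp only: h E emb_Ad2 mst_mm mm_assoc)
  finally show ?thesis by (simp add: emb2_inject)
qed

text \<open>These are \<open>Ad \<sigma>\<^sub>z\<close>, \<open>Ad \<sigma>\<^sub>x\<close> and \<open>Ad \<sigma>\<^sub>y\<close>, composed with the entrywise extension of \<open>h\<close>.\<close>

definition grade2 :: "('a::{zero,uminus} \<Rightarrow> 'a) \<Rightarrow> 'a^2^2 \<Rightarrow> 'a^2^2"
  where "grade2 h x = mat22 (h (x $ 1 $ 1)) (- h (x $ 1 $ 2)) (- h (x $ 2 $ 1)) (h (x $ 2 $ 2))"

definition realx :: "('a::zero \<Rightarrow> 'a) \<Rightarrow> 'a^2^2 \<Rightarrow> 'a^2^2"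
  where "realx h x = mat22 (h (x $ 2 $ 2)) (h (x $ 2 $ 1)) (h (x $ 1 $ 2)) (h (x $ 1 $ 1))"

definition realy :: "('a::{zero,uminus} \<Rightarrow> 'a) \<Rightarrow> 'a^2^2 \<Rightarrow> 'a^2^2"
  where "realy h x = mat22 (h (x $ 2 $ 2)) (- h (x $ 2 $ 1)) (- h (x $ 1 $ 2)) (h (x $ 1 $ 1))"

definition AdM :: "'a::cstar_algebra multiplier \<Rightarrow> 'a \<Rightarrow> 'a"
  where "AdM u a = lm u (rm (mstar u) a)"

lemma emb_AdM: "emb (AdM u a) = u * emb a * mstar u"
  by (simp add: AdM_def emb_lm_rm mult.assoc del: mstar_rm)

lemma munitary_mscl: "munitary u \<Longrightarrow> cmod c = 1 \<Longrightarrow> munitary (mscl c u)"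
  by (simp add: munitary_def complex_norm_square[symmetric] mult.commute[of "cnj c"])

lemma AdM_mscl: "cmod c = 1 \<Longrightarrow> AdM (mscl c u) = AdM u"
  by (rule ext, rule emb_inject[THEN iffD1])
    (simp only: emb_AdM, simp add: complex_norm_square[symmetric] mult.commute[of "cnj c"])

text \<open>\<open>w\<close> may change the grading. Later \<open>Ad2 w\<close> therefore provides
  the graded isomorphism between the triples, not the conjugating unitary on one algebra.\<close>

definition conj2_to :: "('a::cstar_algebra \<Rightarrow> 'a) \<Rightarrow> ('a \<Rightarrow> 'a) \<Rightarrow>
    ('a^2^2 \<Rightarrow> 'a^2^2) \<Rightarrow> ('a^2^2 \<Rightarrow> 'a^2^2) \<Rightarrow> bool"
  where "conj2_to \<gamma> r G \<rho> \<longleftrightarrow> (\<exists>w. unitary2 w \<and>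
    (\<forall>x. Ad2 w (entrywise \<gamma> x) = G (Ad2 w x)) \<and> (\<forall>x. Ad2 w (entrywise r x) = \<rho> (Ad2 w x)))"

lemma twisted_conjugation:
  fixes \<theta> :: "'a::cstar_algebra multiplier"
  assumes f: "star_invol f cnj" and g: "star_invol \<gamma> (\<lambda>c. c)"
    and u: "munitary \<theta>" and r: "\<And>a. r a = AdM \<theta> (f a)"
  shows trivial_conjugation:
      "minvertible (1 + \<theta>) \<Longrightarrow> mext_inv f \<theta> = mstar \<theta> \<Longrightarrow> mext_inv \<gamma> \<theta> = \<theta> \<Longrightarrow>
        \<exists>u. munitary u \<and> mext_inv \<gamma> u = u \<and> (\<forall>a. AdM u (r a) = f (AdM u a))"
    and even_conjugation:
      "minvertible (1 + \<theta> * \<theta>) \<Longrightarrow> mext_inv f \<theta> = - mstar \<theta> \<Longrightarrow> mext_inv \<gamma> \<theta> = \<theta> \<Longrightarrow>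
        conj2_to \<gamma> r (entrywise \<gamma>) (realy f)"
    and odd_conjugation_plus:
      "minvertible (1 + \<theta> * \<theta>) \<Longrightarrow> mext_inv f \<theta> = mstar \<theta> \<Longrightarrow> mext_inv \<gamma> \<theta> = - \<theta> \<Longrightarrow>
        conj2_to \<gamma> r (grade2 \<gamma>) (realx f)"
    and odd_conjugation_minus:
      "minvertible (1 + \<theta> * \<theta>) \<Longrightarrow> mext_inv f \<theta> = - mstar \<theta> \<Longrightarrow> mext_inv \<gamma> \<theta> = - \<theta> \<Longrightarrow>
        conj2_to \<gamma> r (grade2 \<gamma>) (realy f)"
proof -
  interpret f: star_invol f cnj by fact
  interpret g: star_invol \<gamma> "\<lambda>c. c" by fact
  let ?p = "mat22 \<theta> 0 0 \<theta>" and ?F = "\<lambda>x. entrywise emb (entrywise f x)"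
    and ?G = "\<lambda>x. entrywise emb (entrywise \<gamma> x)"
  have hr: "entrywise emb (entrywise r x) = mm (mm ?p (?F x)) (mst ?p)" for x
    by (simp add: mat22_eq_iff r emb_AdM)
  have hg: "entrywise emb (entrywise \<gamma> x) = mm (mm mone (?G x)) (mst mone)" for x
    by (simp add: mat22_eq_iff)
  have kg: "entrywise emb (grade2 \<gamma> x) = mm (mm (mat22 1 0 0 (-1)) (?G x)) (mst (mat22 1 0 0 (-1)))" for x
    by (simp add: mat22_eq_iff grade2_def)
  have kx: "entrywise emb (realx f x) = mm (mm (mat22 0 1 1 0) (?F x)) (mst (mat22 0 1 1 0))" for x
    by (simp add: mat22_eq_iff realx_def)
  have ky: "entrywise emb (realy f x) = mm (mm (mat22 0 (mscl (-\<i>) 1) (mscl \<i> 1) 0) (?F x))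
      (mst (mat22 0 (mscl (-\<i>) 1) (mscl \<i> 1) 0))" for x
    by (simp add: mat22_eq_iff realy_def mscl_minus_left)
  show "\<exists>u. munitary u \<and> mext_inv \<gamma> u = u \<and> (\<forall>a. AdM u (r a) = f (AdM u a))"
    if inv: "minvertible (1 + \<theta>)" and F: "mext_inv f \<theta> = mstar \<theta>" and G: "mext_inv \<gamma> \<theta> = \<theta>"
  proof -
    obtain v where v: "munitary v" "v * v = \<theta>" "mext_inv f v = mstar v" "mext_inv \<gamma> v = v"
      using principal_root[OF u inv] f g F G by metis
    have vv: "mstar v * (v * m) = m" for m using v(1) by (simp add: munitary_def flip: mult.assoc)
    \<comment> \<open>Of the two factors in \<open>\<theta> = v * v\<close>, one cancels against
      \<open>mstar v\<close>. The other is what \<open>f\<close> makes of \<open>mstar v\<close>,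
      since \<open>f v = mstar v\<close>.\<close>
    have "AdM (mstar v) (r a) = f (AdM (mstar v) a)" for a
    proof -
      have "emb (AdM (mstar v) (r a)) = mstar v * (v * v) * emb (f a) * mstar (v * v) * v"
        by (simp only: emb_AdM r v(2) mstar_simps mult.assoc)
      also have "\<dots> = v * emb (f a) * mstar v"
        using v(1) by (simp add: mult.assoc vv munitary_def)
      also have "\<dots> = emb (f (AdM (mstar v) a))"
        by (simp only: f.ext_simps(9)[symmetric] emb_AdM f.ext_simps(6,8) v(3) mstar_simps)
      finally show ?thesis by simp
    qed
    then show ?thesis using v by (intro exI[of _ "mstar v"]) simp
  qed
  show "conj2_to \<gamma> r (entrywise \<gamma>) (realy f)"
    if "minvertible (1 + \<theta> * \<theta>)" "mext_inv f \<theta> = - mstar \<theta>" "mext_inv \<gamma> \<theta> = \<theta>"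
  proof -
    have "mext_inv f \<theta> = mscl (-1) (mstar \<theta>)" "mext_inv \<gamma> \<theta> = mscl 1 \<theta>"
      using that by (simp_all add: mscl_minus_left)
    from phase_root[OF f g u that(1) this]
    obtain v \<epsilon> where v: "munitary v" and e: "\<epsilon> * \<epsilon> = 1" "mstar \<epsilon> = \<epsilon>" "\<epsilon> * v = v * \<epsilon>"
      and \<theta>: "\<theta> = \<epsilon> * v * v" and e': "mext_inv f v = mstar v" "mext_inv \<gamma> v = v"
        "mext_inv f \<epsilon> = - \<epsilon>" "mext_inv \<gamma> \<epsilon> = \<epsilon>"
      by (auto simp: mscl_minus_left)
    have v1: "v * mstar v = 1" "mstar v * v = 1" using v by (auto simp: munitary_def)
    have v2: "v * (mstar v * m) = m" "mstar v * (v * m) = m" "\<epsilon> * (\<epsilon> * m) = m" for m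
      by (simp_all add: v1 e flip: mult.assoc)
    have ve: "v * \<epsilon> = \<epsilon> * v" "mstar v * \<epsilon> = \<epsilon> * mstar v"
      by (rule HOL.sym[OF e(3)]) (use arg_cong[OF e(3), of mstar] in \<open>unfold mstar_simps e(2)\<close>)
    have ve': "mstar v * (\<epsilon> * m) = \<epsilon> * (mstar v * m)" for m
      using ve by (simp flip: mult.assoc)
    define P Q where "P = mscl (1/2) (1 + \<epsilon>)" and "Q = mscl (1/2) (1 - \<epsilon>)"
    have half: "mscl (1/2) m + mscl (1/2) m = m" for m :: "'a multiplier"
      by (simp flip: mscl_add_left)
    have four: "mscl (1/4) m + mscl (1/4) m = mscl (1/2) m" for m :: "'a multiplier"
      by (simp flip: mscl_add_left)
    have half': "mscl (1/2) m + (mscl (1/2) m + n) = m + n" for m n :: "'a multiplier"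
      using half by (simp flip: add.assoc)
    have four': "mscl (1/4) m + (mscl (1/4) m + n) = mscl (1/2) m + n" for m n :: "'a multiplier"
      using four by (simp flip: add.assoc)
    have PQ: "P * P = P" "Q * Q = Q" "P * Q = 0" "Q * P = 0" "P + Q = 1" "mstar P = P" "mstar Q = Q"
      "mext_inv f P = Q" "mext_inv f Q = P" "mext_inv \<gamma> P = P" "mext_inv \<gamma> Q = Q"
      "v * P = P * v" "v * Q = Q * v" "P * \<epsilon> = P" "Q * \<epsilon> = - Q"
      by (simp_all add: P_def Q_def e(1,2) e' ve algebra_simps half half' four four')
    have PQ': "P * (P * m) = P * m" "Q * (Q * m) = Q * m" "P * (Q * m) = 0" "Q * (P * m) = 0"
      "v * (P * m) = P * (v * m)" "v * (Q * m) = Q * (v * m)" "P * (\<epsilon> * m) = P * m"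
      "Q * (\<epsilon> * m) = - (Q * m)" for m
      using PQ by (simp_all flip: mult.assoc)
    have PQ'': "P * m + Q * m = m" for m using PQ(5) by (metis distrib_right mult_1_left)
    have vs: "mstar v * P = P * mstar v" "mstar v * Q = Q * mstar v"
      using arg_cong[OF PQ(12), of mstar] arg_cong[OF PQ(13), of mstar] by (simp_all add: PQ(6,7))
    have vs': "mstar v * (P * m) = P * (mstar v * m)" "mstar v * (Q * m) = Q * (mstar v * m)" for m
      using vs by (simp_all flip: mult.assoc)
    \<comment> \<open>\<open>w = (P \<otimes> 1 - Q \<otimes> \<sigma>\<^sub>y) v\<^sup>*\<close>, because \<open>f\<close> interchanges \<open>P\<close> and \<open>Q\<close>.\<close>
    define w where "w = mat22 (P * mstar v) (mscl \<i> (Q * mstar v)) (mscl (-\<i>) (Q * mstar v)) (P * mstar v)"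
    have "unitary2 w"
      using PQ(5)
      by (simp add: unitary2_def w_def mat22_eq_iff PQ PQ' PQ'' vs vs' v1 v2 mult.assoc
          mscl_minus_left add.commute)
    moreover have "Ad2 w (entrywise \<gamma> x) = entrywise \<gamma> (Ad2 w x)" for x
      by (rule Ad2_intertwine[OF g hg hg, where c = 1])
        (simp_all add: w_def mat22_eq_iff PQ e')
    \<comment> \<open>Two signs match here: complex conjugation negates
      \<open>\<sigma>\<^sub>y\<close>, and \<open>\<epsilon>\<close> is \<open>-1\<close> on
      \<open>Q\<close>.\<close>
    moreover have "Ad2 w (entrywise r x) = realy f (Ad2 w x)" for x
      by (rule Ad2_intertwine[OF f hr ky, where c = 1])
        (simp_all add: w_def mat22_eq_iff PQ PQ' e' vs vs' ve' v1 v2 \<theta> mult.assoc mscl_minus_left)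
    ultimately show ?thesis unfolding conj2_to_def by blast
  qed
  \<comment> \<open>One \<open>w\<close> serves both values of \<open>s\<close>: it is determined by
    \<open>\<gamma>\<close>, which exchanges the projections in either case, and \<open>s\<close>
    only selects the Pauli matrix.\<close>
  have odd: "(s = 1 \<longrightarrow> conj2_to \<gamma> r (grade2 \<gamma>) (realx f)) \<and>
      (s = -1 \<longrightarrow> conj2_to \<gamma> r (grade2 \<gamma>) (realy f))"
    if inv: "minvertible (1 + \<theta> * \<theta>)" and fs: "mext_inv f \<theta> = mscl s (mstar \<theta>)"
      and gt: "mext_inv \<gamma> \<theta> = - \<theta>" and s: "s = 1 \<or> s = -1" for s
  proof -
    have "mext_inv \<gamma> \<theta> = mscl (-1) \<theta>" using gt by (simp add: mscl_minus_left)
    from phase_root[OF f g u inv fs this s]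
    obtain v \<epsilon> where v: "munitary v" and e: "\<epsilon> * \<epsilon> = 1" "mstar \<epsilon> = \<epsilon>" "\<epsilon> * v = v * \<epsilon>"
      and \<theta>: "\<theta> = \<epsilon> * v * v" and e': "mext_inv f v = mstar v" "mext_inv \<gamma> v = v"
        "mext_inv f \<epsilon> = mscl s \<epsilon>" "mext_inv \<gamma> \<epsilon> = - \<epsilon>"
      by (auto simp: mscl_minus_left)
    have v1: "v * mstar v = 1" "mstar v * v = 1" using v by (auto simp: munitary_def)
    have v2: "v * (mstar v * m) = m" "mstar v * (v * m) = m" "\<epsilon> * (\<epsilon> * m) = m" for m
      by (simp_all add: v1 e flip: mult.assoc)
    have ve: "v * \<epsilon> = \<epsilon> * v" "mstar v * \<epsilon> = \<epsilon> * mstar v"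
      by (rule HOL.sym[OF e(3)]) (use arg_cong[OF e(3), of mstar] in \<open>unfold mstar_simps e(2)\<close>)
    have ve': "v * (\<epsilon> * m) = \<epsilon> * (v * m)" "mstar v * (\<epsilon> * m) = \<epsilon> * (mstar v * m)" for m
      using ve by (simp_all flip: mult.assoc)
    \<comment> \<open>\<open>w = (P \<otimes> a + Q \<otimes> \<sigma>\<^sub>z a) v\<^sup>*\<close>, where \<open>a\<close> times its transpose is \<open>\<i> \<sigma>\<^sub>x\<close>.\<close>
    define w where "w = mat22 (mscl ((1 + \<i>) / 2) (mstar v)) (mscl ((-1 + \<i>) / 2) (mstar v))
      (mscl ((1 + \<i>) / 2) (\<epsilon> * mstar v)) (mscl ((1 - \<i>) / 2) (\<epsilon> * mstar v))"
    have "unitary2 w"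
      by (simp add: unitary2_def w_def mat22_eq_iff e(1,2) ve ve' v1 v2 mult.assoc flip: mscl_add_left)
        (simp add: complex_eq_iff field_simps)
    moreover have "Ad2 w (entrywise \<gamma> x) = grade2 \<gamma> (Ad2 w x)" for x
      by (rule Ad2_intertwine[OF g hg kg, where c = 1])
        (simp_all add: w_def mat22_eq_iff e')
    \<comment> \<open>On \<open>P\<close> the condition is that \<open>\<sigma>\<^sub>x\<close>
      times the conjugate of \<open>a\<close> be \<open>c a\<close>, and the choice of
      \<open>a\<close> gives \<open>c = - \<i>\<close>. For \<open>s = -1\<close>, where
      \<open>f\<close> exchanges \<open>P\<close> and \<open>Q\<close>, the product
      \<open>\<sigma>\<^sub>y \<sigma>\<^sub>z = \<i> \<sigma>\<^sub>x\<close> takes the place of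
      \<open>\<sigma>\<^sub>x\<close> and the phase is \<open>1\<close>.\<close>
    moreover have "Ad2 w (entrywise r x) = realx f (Ad2 w x)" if "s = 1" for x
      by (rule Ad2_intertwine[OF f hr kx, where c = "-\<i>"])
        (simp_all add: w_def mat22_eq_iff e(1,2) e' ve ve' v1 v2 \<theta> that mult.assoc algebra_simps
            add_divide_distrib diff_divide_distrib)
    moreover have "Ad2 w (entrywise r x) = realy f (Ad2 w x)" if "s = -1" for x
      by (rule Ad2_intertwine[OF f hr ky, where c = 1])
        (simp_all add: w_def mat22_eq_iff e(1,2) e' ve ve' v1 v2 \<theta> that mult.assoc mscl_minus_left
            algebra_simps add_divide_distrib diff_divide_distrib)
    ultimately show ?thesis unfolding conj2_to_def by blast
  qed
  show "conj2_to \<gamma> r (grade2 \<gamma>) (realx f)"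
    if "minvertible (1 + \<theta> * \<theta>)" "mext_inv f \<theta> = mstar \<theta>" "mext_inv \<gamma> \<theta> = - \<theta>"
    using odd[of 1] that by auto
  show "conj2_to \<gamma> r (grade2 \<gamma>) (realy f)"
    if "minvertible (1 + \<theta> * \<theta>)" "mext_inv f \<theta> = - mstar \<theta>" "mext_inv \<gamma> \<theta> = - \<theta>"
    using odd[of "-1"] that by (auto simp: mscl_minus_left)
qed

section \<open>Generators and relative signs\<close>

lemma graded_alg_simps [simp]:
  "carr (graded_alg \<gamma>) = UNIV" "nul (graded_alg \<gamma>) = 0" "add (graded_alg \<gamma>) = (+)"
  "scl (graded_alg \<gamma>) = scaleC" "mul (graded_alg \<gamma>) = (*)" "adj (graded_alg \<gamma>) = star"
  "grd (graded_alg \<gamma>) = \<gamma>"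
  by (simp_all add: graded_alg_def)

lemma grading_star_invol: "grading (graded_alg \<gamma>) \<Longrightarrow> star_invol \<gamma> (\<lambda>c. c)"
  by (simp add: grading_def star_iso_def star_invol_def)

lemma real_structure_star_invol: "real_structure (graded_alg \<gamma>) f \<Longrightarrow> star_invol f cnj"
  by (simp add: real_structure_def star_invol_def)

text \<open>Dictionary between the type of multipliers and the carrier of \<open>mult_alg\<close>;
  as the carrier of \<open>graded_alg\<close> is the whole type, extensional functions are plain
  functions.\<close>

definition pr :: "'a::cstar_algebra multiplier \<Rightarrow> ('a \<Rightarrow> 'a) \<times> ('a \<Rightarrow> 'a)"
  where "pr m = (lm m, rm m)"

lemma pr_inject [simp]: "pr m = pr n \<longleftrightarrow> m = n"
  by (auto simp: pr_def intro: multiplier_eqI)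

lemma carr_mult_alg: "carr (mult_alg (graded_alg \<gamma>)) = range pr"
proof -
  have "(L, R) \<in> range pr" if "(L, R) \<in> double_centralizers (graded_alg \<gamma>)" for L R :: "'a \<Rightarrow> 'a"
  proof -
    have "(L, R) \<in> {(L, R). (\<forall>a b. L (a * b) = L a * b) \<and>
      (\<forall>a b. R (a * b) = a * R b) \<and> (\<forall>a b. a * L b = R a * b)}"
      using that by (auto simp: double_centralizers_def)
    then have "pr (Abs_multiplier (L, R)) = (L, R)"
      by (simp add: pr_def lm.rep_eq rm.rep_eq Abs_multiplier_inverse)
    then show ?thesis by (metis rangeI)
  qed
  moreover have "pr m \<in> double_centralizers (graded_alg \<gamma>)" for m
    by (auto simp: pr_def double_centralizers_def linear_map_on_def lm_add rm_add lm_scaleC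
      rm_scaleC lm_mult rm_mult lm_rm)
  ultimately show ?thesis by (auto simp: mult_alg_def)
qed

lemma mult_alg_pr [simp]:
  "add (mult_alg (graded_alg \<gamma>)) (pr m) (pr n) = pr (m + n)"
  "scl (mult_alg (graded_alg \<gamma>)) c (pr m) = pr (mscl c m)"
  "mul (mult_alg (graded_alg \<gamma>)) (pr m) (pr n) = pr (m * n)"
  "adj (mult_alg (graded_alg \<gamma>)) (pr m) = pr (mstar m)"
  "mult_one (graded_alg \<gamma>) = pr 1"
  by (auto simp: mult_alg_def pr_def mult_one_def compose_def)

lemma mext_pr:
  assumes "star_invol \<tau> \<kappa>" shows "mext (graded_alg \<gamma>) \<tau> (pr m) = pr (mext_inv \<tau> m)"
proof -
  interpret star_invol \<tau> \<kappa> by fact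
  have "inv_into UNIV \<tau> = \<tau>" by (rule inv_equality) auto
  then show ?thesis by (auto simp: mext_def pr_def)
qed

lemma grd_pr:
  "star_invol \<gamma> \<kappa> \<Longrightarrow> grd (mult_alg (graded_alg \<gamma>)) (pr m) = pr (mext_inv \<gamma> m)"
  by (simp add: mext_pr mult_alg_def)

lemma generator_pr:
  "generator (graded_alg \<gamma>) r f T \<longleftrightarrow> (\<exists>\<theta>. T = pr \<theta> \<and> munitary \<theta> \<and> (\<forall>a. r (f a) = AdM \<theta> a))"
proof -
  have "Ad (graded_alg \<gamma>) (pr m) a = AdM m a" for m and a :: 'a
    by (simp only: Ad_def mult_alg_pr) (simp add: pr_def AdM_def)
  then show ?thesis
    by (auto simp: generator_def mult_unitary_def carr_mult_alg munitary_def)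
qed

lemma mult_spectrum_pr:
  "c \<notin> mult_spectrum (graded_alg \<gamma>) (pr m) \<longleftrightarrow> minvertible (mscl c 1 - m)"
  by (auto simp: mult_spectrum_def carr_mult_alg minvertible_def Let_def mscl_minus_left
    simp flip: diff_conv_add_uminus)

lemma mult_center_pr:
  "pr c \<in> mult_center (graded_alg \<gamma>) \<longleftrightarrow> (\<forall>m. c * m = m * c)"
  by (auto simp: mult_center_def carr_mult_alg)

text \<open>The circle is infinite, since its real parts fill an interval, so \<open>S\<close> and
  \<open>- S\<close> do not cover it. This yields the gap when the spectrum is finite.\<close>

lemma unit_circle_avoids_finite:
  assumes "finite S"
  obtains z :: complex where "cmod z = 1" "z \<notin> S" "- z \<notin> S"
proof -
  have "infinite {z :: complex. cmod z = 1}"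
  proof
    assume "finite {z :: complex. cmod z = 1}"
    moreover have "{-1..1} \<subseteq> Re ` {z. cmod z = 1}"
    proof
      fix x :: real assume "x \<in> {-1..1}"
      then have "x\<^sup>2 \<le> 1" by (simp add: abs_square_le_1 abs_le_iff)
      then have "cmod (Complex x (sqrt (1 - x\<^sup>2))) = 1" by (simp add: cmod_def)
      then show "x \<in> Re ` {z. cmod z = 1}" by force
    qed
    ultimately have "finite {-1..1::real}" by (meson finite_imageI finite_subset)
    then show False by (simp add: infinite_Icc)
  qed
  then have "infinite ({z. cmod z = 1} - (S \<union> uminus ` S))"
    using assms by simp
  then obtain z where "z \<in> {z. cmod z = 1} - (S \<union> uminus ` S)"
    by (metis equals0I finite.emptyI)
  then show ?thesis using that[of z] by force
qed

text \<open>The generator that carries the signs need not be the one with a gap. If its spectrum is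
  finite it has a gap itself. Under \<open>condA1\<close> the two differ by a central unitary
  \<open>c\<close> with \<open>f c = mstar c\<close> and \<open>\<gamma> c = c\<close>, so in both
  sign products \<open>c\<close> meets its adjoint and cancels.\<close>

lemma gapped_generator:
  fixes \<gamma> f r :: "'a::cstar_algebra \<Rightarrow> 'a"
  assumes "grading (graded_alg \<gamma>)" "real_structure (graded_alg \<gamma>) f"
    and AB: "condA1 (graded_alg \<gamma>) f \<and> condA2 (graded_alg \<gamma>) r f \<or> condB2 (graded_alg \<gamma>) r f"
    and signs: "relative_signs (graded_alg \<gamma>) r f (s, t)"
  obtains \<theta> z where "munitary \<theta>" "\<And>a. r (f a) = AdM \<theta> a"
    "\<theta> * mext_inv f \<theta> = mscl s 1" "\<theta> * mext_inv \<gamma> (mstar \<theta>) = mscl t 1"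
    "cmod z = 1" "minvertible (mscl z 1 - \<theta>)" "minvertible (mscl (-z) 1 - \<theta>)"
proof -
  note f = real_structure_star_invol[OF assms(2)] and g = grading_star_invol[OF assms(1)]
  interpret f: star_invol f cnj by fact
  interpret g: star_invol \<gamma> "\<lambda>c. c" by fact
  note pr = generator_pr mext_pr[OF f] grd_pr[OF g]
  obtain \<theta>\<^sub>0 where t0: "munitary \<theta>\<^sub>0" "\<And>a. r (f a) = AdM \<theta>\<^sub>0 a"
    "\<theta>\<^sub>0 * mext_inv f \<theta>\<^sub>0 = mscl s 1" "\<theta>\<^sub>0 * mext_inv \<gamma> (mstar \<theta>\<^sub>0) = mscl t 1"
    "condA1 (graded_alg \<gamma>) f \<or> finite (mult_spectrum (graded_alg \<gamma>) (pr \<theta>\<^sub>0))"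
    using signs unfolding relative_signs_def by (auto simp: pr)
  show ?thesis
  proof (cases "condA1 (graded_alg \<gamma>) f")
    case False
    then obtain z where "cmod z = 1" "minvertible (mscl z 1 - \<theta>\<^sub>0)" "minvertible (mscl (-z) 1 - \<theta>\<^sub>0)"
      using t0(5) unit_circle_avoids_finite by (metis mult_spectrum_pr)
    then show ?thesis using that t0 by blast
  next
    case True
    have "\<exists>\<theta> z. munitary \<theta> \<and> (\<forall>a. r (f a) = AdM \<theta> a) \<and> cmod z = 1 \<and>
        minvertible (mscl z 1 - \<theta>) \<and> minvertible (mscl (-z) 1 - \<theta>)"
      using AB
    proof (elim disjE conjE)
      assume "condA2 (graded_alg \<gamma>) r f"
      then show ?thesis unfolding condA2_def pr by (metis mult_spectrum_pr)
    next
      assume "condB2 (graded_alg \<gamma>) r f"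
      then obtain \<theta> where *: "munitary \<theta>" "\<forall>a. r (f a) = AdM \<theta> a"
        "finite (mult_spectrum (graded_alg \<gamma>) (pr \<theta>))"
        unfolding condB2_def pr by auto
      from *(3) obtain z where "cmod z = 1" "minvertible (mscl z 1 - \<theta>)" "minvertible (mscl (-z) 1 - \<theta>)"
        using unit_circle_avoids_finite by (metis mult_spectrum_pr)
      with * show ?thesis by blast
    qed
    then obtain \<theta> z where t: "munitary \<theta>" "\<And>a. r (f a) = AdM \<theta> a" "cmod z = 1"
        "minvertible (mscl z 1 - \<theta>)" "minvertible (mscl (-z) 1 - \<theta>)" by blast
    \<comment> \<open>Both generators implement \<open>r \<circ> f\<close>, so \<open>c\<close>
      commutes with \<open>A\<close>.\<close>
    define c where "c = mstar \<theta>\<^sub>0 * \<theta>"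
    have u0: "\<theta>\<^sub>0 * mstar \<theta>\<^sub>0 = 1" "mstar \<theta>\<^sub>0 * \<theta>\<^sub>0 = 1" and u: "\<theta> * mstar \<theta> = 1" "mstar \<theta> * \<theta> = 1"
      using t0(1) t(1) by (auto simp: munitary_def)
    then have u0': "\<theta>\<^sub>0 * (mstar \<theta>\<^sub>0 * m) = m" "mstar \<theta>\<^sub>0 * (\<theta>\<^sub>0 * m) = m"
      and u': "\<theta> * (mstar \<theta> * m) = m" "mstar \<theta> * (\<theta> * m) = m" for m
      by (simp_all flip: mult.assoc)
    have "c * emb a = emb a * c" for a
    proof -
      have "emb (AdM \<theta> a) = emb (AdM \<theta>\<^sub>0 a)" by (metis t(2) t0(2))
      then have "mstar \<theta>\<^sub>0 * (\<theta> * emb a * mstar \<theta>) * \<theta> = mstar \<theta>\<^sub>0 * (\<theta>\<^sub>0 * emb a * mstar \<theta>\<^sub>0) * \<theta>"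
        by (simp only: emb_AdM)
      then show ?thesis by (simp add: c_def mult.assoc u u0')
    qed
    then have c: "c * m = m * c" for m by (rule emb_commute_imp)
    then have "pr c \<in> mult_center (graded_alg \<gamma>)" by (simp add: mult_center_pr)
    then have "mext_inv f (mstar c) = c" "mext_inv \<gamma> c = c"
      using True unfolding condA1_def by (auto simp: pr)
    then have fc: "mext_inv f c = mstar c" and gc: "mext_inv \<gamma> c = c"
      by (metis f.ext_simps(8) mstar_simps(8))+
    have cc: "c * mstar c = 1" by (simp add: c_def mult.assoc u' u0 u0')
    have tc: "\<theta> = \<theta>\<^sub>0 * c" by (simp add: c_def u0')
    show ?thesis
    proof (rule that[OF t(1,2) _ _ t(3-5)])
      have "\<theta> * mext_inv f \<theta> = \<theta>\<^sub>0 * mext_inv f \<theta>\<^sub>0 * (c * mstar c)"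
        unfolding tc by (simp add: fc) (metis c mult.assoc)
      then show "\<theta> * mext_inv f \<theta> = mscl s 1" by (simp add: cc t0(3))
      have "\<theta> * mext_inv \<gamma> (mstar \<theta>) = \<theta>\<^sub>0 * (c * mstar c) * mext_inv \<gamma> (mstar \<theta>\<^sub>0)"
        unfolding tc by (simp add: gc mult.assoc)
      then show "\<theta> * mext_inv \<gamma> (mstar \<theta>) = mscl t 1" using t0(4) by (simp add: cc)
    qed
  qed
qed

lemma conjugating_unitary:
  fixes \<gamma> f r :: "'a::cstar_algebra \<Rightarrow> 'a"
  assumes "grading (graded_alg \<gamma>)" "real_structure (graded_alg \<gamma>) f"
    and "condA1 (graded_alg \<gamma>) f \<and> condA2 (graded_alg \<gamma>) r f \<or> condB2 (graded_alg \<gamma>) r f"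
    and "relative_signs (graded_alg \<gamma>) r f (s, t)"
  shows
    "(s, t) = (1, 1) \<Longrightarrow> \<exists>u. munitary u \<and> mext_inv \<gamma> u = u \<and> (\<forall>a. AdM u (r a) = f (AdM u a))"
    "(s, t) = (-1, 1) \<Longrightarrow>
        conj2_to \<gamma> r (entrywise \<gamma>) (realy f)"
    "(s, t) = (1, -1) \<Longrightarrow>
        conj2_to \<gamma> r (grade2 \<gamma>) (realx f)"
    "(s, t) = (-1, -1) \<Longrightarrow>
        conj2_to \<gamma> r (grade2 \<gamma>) (realy f)"
proof -
  note f = real_structure_star_invol[OF assms(2)] and g = grading_star_invol[OF assms(1)]
  interpret f: star_invol f cnj by fact
  interpret g: star_invol \<gamma> "\<lambda>c. c" by fact
  obtain \<theta> z where u: "munitary \<theta>" and r: "\<And>a. r (f a) = AdM \<theta> a"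
    and s: "\<theta> * mext_inv f \<theta> = mscl s 1" and t: "\<theta> * mext_inv \<gamma> (mstar \<theta>) = mscl t 1"
    and z: "cmod z = 1" "minvertible (mscl z 1 - \<theta>)" "minvertible (mscl (-z) 1 - \<theta>)"
    using gapped_generator[OF assms] by metis
  have z0: "z \<noteq> 0" using z(1) by auto
  have u1: "\<theta> * mstar \<theta> = 1" "mstar \<theta> * \<theta> = 1" using u by (auto simp: munitary_def)
  have "mstar \<theta> * (\<theta> * mext_inv f \<theta>) = mscl s (mstar \<theta>)" by (simp add: s)
  then have F: "mext_inv f \<theta> = mscl s (mstar \<theta>)" by (simp add: u1 flip: mult.assoc)
  have "mstar \<theta> * (\<theta> * mext_inv \<gamma> (mstar \<theta>)) = mscl t (mstar \<theta>)" by (simp only: t) simp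
  then have "mstar (mext_inv \<gamma> \<theta>) = mscl t (mstar \<theta>)" by (simp add: u1 flip: mult.assoc)
  then have G: "mext_inv \<gamma> \<theta> = mscl (cnj t) \<theta>" by (metis mstar_simps(7,8))
  have r': "r a = AdM (mscl c \<theta>) (f a)" if "cmod c = 1" for a c
    using r[of "f a"] by (simp add: AdM_mscl[OF that])
  \<comment> \<open>The factor \<open>- 1 / z\<close> moves the gap from \<open>z\<close> to
    \<open>-1\<close>, and \<open>\<i> / z\<close> moves the gaps from \<open>z, - z\<close> to
    \<open>\<i>, - \<i>\<close>. A phase leaves the sign relations alone, as \<open>f\<close> and
    \<open>mstar\<close> both conjugate it and \<open>\<gamma>\<close> is linear.\<close>
  have c1: "cmod (- 1 / z) = 1" "cmod (\<i> / z) = 1" using z(1) by (simp_all add: norm_divide)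
  have "1 + mscl (- 1 / z) \<theta> = mscl (1 / z) (mscl z 1 - \<theta>)"
    using z0 by (simp add: mscl_minus_left)
  then have inv1: "minvertible (1 + mscl (- 1 / z) \<theta>)"
    using z(2) z0 by (simp add: minvertible_mscl del: mscl_simps)
  have "1 + mscl (\<i> / z) \<theta> * mscl (\<i> / z) \<theta> = mscl (- 1 / (z * z)) ((mscl z 1 - \<theta>) * (mscl (-z) 1 - \<theta>))"
    using z0 by (simp add: mscl_minus_left algebra_simps)
  then have inv2: "minvertible (1 + mscl (\<i> / z) \<theta> * mscl (\<i> / z) \<theta>)"
    using z z0 by (simp add: minvertible_mscl minvertible_mult del: mscl_simps)
  note con = twisted_conjugation[OF f g munitary_mscl[OF u] r']
  show "\<exists>u. munitary u \<and> mext_inv \<gamma> u = u \<and> (\<forall>a. AdM u (r a) = f (AdM u a))"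
    if "(s, t) = (1, 1)"
    by (rule con(1)[OF c1(1) c1(1) inv1]) (use that F G in simp_all)
  show "conj2_to \<gamma> r (entrywise \<gamma>) (realy f)" if "(s, t) = (-1, 1)"
    by (rule con(2)[OF c1(2) c1(2) inv2]) (use that F G in \<open>simp_all add: mscl_minus_left\<close>)
  show "conj2_to \<gamma> r (grade2 \<gamma>) (realx f)" if "(s, t) = (1, -1)"
    by (rule con(3)[OF c1(2) c1(2) inv2]) (use that F G in \<open>simp_all add: mscl_minus_left\<close>)
  show "conj2_to \<gamma> r (grade2 \<gamma>) (realy f)" if "(s, t) = (-1, -1)"
    by (rule con(4)[OF c1(2) c1(2) inv2]) (use that F G in \<open>simp_all add: mscl_minus_left\<close>)
qed

section \<open>Concrete models of graded tensor products\<close>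

text \<open>Sum and zero are those of an ambient additive group, so that finite sums and
  cancellation in the carrier are the ordinary ones. The field of scalars is arbitrary, to serve
  complex algebras and their real subalgebras alike.\<close>

locale plain_galg =
  fixes B :: "('b::ab_group_add, 'k::field) galg"
  assumes add_eq [simp]: "add B = (+)" and nul_eq [simp]: "nul B = 0"
    and carr_zero [simp]: "0 \<in> carr B"
    and carr_add [simp]: "x \<in> carr B \<Longrightarrow> y \<in> carr B \<Longrightarrow> x + y \<in> carr B"
    and carr_scl [simp]: "x \<in> carr B \<Longrightarrow> scl B c x \<in> carr B"
    and carr_mul [simp]: "x \<in> carr B \<Longrightarrow> y \<in> carr B \<Longrightarrow> mul B x y \<in> carr B"
    and carr_adj [simp]: "x \<in> carr B \<Longrightarrow> adj B x \<in> carr B"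
    and carr_grd [simp]: "x \<in> carr B \<Longrightarrow> grd B x \<in> carr B"
    and scl_add_right: "x \<in> carr B \<Longrightarrow> y \<in> carr B \<Longrightarrow> scl B c (x + y) = scl B c x + scl B c y"
    and scl_add_left: "x \<in> carr B \<Longrightarrow> scl B (c + d) x = scl B c x + scl B d x"
    and scl_scl: "x \<in> carr B \<Longrightarrow> scl B c (scl B d x) = scl B (c * d) x"
    and scl_one [simp]: "x \<in> carr B \<Longrightarrow> scl B 1 x = x"
    and mul_add_left: "x \<in> carr B \<Longrightarrow> y \<in> carr B \<Longrightarrow> z \<in> carr B \<Longrightarrow>
      mul B (x + y) z = mul B x z + mul B y z"
    and mul_add_right: "x \<in> carr B \<Longrightarrow> y \<in> carr B \<Longrightarrow> z \<in> carr B \<Longrightarrow>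
      mul B x (y + z) = mul B x y + mul B x z"
    and mul_scl_left: "x \<in> carr B \<Longrightarrow> y \<in> carr B \<Longrightarrow> mul B (scl B c x) y = scl B c (mul B x y)"
    and mul_scl_right: "x \<in> carr B \<Longrightarrow> y \<in> carr B \<Longrightarrow> mul B x (scl B c y) = scl B c (mul B x y)"
    and adj_add: "x \<in> carr B \<Longrightarrow> y \<in> carr B \<Longrightarrow> adj B (x + y) = adj B x + adj B y"
    and grd_add: "x \<in> carr B \<Longrightarrow> y \<in> carr B \<Longrightarrow> grd B (x + y) = grd B x + grd B y"
    and grd_scl: "x \<in> carr B \<Longrightarrow> grd B (scl B c x) = scl B c (grd B x)"
    and grd_grd [simp]: "x \<in> carr B \<Longrightarrow> grd B (grd B x) = x"
    and grd_adj: "x \<in> carr B \<Longrightarrow> grd B (adj B x) = adj B (grd B x)"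
begin

lemma scl_zero_left [simp]: "x \<in> carr B \<Longrightarrow> scl B 0 x = 0"
  using scl_add_left[of x 0 0] by simp

lemma scl_zero_right [simp]: "scl B c 0 = 0"
  using scl_add_right[of 0 0 c] by simp

lemma scl_minus_one [simp]: "x \<in> carr B \<Longrightarrow> scl B (-1) x = - x"
  using scl_add_left[of x 1 "-1"] by (simp add: eq_neg_iff_add_eq_0 add.commute)

lemma carr_minus [simp]: "x \<in> carr B \<Longrightarrow> - x \<in> carr B"
  using carr_scl[of x "-1"] by simp

lemma carr_diff [simp]: "x \<in> carr B \<Longrightarrow> y \<in> carr B \<Longrightarrow> x - y \<in> carr B"
  using carr_add[of x "- y"] by simp

lemma mul_zero [simp]: "x \<in> carr B \<Longrightarrow> mul B 0 x = 0" "x \<in> carr B \<Longrightarrow> mul B x 0 = 0"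
  using mul_add_left[of 0 0 x] mul_add_right[of x 0 0] by simp_all

lemma adj_zero [simp]: "adj B 0 = 0"
  using adj_add[of 0 0] by simp

lemma grd_zero [simp]: "grd B 0 = 0"
  using grd_add[of 0 0] by simp

lemma scl_minus: "x \<in> carr B \<Longrightarrow> scl B c (- x) = - scl B c x"
  using scl_add_right[of x "- x" c] by (simp add: eq_neg_iff_add_eq_0 add.commute)

lemma adj_minus: "x \<in> carr B \<Longrightarrow> adj B (- x) = - adj B x"
  using adj_add[of x "- x"] by (simp add: eq_neg_iff_add_eq_0 add.commute)

lemma grd_minus: "x \<in> carr B \<Longrightarrow> grd B (- x) = - grd B x"
  using grd_add[of x "- x"] by (simp add: eq_neg_iff_add_eq_0 add.commute)

lemma mul_minus: "x \<in> carr B \<Longrightarrow> y \<in> carr B \<Longrightarrow> mul B (- x) y = - mul B x y"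
    "x \<in> carr B \<Longrightarrow> y \<in> carr B \<Longrightarrow> mul B x (- y) = - mul B x y"
  using mul_add_left[of x "- x" y] mul_add_right[of x y "- y"]
  by (simp_all add: eq_neg_iff_add_eq_0 add.commute)

lemma carr_even_odd [simp]:
  "x \<in> carr B \<Longrightarrow> even_part B x \<in> carr B" "x \<in> carr B \<Longrightarrow> odd_part B x \<in> carr B"
  by (simp_all add: even_part_def odd_part_def)

lemma carr_sum: "finite J \<Longrightarrow> (\<And>j. j \<in> J \<Longrightarrow> v j \<in> carr B) \<Longrightarrow> sum v J \<in> carr B"
  by (induction J rule: finite_induct) auto

end

section \<open>Formal sums and concrete models\<close>

definition tsum :: "('a \<Rightarrow> 'b \<Rightarrow> 'x::comm_monoid_add) \<Rightarrow> ('a \<times> 'b) multiset \<Rightarrow> 'x"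
  where "tsum T M = (\<Sum>(a, b)\<in>#M. T a b)"

lemma tsum_simps [simp]:
  "tsum T {#} = 0" "tsum T (add_mset (a, b) M) = T a b + tsum T M" "tsum T (M + N) = tsum T M + tsum T N"
  by (simp_all add: tsum_def)

text \<open>Universal property of the tensor product, by induction on the congruence. Cancellation
  in the target gives \<open>T 0 b = 0\<close>, as needed for the rule on zero.\<close>

lemma tensor_eq_imp_tsum_eq:
  assumes "tensor_eq A C M N" "plain_galg A" "plain_galg C"
    and T: "\<And>a a' b. a \<in> carr A \<Longrightarrow> a' \<in> carr A \<Longrightarrow> b \<in> carr C \<Longrightarrow> T (a + a') b = T a b + T a' b"
      "\<And>a b b'. a \<in> carr A \<Longrightarrow> b \<in> carr C \<Longrightarrow> b' \<in> carr C \<Longrightarrow> T a (b + b') = T a b + T a b'"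
      "\<And>a b c. a \<in> carr A \<Longrightarrow> b \<in> carr C \<Longrightarrow> T (scl A c a) b = T a (scl C c b)"
  shows "tsum T M = (tsum T N :: 'x::cancel_comm_monoid_add)"
proof -
  interpret A: plain_galg A by fact
  interpret C: plain_galg C by fact
  have zero: "T 0 b = 0" if "b \<in> carr C" for b
    using T(1)[of 0 0 b] that by simp
  show ?thesis using assms(1)
    by (induction rule: tensor_eq.induct) (auto simp: T zero)
qed

lemma tensor_eq_carr:
  assumes "tensor_eq A C M N" "plain_galg A" "plain_galg C"
  shows "set_mset M \<subseteq> carr A \<times> carr C \<and> set_mset N \<subseteq> carr A \<times> carr C"
proof -
  interpret A: plain_galg A by fact
  interpret C: plain_galg C by fact
  show ?thesis using assms(1) by (induction rule: tensor_eq.induct) auto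
qed

lemma tensor_eq_sum:
  assumes "finite J" "\<And>j. j \<in> J \<Longrightarrow> tensor_eq A C (F j) (G j)"
  shows "tensor_eq A C (sum F J) (sum G J)"
  using assms by (induction J rule: finite_induct) (auto intro: tensor_eq.refl tensor_eq.plus)

lemma tensor_eq_map:
  assumes "tensor_eq A C M N"
    and "\<And>b. b \<in> carr C \<Longrightarrow> g b \<in> carr C'"
    and "\<And>b b'. b \<in> carr C \<Longrightarrow> b' \<in> carr C \<Longrightarrow> g (add C b b') = add C' (g b) (g b')"
    and "\<And>b c. b \<in> carr C \<Longrightarrow> g (scl C c b) = scl C' c (g b)"
  shows "tensor_eq A C' (image_mset (map_prod id g) M) (image_mset (map_prod id g) N)"
  using assms(1)
proof (induction rule: tensor_eq.induct)
  case (refl M)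
  then show ?case using assms(2) by (intro tensor_eq.refl) auto
next
  case (trans M N P)
  then show ?case using tensor_eq.trans by blast
qed (auto simp: assms intro: tensor_eq.intros)

text \<open>\<open>X\<close> is a concrete copy of the graded tensor product, with
  \<open>T a b\<close> in the role of \<open>a \<otimes> b\<close>. The rule for products has the
  factor \<open>grd A a'\<close> next to the odd part of \<open>b\<close>, as in
  \<open>gtensor_mul\<close>. Computations with classes of multisets are confined to this
  locale.\<close>

locale tensor_model = A: plain_galg A + C: plain_galg C + X: plain_galg X
  for A :: "('a::ab_group_add, 'k::field) galg" and C :: "('b::ab_group_add, 'k) galg"
    and X :: "('x::ab_group_add, 'k) galg" +
  fixes T :: "'a \<Rightarrow> 'b \<Rightarrow> 'x"
  assumes T_carr [simp]: "a \<in> carr A \<Longrightarrow> b \<in> carr C \<Longrightarrow> T a b \<in> carr X"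
    and T_add_left: "a \<in> carr A \<Longrightarrow> a' \<in> carr A \<Longrightarrow> b \<in> carr C \<Longrightarrow> T (a + a') b = T a b + T a' b"
    and T_add_right: "a \<in> carr A \<Longrightarrow> b \<in> carr C \<Longrightarrow> b' \<in> carr C \<Longrightarrow> T a (b + b') = T a b + T a b'"
    and T_scl_left: "a \<in> carr A \<Longrightarrow> b \<in> carr C \<Longrightarrow> T (scl A c a) b = scl X c (T a b)"
    and T_scl_right: "a \<in> carr A \<Longrightarrow> b \<in> carr C \<Longrightarrow> T a (scl C c b) = scl X c (T a b)"
    and T_mul: "a \<in> carr A \<Longrightarrow> b \<in> carr C \<Longrightarrow> a' \<in> carr A \<Longrightarrow> b' \<in> carr C \<Longrightarrow>
      mul X (T a b) (T a' b') = T (mul A a a') (mul C (even_part C b) b') +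
        T (mul A a (grd A a')) (mul C (odd_part C b) b')"
    and T_adj: "a \<in> carr A \<Longrightarrow> b \<in> carr C \<Longrightarrow>
      adj X (T a b) = T (adj A a) (adj C (even_part C b)) + T (adj A (grd A a)) (adj C (odd_part C b))"
    and T_grd: "a \<in> carr A \<Longrightarrow> b \<in> carr C \<Longrightarrow> grd X (T a b) = T (grd A a) (grd C b)"
    and T_surj: "x \<in> carr X \<Longrightarrow> \<exists>M. set_mset M \<subseteq> carr A \<times> carr C \<and> tsum T M = x"
    and T_inj: "set_mset M \<subseteq> carr A \<times> carr C \<Longrightarrow> set_mset N \<subseteq> carr A \<times> carr C \<Longrightarrow>
      tsum T M = tsum T N \<Longrightarrow> tensor_eq A C M N"
begin

lemma T_zero_right [simp]: "a \<in> carr A \<Longrightarrow> T a 0 = 0"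
  using T_add_right[of a 0 0] by simp

lemma tsum_carr: "set_mset M \<subseteq> carr A \<times> carr C \<Longrightarrow> tsum T M \<in> carr X"
  by (induction M) auto

lemma tensor_eq_iff:
  "tensor_eq A C M N \<longleftrightarrow> set_mset M \<subseteq> carr A \<times> carr C \<and> set_mset N \<subseteq> carr A \<times> carr C \<and>
    tsum T M = tsum T N"
  using tensor_eq_carr[OF _ A.plain_galg_axioms C.plain_galg_axioms, of M N]
    tensor_eq_imp_tsum_eq[OF _ A.plain_galg_axioms C.plain_galg_axioms, of M N T] T_inj[of M N]
  by (auto simp: T_add_left T_add_right T_scl_left T_scl_right)

text \<open>The classes of the congruence are the fibres of \<open>tsum T\<close>.\<close>

definition cls :: "'x \<Rightarrow> ('a \<times> 'b) multiset set"
  where "cls x = {N. set_mset N \<subseteq> carr A \<times> carr C \<and> tsum T N = x}"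

lemma tensor_class_eq: "set_mset M \<subseteq> carr A \<times> carr C \<Longrightarrow> tensor_class A C M = cls (tsum T M)"
  by (auto simp: tensor_class_def cls_def tensor_eq_iff)

lemma tlift_cls:
  assumes "x \<in> carr X" "\<And>M. set_mset M \<subseteq> carr A \<times> carr C \<Longrightarrow> tsum T M = x \<Longrightarrow>
    set_mset (F M) \<subseteq> carr A \<times> carr C \<and> tsum T (F M) = y"
  shows "tlift A C F (cls x) = cls y"
proof -
  have "tlift A C F (cls x) = (\<Union>M\<in>cls x. cls y)"
    unfolding tlift_def using assms(2) by (intro SUP_cong) (auto simp: cls_def[of x] tensor_class_eq)
  \<comment> \<open>The union over an empty class would be empty; surjectivity of \<open>T\<close>
    excludes this.\<close>
  moreover have "cls x \<noteq> {}" using T_surj[OF assms(1)] by (auto simp: cls_def)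
  ultimately show ?thesis by simp
qed

lemma tlift2_cls:
  assumes "x \<in> carr X" "x' \<in> carr X" "\<And>M N. set_mset M \<subseteq> carr A \<times> carr C \<Longrightarrow> tsum T M = x \<Longrightarrow>
    set_mset N \<subseteq> carr A \<times> carr C \<Longrightarrow> tsum T N = x' \<Longrightarrow>
    set_mset (F M N) \<subseteq> carr A \<times> carr C \<and> tsum T (F M N) = y"
  shows "tlift2 A C F (cls x) (cls x') = cls y"
proof -
  have "tlift2 A C F (cls x) (cls x') = (\<Union>M\<in>cls x. \<Union>N\<in>cls x'. cls y)"
    unfolding tlift2_def using assms(3)
    by (intro SUP_cong) (auto simp: cls_def[of x] cls_def[of x'] tensor_class_eq)
  moreover have "cls x \<noteq> {}" "cls x' \<noteq> {}"
    using T_surj[OF assms(1)] T_surj[OF assms(2)] by (auto simp: cls_def)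
  ultimately show ?thesis by simp
qed

lemma gtensor_mul_tsum:
  assumes "set_mset M \<subseteq> carr A \<times> carr C" "set_mset N \<subseteq> carr A \<times> carr C"
  shows "set_mset (gtensor_mul A C M N) \<subseteq> carr A \<times> carr C \<and>
    tsum T (gtensor_mul A C M N) = mul X (tsum T M) (tsum T N)"
  using assms(1)
proof (induction M)
  case empty
  then show ?case by (simp add: gtensor_mul_def tsum_carr assms)
next
  case (add p M)
  obtain a b where p: "p = (a, b)" by fastforce
  have ab: "a \<in> carr A" "b \<in> carr C" using add.prems p by auto
  define R where "R N = (\<Sum>(a', b')\<in>#N. {#(mul A a a', mul C (even_part C b) b'),
        (mul A a (grd A a'), mul C (odd_part C b) b')#})" for N
  have "set_mset (R N) \<subseteq> carr A \<times> carr C \<and> tsum T (R N) = mul X (T a b) (tsum T N)"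
    using assms(2)
  proof (induction N)
    case empty
    then show ?case by (simp add: R_def ab)
  next
    case (add q N)
    obtain a' b' where q: "q = (a', b')" by fastforce
    have ab': "a' \<in> carr A" "b' \<in> carr C" "set_mset N \<subseteq> carr A \<times> carr C" using add.prems q by auto
    have "R (add_mset q N) = {#(mul A a a', mul C (even_part C b) b'),
        (mul A a (grd A a'), mul C (odd_part C b) b')#} + R N"
      by (simp add: R_def q)
    then show ?case using add ab ab' by (simp add: q X.mul_add_right tsum_carr T_mul add.assoc)
  qed
  moreover have "gtensor_mul A C (add_mset p M) N = R N + gtensor_mul A C M N"
    by (simp add: gtensor_mul_def p R_def)
  ultimately show ?case using add ab by (simp add: p X.mul_add_left tsum_carr assms)
qed

lemma gtensor_adj_tsum:
  assumes "set_mset M \<subseteq> carr A \<times> carr C"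
  shows "set_mset (gtensor_adj A C M) \<subseteq> carr A \<times> carr C \<and>
    tsum T (gtensor_adj A C M) = adj X (tsum T M)"
  using assms by (induction M) (auto simp: gtensor_adj_def X.adj_add tsum_carr T_adj add.assoc)

lemma map_tsum:
  assumes "set_mset M \<subseteq> carr A \<times> carr C"
    and "\<And>a. a \<in> carr A \<Longrightarrow> f a \<in> carr A" "\<And>b. b \<in> carr C \<Longrightarrow> g b \<in> carr C"
    and "\<And>x y. x \<in> carr X \<Longrightarrow> y \<in> carr X \<Longrightarrow> \<rho> (x + y) = \<rho> x + \<rho> y"
    and "\<And>a b. a \<in> carr A \<Longrightarrow> b \<in> carr C \<Longrightarrow> \<rho> (T a b) = T (f a) (g b)"
  shows "set_mset (image_mset (map_prod f g) M) \<subseteq> carr A \<times> carr C \<and>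
    tsum T (image_mset (map_prod f g) M) = \<rho> (tsum T M)"
proof -
  have "\<rho> 0 = 0" using assms(4)[of 0 0] by simp
  then show ?thesis using assms by (induction M) (auto simp: tsum_carr)
qed

lemma tmap_cls:
  assumes "x \<in> carr X" "\<And>a. a \<in> carr A \<Longrightarrow> f a \<in> carr A" "\<And>b. b \<in> carr C \<Longrightarrow> g b \<in> carr C"
    and "\<And>x y. x \<in> carr X \<Longrightarrow> y \<in> carr X \<Longrightarrow> \<rho> (x + y) = \<rho> x + \<rho> y"
    and "\<And>a b. a \<in> carr A \<Longrightarrow> b \<in> carr C \<Longrightarrow> \<rho> (T a b) = T (f a) (g b)"
  shows "tmap A C f g (cls x) = cls (\<rho> x)"
  unfolding tmap_def by (rule tlift_cls[OF assms(1)]) (use map_tsum[OF _ assms(2-5)] in blast)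

lemma gtensor_simps:
  "carr (A \<otimes>\<^sub>g C) = cls ` carr X"
  "x \<in> carr X \<Longrightarrow> y \<in> carr X \<Longrightarrow> add (A \<otimes>\<^sub>g C) (cls x) (cls y) = cls (x + y)"
  "x \<in> carr X \<Longrightarrow> scl (A \<otimes>\<^sub>g C) c (cls x) = cls (scl X c x)"
  "x \<in> carr X \<Longrightarrow> y \<in> carr X \<Longrightarrow> mul (A \<otimes>\<^sub>g C) (cls x) (cls y) = cls (mul X x y)"
  "x \<in> carr X \<Longrightarrow> adj (A \<otimes>\<^sub>g C) (cls x) = cls (adj X x)"
  "x \<in> carr X \<Longrightarrow> grd (A \<otimes>\<^sub>g C) (cls x) = cls (grd X x)"
proof -
  show "carr (A \<otimes>\<^sub>g C) = cls ` carr X"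
  proof -
    have "tensor_class A C ` {M. set_mset M \<subseteq> carr A \<times> carr C} =
        cls ` (tsum T ` {M. set_mset M \<subseteq> carr A \<times> carr C})"
      unfolding image_image by (intro image_cong) (auto simp: tensor_class_eq)
    moreover have "tsum T ` {M. set_mset M \<subseteq> carr A \<times> carr C} = carr X"
      using T_surj tsum_carr by fastforce
    ultimately show ?thesis by (simp add: gtensor_def)
  qed
  show "add (A \<otimes>\<^sub>g C) (cls x) (cls y) = cls (x + y)" if "x \<in> carr X" "y \<in> carr X"
    by (simp add: gtensor_def tlift2_cls that)
  show "scl (A \<otimes>\<^sub>g C) c (cls x) = cls (scl X c x)" if "x \<in> carr X"
    unfolding gtensor_def galg.simps
    by (rule tlift_cls[OF that]) (use map_tsum[of _ "scl A c" id "scl X c"] in \<open>simp add: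
        X.scl_add_right T_scl_left\<close>)
  show "mul (A \<otimes>\<^sub>g C) (cls x) (cls y) = cls (mul X x y)" if "x \<in> carr X" "y \<in> carr X"
    unfolding gtensor_def galg.simps by (rule tlift2_cls[OF that]) (use gtensor_mul_tsum in blast)
  show "adj (A \<otimes>\<^sub>g C) (cls x) = cls (adj X x)" if "x \<in> carr X"
    unfolding gtensor_def galg.simps by (rule tlift_cls[OF that]) (use gtensor_adj_tsum in blast)
  show "grd (A \<otimes>\<^sub>g C) (cls x) = cls (grd X x)" if "x \<in> carr X"
    unfolding gtensor_def galg.simps
    by (rule tmap_cls[OF that]) (simp_all add: X.grd_add T_grd)
qed

lemma cls_graded_iso: "graded_iso X (A \<otimes>\<^sub>g C) cls"
proof -
  have "inj_on cls (carr X)"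
  proof (rule inj_onI)
    fix x y assume *: "x \<in> carr X" "y \<in> carr X" "cls x = cls y"
    from T_surj[OF *(1)] obtain M where "set_mset M \<subseteq> carr A \<times> carr C" "tsum T M = x" by blast
    then have "M \<in> cls x" by (simp add: cls_def)
    then show "x = y" unfolding *(3) using \<open>tsum T M = x\<close> by (simp add: cls_def)
  qed
  then show ?thesis
    by (simp add: graded_iso_def star_iso_def bij_betw_def gtensor_simps)
qed

end

lemma tsum_image: "tsum T (image_mset (map_prod f g) M) = tsum (\<lambda>a b. T (f a) (g b)) M"
  by (induction M) auto

lemma even_part_iso:
  assumes "plain_galg C'" "graded_iso C' C \<kappa>" "b \<in> carr C'"
  shows "\<kappa> (even_part C' b) = even_part C (\<kappa> b)" "\<kappa> (odd_part C' b) = odd_part C (\<kappa> b)"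
proof -
  interpret plain_galg C' by fact
  have "add C' x y \<in> carr C'" if "x \<in> carr C'" "y \<in> carr C'" for x y using that by simp
  then show "\<kappa> (even_part C' b) = even_part C (\<kappa> b)" "\<kappa> (odd_part C' b) = odd_part C (\<kappa> b)"
    unfolding even_part_def odd_part_def
    using assms(2,3) by (simp_all add: graded_iso_def star_iso_def del: add_eq scl_minus_one)
qed

context tensor_model
begin

text \<open>Injectivity is obtained by mapping formal sums along \<open>\<kappa>\<close>, applying
  it in the old model, and returning along the inverse \<open>l\<close>. In this way matrix models
  become models of tensor products with Clifford algebras.\<close>

lemma pullback:
  assumes C': "plain_galg C'" and \<kappa>: "graded_iso C' C \<kappa>"
  shows "tensor_model A C' X (\<lambda>a b. T a (\<kappa> b))"
proof -
  interpret C': plain_galg C' by fact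
  have bij: "bij_betw \<kappa> (carr C') (carr C)" using \<kappa> by (simp add: graded_iso_def star_iso_def)
  have k: "\<kappa> b \<in> carr C" if "b \<in> carr C'" for b using bij that by (auto simp: bij_betw_def)
  have hom: "x \<in> carr C' \<Longrightarrow> y \<in> carr C' \<Longrightarrow> \<kappa> (x + y) = \<kappa> x + \<kappa> y"
      "x \<in> carr C' \<Longrightarrow> y \<in> carr C' \<Longrightarrow> \<kappa> (mul C' x y) = mul C (\<kappa> x) (\<kappa> y)"
      "x \<in> carr C' \<Longrightarrow> \<kappa> (scl C' c x) = scl C c (\<kappa> x)"
      "x \<in> carr C' \<Longrightarrow> \<kappa> (adj C' x) = adj C (\<kappa> x)"
      "x \<in> carr C' \<Longrightarrow> \<kappa> (grd C' x) = grd C (\<kappa> x)" for x y c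
    using \<kappa> by (simp_all add: graded_iso_def star_iso_def)
  define l where "l = inv_into (carr C') \<kappa>"
  have l: "l b \<in> carr C'" "\<kappa> (l b) = b" if "b \<in> carr C" for b
    using bij that by (auto simp: l_def bij_betw_def inv_into_into f_inv_into_f)
  have lk: "l (\<kappa> b) = b" if "b \<in> carr C'" for b
    using bij that by (simp add: l_def bij_betw_def)
  have l_add: "l (x + y) = l x + l y" if "x \<in> carr C" "y \<in> carr C" for x y
    using lk[of "l x + l y"] that by (simp add: hom l)
  have l_scl: "l (scl C c x) = scl C' c (l x)" if "x \<in> carr C" for x c
    using lk[of "scl C' c (l x)"] that by (simp add: hom l)
  show ?thesis
  proof
    show "\<exists>M. set_mset M \<subseteq> carr A \<times> carr C' \<and> tsum (\<lambda>a b. T a (\<kappa> b)) M = x" if x: "x \<in> carr X" for x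
    proof -
      obtain M where M: "set_mset M \<subseteq> carr A \<times> carr C" "tsum T M = x" using T_surj[OF x] by blast
      have "tsum (\<lambda>a b. T a (\<kappa> (l b))) M = tsum T M"
        using M(1) by (induction M) (auto simp: l)
      then show ?thesis using M l
        by (intro exI[of _ "image_mset (map_prod id l) M"]) (auto simp: tsum_image)
    qed
    show "tensor_eq A C' M N" if *: "set_mset M \<subseteq> carr A \<times> carr C'" "set_mset N \<subseteq> carr A \<times> carr C'"
      "tsum (\<lambda>a b. T a (\<kappa> b)) M = tsum (\<lambda>a b. T a (\<kappa> b)) N" for M N
    proof -
      let ?k = "image_mset (map_prod id \<kappa>)" and ?l = "image_mset (map_prod id l)"
      have lk': "?l (?k M) = M" if "set_mset M \<subseteq> carr A \<times> carr C'" for M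
        using that by (induction M) (auto simp: lk)
      have "tensor_eq A C (?k M) (?k N)"
        by (rule T_inj) (use * in \<open>auto simp: tsum_image k\<close>)
      then have "tensor_eq A C' (?l (?k M)) (?l (?k N))"
        by (rule tensor_eq_map) (auto simp: l l_add l_scl)
      then show ?thesis by (simp only: lk' *)
    qed
  qed (simp_all add: k hom even_part_iso[OF C' \<kappa>] T_add_left T_add_right T_scl_left T_scl_right
      T_mul T_adj T_grd)
qed

end

section \<open>Coordinates of a tensor with respect to a finite basis and its dual basis\<close>

definition fin_basis :: "('b::ab_group_add, 'k::field) galg \<Rightarrow> 'j set \<Rightarrow> ('j \<Rightarrow> 'b) \<Rightarrow> ('j \<Rightarrow> 'b \<Rightarrow> 'k) \<Rightarrow> bool"
  where "fin_basis C J e \<delta> \<longleftrightarrow> finite J \<and> (\<forall>j\<in>J. e j \<in> carr C) \<and>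
    (\<forall>j\<in>J. \<forall>b\<in>carr C. \<forall>b'\<in>carr C. \<delta> j (b + b') = \<delta> j b + \<delta> j b') \<and>
    (\<forall>j\<in>J. \<forall>b\<in>carr C. \<forall>c. \<delta> j (scl C c b) = c * \<delta> j b) \<and>
    (\<forall>i\<in>J. \<forall>j\<in>J. \<delta> j (e i) = (if i = j then 1 else 0)) \<and>
    (\<forall>b\<in>carr C. b = (\<Sum>j\<in>J. scl C (\<delta> j b) (e j)))"

locale tensor_coords = A: plain_galg A + C: plain_galg C
  for A :: "('a::ab_group_add, 'k::field) galg" and C :: "('b::ab_group_add, 'k) galg" +
  fixes J :: "'j set" and e :: "'j \<Rightarrow> 'b" and \<delta> :: "'j \<Rightarrow> 'b \<Rightarrow> 'k"
  assumes basis: "fin_basis C J e \<delta>"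
begin

lemma basis_facts:
  "finite J" "j \<in> J \<Longrightarrow> e j \<in> carr C"
  "j \<in> J \<Longrightarrow> b \<in> carr C \<Longrightarrow> b' \<in> carr C \<Longrightarrow> \<delta> j (b + b') = \<delta> j b + \<delta> j b'"
  "j \<in> J \<Longrightarrow> b \<in> carr C \<Longrightarrow> \<delta> j (scl C c b) = c * \<delta> j b"
  "i \<in> J \<Longrightarrow> j \<in> J \<Longrightarrow> \<delta> j (e i) = (if i = j then 1 else 0)"
  "b \<in> carr C \<Longrightarrow> b = (\<Sum>j\<in>J. scl C (\<delta> j b) (e j))"
  using basis unfolding fin_basis_def by auto

text \<open>The slice map: the identity on \<open>A\<close> tensor the functional
  \<open>\<delta> j\<close>.\<close>

definition co :: "'j \<Rightarrow> ('a \<times> 'b) multiset \<Rightarrow> 'a"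
  where "co j M = tsum (\<lambda>a b. scl A (\<delta> j b) a) M"

lemma co_carr: "set_mset M \<subseteq> carr A \<times> carr C \<Longrightarrow> co j M \<in> carr A"
  by (induction M) (auto simp: co_def)

lemma co_cong:
  assumes "tensor_eq A C M N" "j \<in> J" shows "co j M = co j N"
  unfolding co_def
  by (rule tensor_eq_imp_tsum_eq[OF assms(1) A.plain_galg_axioms C.plain_galg_axioms])
    (auto simp: basis_facts assms A.scl_add_right A.scl_add_left A.scl_scl mult.commute)

text \<open>The congruence discards pairs whose first entry is zero; the scalar \<open>0\<close>
  carries a zero from the second entry to the first.\<close>

lemma tensor_eq_nul_right:
  assumes "a \<in> carr A" shows "tensor_eq A C {#(a, 0)#} {#}"
proof -
  have "tensor_eq A C {#(a, scl C 0 0)#} {#(scl A 0 a, 0)#}"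
    using assms by (intro tensor_eq.sym[OF tensor_eq.scl]) auto
  moreover have "tensor_eq A C {#(nul A, 0)#} {#}" by (rule tensor_eq.nul) simp
  ultimately show ?thesis using assms by (auto intro: tensor_eq.trans)
qed

lemma tensor_eq_sum_right:
  assumes "finite I" "a \<in> carr A" "\<And>i. i \<in> I \<Longrightarrow> v i \<in> carr C"
  shows "tensor_eq A C {#(a, sum v I)#} (\<Sum>i\<in>I. {#(a, v i)#})"
  using assms(1,3)
proof (induction I rule: finite_induct)
  case empty
  then show ?case using tensor_eq_nul_right assms(2) by simp
next
  case (insert i I)
  have "tensor_eq A C {#(a, add C (v i) (sum v I))#} ({#(a, v i)#} + {#(a, sum v I)#})"
    using tensor_eq.add_right[of a A "v i" C "sum v I"] insert assms(2) C.carr_sum[of I v]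
    by (simp add: add_mset_commute)
  moreover have "tensor_eq A C ({#(a, v i)#} + {#(a, sum v I)#}) ({#(a, v i)#} + (\<Sum>i\<in>I. {#(a, v i)#}))"
    using insert assms(2) by (intro tensor_eq.plus tensor_eq.refl) auto
  ultimately show ?case using insert(1,2) by (auto intro: tensor_eq.trans)
qed

text \<open>Each second entry is expanded in the basis, scalars move to the left, and terms with the
  same basis vector are collected.\<close>

lemma normal_form:
  assumes "set_mset M \<subseteq> carr A \<times> carr C"
  shows "tensor_eq A C M (\<Sum>j\<in>J. {#(co j M, e j)#})"
  using assms
proof (induction M)
  case empty
  have "tensor_eq A C (\<Sum>j\<in>J. {#(nul A, e j)#}) (\<Sum>j\<in>J. {#})"
    by (intro tensor_eq_sum tensor_eq.nul basis_facts)
  then show ?case by (simp add: co_def tensor_eq.sym)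
next
  case (add p M)
  obtain a b where p: "p = (a, b)" by fastforce
  have ab: "a \<in> carr A" "b \<in> carr C" "set_mset M \<subseteq> carr A \<times> carr C" using add.prems p by auto
  have "tensor_eq A C {#(a, \<Sum>j\<in>J. scl C (\<delta> j b) (e j))#} (\<Sum>j\<in>J. {#(a, scl C (\<delta> j b) (e j))#})"
    using ab by (intro tensor_eq_sum_right basis_facts C.carr_scl)
  then have "tensor_eq A C {#(a, b)#} (\<Sum>j\<in>J. {#(a, scl C (\<delta> j b) (e j))#})"
    using basis_facts(6)[OF ab(2)] by simp
  moreover have "tensor_eq A C (\<Sum>j\<in>J. {#(a, scl C (\<delta> j b) (e j))#}) (\<Sum>j\<in>J. {#(scl A (\<delta> j b) a, e j)#})"
    using ab by (intro tensor_eq_sum basis_facts tensor_eq.sym[OF tensor_eq.scl])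
  ultimately have "tensor_eq A C {#(a, b)#} (\<Sum>j\<in>J. {#(scl A (\<delta> j b) a, e j)#})"
    by (rule tensor_eq.trans)
  then have 1: "tensor_eq A C ({#(a, b)#} + M)
      ((\<Sum>j\<in>J. {#(scl A (\<delta> j b) a, e j)#}) + (\<Sum>j\<in>J. {#(co j M, e j)#}))"
    using add.IH[OF ab(3)] by (rule tensor_eq.plus)
  have "tensor_eq A C (\<Sum>j\<in>J. {#(add A (scl A (\<delta> j b) a) (co j M), e j)#})
      (\<Sum>j\<in>J. {#(scl A (\<delta> j b) a, e j), (co j M, e j)#})"
    using ab co_carr by (intro tensor_eq_sum basis_facts tensor_eq.add_left) auto
  moreover have "(\<Sum>j\<in>J. {#(scl A (\<delta> j b) a, e j), (co j M, e j)#}) =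
      (\<Sum>j\<in>J. {#(scl A (\<delta> j b) a, e j)#}) + (\<Sum>j\<in>J. {#(co j M, e j)#})"
  proof -
    have "{#p, q#} = {#p#} + {#q#}" for p q :: "'a \<times> 'b" by (simp add: add_mset_commute)
    then show ?thesis by (simp only: sum.distrib)
  qed
  ultimately show ?case using tensor_eq.trans[OF 1 tensor_eq.sym]
    by (simp add: p co_def)
qed

lemma tensor_eq_coI:
  assumes "set_mset M \<subseteq> carr A \<times> carr C" "set_mset N \<subseteq> carr A \<times> carr C"
    "\<And>j. j \<in> J \<Longrightarrow> co j M = co j N"
  shows "tensor_eq A C M N"
proof -
  have "(\<Sum>j\<in>J. {#(co j M, e j)#}) = (\<Sum>j\<in>J. {#(co j N, e j)#})"
    by (rule sum.cong) (simp_all add: assms(3))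
  then show ?thesis
    using normal_form[OF assms(1)] tensor_eq.sym[OF normal_form[OF assms(2)]]
    by (auto intro: tensor_eq.trans)
qed

lemma tsum_single_sum:
  "finite I \<Longrightarrow> tsum T (\<Sum>j\<in>I. {#(a j, v j)#}) = (\<Sum>j\<in>I. T (a j) (v j))"
  by (induction I rule: finite_induct) simp_all

text \<open>The maps \<open>p j\<close> recover from the value in \<open>X\<close> the coordinates
  of a formal sum, and these determine its normal form.\<close>

lemma coords_T_inj:
  fixes T :: "'a \<Rightarrow> 'b \<Rightarrow> 'x::ab_group_add"
  assumes X: "plain_galg X"
    and T: "\<And>a b. a \<in> carr A \<Longrightarrow> b \<in> carr C \<Longrightarrow> T a b \<in> carr X"
    and add: "\<And>j x y. j \<in> J \<Longrightarrow> x \<in> carr X \<Longrightarrow> y \<in> carr X \<Longrightarrow> p j (x + y) = p j x + p j y"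
    and p: "\<And>j a b. j \<in> J \<Longrightarrow> a \<in> carr A \<Longrightarrow> b \<in> carr C \<Longrightarrow> p j (T a b) = scl A (\<delta> j b) a"
    and M: "set_mset M \<subseteq> carr A \<times> carr C" "set_mset N \<subseteq> carr A \<times> carr C" "tsum T M = tsum T N"
  shows "tensor_eq A C M N"
proof (rule tensor_eq_coI[OF M(1,2)])
  interpret X: plain_galg X by fact
  fix j assume j: "j \<in> J"
  have "p j 0 = 0" using add[OF j, of 0 0] by simp
  then have "tsum T M \<in> carr X \<and> p j (tsum T M) = co j M" if "set_mset M \<subseteq> carr A \<times> carr C" for M
    using that by (induction M) (auto simp: co_def add p j T)
  then show "co j M = co j N" using M by metis
qed

lemma coords_T_surj:
  assumes "\<And>j. j \<in> J \<Longrightarrow> p j x \<in> carr A" "x = (\<Sum>j\<in>J. T (p j x) (e j))"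
  shows "\<exists>M. set_mset M \<subseteq> carr A \<times> carr C \<and> tsum T M = x"
proof (intro exI conjI)
  show "tsum T (\<Sum>j\<in>J. {#(p j x, e j)#}) = x"
    using assms(2) by (simp add: tsum_single_sum basis_facts(1))
  have "set_mset (\<Sum>j\<in>I. {#(p j x, e j)#}) \<subseteq> carr A \<times> carr C" if "I \<subseteq> J" for I
    using finite_subset[OF that basis_facts(1)] that assms(1) basis_facts(2)
    by (induction I rule: finite_induct) auto
  then show "set_mset (\<Sum>j\<in>J. {#(p j x, e j)#}) \<subseteq> carr A \<times> carr C" by blast
qed

end

text \<open>A converse to \<open>coords_T_inj\<close>: the coordinates of any representing formal
  sum will do, since by \<open>T_inj\<close> they do not depend on the choice.\<close>

lemma (in tensor_model) coordinates:
  assumes "fin_basis C J e \<delta>"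
  shows "\<exists>p. (\<forall>j\<in>J. \<forall>x\<in>carr X. p j x \<in> carr A) \<and>
    (\<forall>j\<in>J. \<forall>x\<in>carr X. \<forall>y\<in>carr X. p j (x + y) = p j x + p j y) \<and>
    (\<forall>j\<in>J. \<forall>a\<in>carr A. \<forall>b\<in>carr C. p j (T a b) = scl A (\<delta> j b) a) \<and>
    (\<forall>x\<in>carr X. x = (\<Sum>j\<in>J. T (p j x) (e j)))"
proof -
  interpret tensor_coords A C J e \<delta>
    by (intro tensor_coords.intro tensor_coords_axioms.intro assms A.plain_galg_axioms C.plain_galg_axioms)
  define rep where "rep x = (SOME M. set_mset M \<subseteq> carr A \<times> carr C \<and> tsum T M = x)" for x
  have rep: "set_mset (rep x) \<subseteq> carr A \<times> carr C" "tsum T (rep x) = x" if "x \<in> carr X" for x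
    using someI_ex[OF T_surj[OF that]] unfolding rep_def by auto
  have co: "co j (rep x) = co j M" if "j \<in> J" "x \<in> carr X" "set_mset M \<subseteq> carr A \<times> carr C" "tsum T M
      = x" for j x M
    by (rule co_cong[OF T_inj]) (simp_all add: that rep)
  show ?thesis
  proof (intro exI[of _ "\<lambda>j x. co j (rep x)"] conjI ballI)
    show "co j (rep x) \<in> carr A" if "j \<in> J" "x \<in> carr X" for j x
      using that rep co_carr by blast
    show "co j (rep (x + y)) = co j (rep x) + co j (rep y)" if "j \<in> J" "x \<in> carr X" "y \<in> carr X" for j x y
    proof -
      have "co j (rep (x + y)) = co j (rep x + rep y)"
        by (rule co) (use that rep in auto)
      then show ?thesis by (simp add: co_def)
    qed
    show "co j (rep (T a b)) = scl A (\<delta> j b) a" if "j \<in> J" "a \<in> carr A" "b \<in> carr C" for j a b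
    proof -
      have "co j (rep (T a b)) = co j {#(a, b)#}"
        by (rule co) (use that in auto)
      then show ?thesis by (simp add: co_def)
    qed
    show "x = (\<Sum>j\<in>J. T (co j (rep x)) (e j))" if "x \<in> carr X" for x
    proof -
      have "tsum T (rep x) = tsum T (\<Sum>j\<in>J. {#(co j (rep x), e j)#})"
        using normal_form[OF rep(1)[OF that]] tensor_eq_iff by blast
      then show ?thesis by (simp add: rep that tsum_single_sum basis_facts(1))
    qed
  qed
qed

section \<open>Isomorphisms of graded algebras that intertwine real structures\<close>

definition real_iso :: "('b, complex) galg \<Rightarrow> ('b \<Rightarrow> 'b) \<Rightarrow> ('c, complex) galg \<Rightarrow> ('c \<Rightarrow> 'c) \<Rightarrow> ('b \<Rightarrow> 'c) \<Rightarrow> bool"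
  where "real_iso B r C s \<phi> \<longleftrightarrow> graded_iso B C \<phi> \<and> (\<forall>x\<in>carr B. r x \<in> carr B \<and> \<phi> (r x) = s (\<phi> x))"

lemma graded_isoD:
  assumes "graded_iso B C \<phi>"
  shows "bij_betw \<phi> (carr B) (carr C)" "x \<in> carr B \<Longrightarrow> \<phi> x \<in> carr C"
    "x \<in> carr B \<Longrightarrow> y \<in> carr B \<Longrightarrow> \<phi> (add B x y) = add C (\<phi> x) (\<phi> y)"
    "x \<in> carr B \<Longrightarrow> \<phi> (scl B c x) = scl C c (\<phi> x)"
    "x \<in> carr B \<Longrightarrow> y \<in> carr B \<Longrightarrow> \<phi> (mul B x y) = mul C (\<phi> x) (\<phi> y)"
    "x \<in> carr B \<Longrightarrow> \<phi> (adj B x) = adj C (\<phi> x)" "x \<in> carr B \<Longrightarrow> \<phi> (grd B x) = grd C (\<phi> x)"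
  using assms by (auto simp: graded_iso_def star_iso_def bij_betw_def)

lemma graded_iso_trans:
  assumes "graded_iso B C \<phi>" "graded_iso C D \<psi>" shows "graded_iso B D (\<psi> \<circ> \<phi>)"
  unfolding graded_iso_def star_iso_def
  using bij_betw_trans[OF graded_isoD(1)[OF assms(1)] graded_isoD(1)[OF assms(2)]]
  by (simp add: graded_isoD[OF assms(1)] graded_isoD[OF assms(2)])

lemma real_iso_trans:
  "real_iso B r C s \<phi> \<Longrightarrow> real_iso C s D t \<psi> \<Longrightarrow> real_iso B r D t (\<psi> \<circ> \<phi>)"
  unfolding real_iso_def using graded_iso_trans graded_isoD(2) by (metis comp_apply)

lemma graded_iso_inv:
  assumes "plain_galg B" "graded_iso B C \<phi>" shows "graded_iso C B (inv_into (carr B) \<phi>)"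
proof -
  interpret plain_galg B by fact
  note h = graded_isoD[OF assms(2)]
  let ?i = "inv_into (carr B) \<phi>"
  have i: "?i y \<in> carr B" "\<phi> (?i y) = y" if "y \<in> carr C" for y
    using h(1) that by (auto simp: bij_betw_def inv_into_into f_inv_into_f)
  have i': "?i (\<phi> x) = x" if "x \<in> carr B" for x
    using h(1) that by (simp add: bij_betw_def)
  have "add C y z = \<phi> (add B (?i y) (?i z))" "mul C y z = \<phi> (mul B (?i y) (?i z))"
    if "y \<in> carr C" "z \<in> carr C" for y z
    using that by (simp_all only: h i)
  moreover have "scl C c y = \<phi> (scl B c (?i y))" "adj C y = \<phi> (adj B (?i y))" "grd C y = \<phi> (grd B (?i y))"
    if "y \<in> carr C" for y c
    using that by (simp_all only: h i)
  ultimately show ?thesis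
    unfolding graded_iso_def star_iso_def using bij_betw_inv_into[OF h(1)] by (simp add: i i')
qed

lemma real_iso_inv:
  assumes "plain_galg B" "real_iso B r C s \<phi>" shows "real_iso C s B r (inv_into (carr B) \<phi>)"
proof -
  have g: "graded_iso B C \<phi>" using assms(2) by (simp add: real_iso_def)
  note h = graded_isoD[OF g]
  have "s y \<in> carr C \<and> inv_into (carr B) \<phi> (s y) = r (inv_into (carr B) \<phi> y)" if y: "y \<in> carr C" for y
  proof -
    obtain x where x: "x \<in> carr B" "y = \<phi> x" using h(1) y by (auto simp: bij_betw_def)
    then have "s y = \<phi> (r x)" "r x \<in> carr B" using assms(2) by (auto simp: real_iso_def)
    then show ?thesis using x h(1,2) by (simp add: bij_betw_def)
  qed
  then show ?thesis using graded_iso_inv[OF assms(1) g] by (simp add: real_iso_def)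
qed

lemma real_iso_fixed:
  assumes "real_iso B r C s \<phi>" shows "graded_iso (fixed_alg B r) (fixed_alg C s) \<phi>"
proof -
  have g: "graded_iso B C \<phi>" and r: "\<And>x. x \<in> carr B \<Longrightarrow> r x \<in> carr B \<and> \<phi> (r x) = s (\<phi> x)"
    using assms by (auto simp: real_iso_def)
  note h = graded_isoD[OF g]
  have "bij_betw \<phi> {x \<in> carr B. r x = x} {y \<in> carr C. s y = y}"
    unfolding bij_betw_def
  proof
    show "inj_on \<phi> {x \<in> carr B. r x = x}"
      using h(1) by (auto simp: bij_betw_def inj_on_def)
    have "y \<in> \<phi> ` {x \<in> carr B. r x = x}" if y: "y \<in> carr C" "s y = y" for y
    proof -
      obtain x where x: "x \<in> carr B" "y = \<phi> x" using h(1) y by (auto simp: bij_betw_def)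
      then have "\<phi> (r x) = \<phi> x" using r y by simp
      then have "r x = x" using r x h(1) by (auto simp: bij_betw_def inj_on_def)
      then show ?thesis using x by blast
    qed
    moreover have "\<phi> x \<in> carr C" "s (\<phi> x) = \<phi> x" if "x \<in> carr B" "r x = x" for x
      using r[OF that(1)] h(2) that by simp_all
    ultimately show "\<phi> ` {x \<in> carr B. r x = x} = {y \<in> carr C. s y = y}" by blast
  qed
  then show ?thesis
    by (simp add: graded_iso_def star_iso_def fixed_alg_def h)
qed

lemma (in tensor_model) cls_real_iso:
  assumes "\<And>x. x \<in> carr X \<Longrightarrow> \<rho> x \<in> carr X"
    and "\<And>a. a \<in> carr A \<Longrightarrow> f a \<in> carr A" "\<And>b. b \<in> carr C \<Longrightarrow> g b \<in> carr C"
    and "\<And>x y. x \<in> carr X \<Longrightarrow> y \<in> carr X \<Longrightarrow> \<rho> (x + y) = \<rho> x + \<rho> y"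
    and "\<And>a b. a \<in> carr A \<Longrightarrow> b \<in> carr C \<Longrightarrow> \<rho> (T a b) = T (f a) (g b)"
  shows "graded_iso X (A \<otimes>\<^sub>g C) cls \<and> (\<forall>x\<in>carr X. \<rho> x \<in> carr X \<and> cls (\<rho> x) = tmap A C f g (cls x))"
  using cls_graded_iso assms(1) tmap_cls[OF _ assms(2-5)] by simp

section \<open>Real fixed point algebras of tensor products\<close>

lemma plain_galg_fixed:
  assumes "plain_galg B" and f: "real_structure B f" shows "plain_galg (fixed_alg B f)"
proof -
  interpret plain_galg B by fact
  have h: "x \<in> carr B \<Longrightarrow> y \<in> carr B \<Longrightarrow> f (x + y) = f x + f y"
    "x \<in> carr B \<Longrightarrow> f (scl B c x) = scl B (cnj c) (f x)"
    "x \<in> carr B \<Longrightarrow> y \<in> carr B \<Longrightarrow> f (mul B x y) = mul B (f x) (f y)"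
    "x \<in> carr B \<Longrightarrow> f (adj B x) = adj B (f x)" "x \<in> carr B \<Longrightarrow> f (grd B x) = grd B (f x)" for x y c
    using f by (simp_all add: real_structure_def)
  have "f 0 = 0" using h(1)[of 0 0] by simp
  then show ?thesis
    by unfold_locales (simp_all add: fixed_alg_def h scl_add_right scl_add_left scl_scl mul_add_left
      mul_add_right mul_scl_left mul_scl_right adj_add grd_add grd_scl grd_adj)
qed

text \<open>Bijectivity onto the fixed points is left to \<open>real_form_model\<close>, where a
  real basis of \<open>D\<close> is carried to a complex basis of \<open>C\<close>.\<close>

definition real_form ::
    "('d, real) galg \<Rightarrow> ('b, complex) galg \<Rightarrow> ('b \<Rightarrow> 'b) \<Rightarrow> ('d \<Rightarrow> 'b) \<Rightarrow> bool"
  where "real_form D C r' \<kappa> \<longleftrightarrow>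
    (\<forall>x\<in>carr D. \<kappa> x \<in> carr C \<and> r' (\<kappa> x) = \<kappa> x) \<and>
    (\<forall>x\<in>carr D. \<forall>y\<in>carr D. \<kappa> (add D x y) = add C (\<kappa> x) (\<kappa> y)) \<and>
    (\<forall>t. \<forall>x\<in>carr D. \<kappa> (scl D t x) = scl C (complex_of_real t) (\<kappa> x)) \<and>
    (\<forall>x\<in>carr D. \<forall>y\<in>carr D. \<kappa> (mul D x y) = mul C (\<kappa> x) (\<kappa> y)) \<and>
    (\<forall>x\<in>carr D. \<kappa> (adj D x) = adj C (\<kappa> x)) \<and>
    (\<forall>x\<in>carr D. \<kappa> (grd D x) = grd C (\<kappa> x))"

text \<open>In coordinates for a basis fixed by \<open>g\<close>, the real structure
  \<open>\<rho>\<close> is \<open>f\<close> applied to each coordinate. A tensor is therefore fixed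
  exactly when its coordinates lie in the fixed points of \<open>f\<close>.\<close>

lemma real_form_model:
  assumes "tensor_model A C X T" and f: "real_structure A f" and \<rho>: "real_structure X \<rho>" and g:
      "real_structure C g"
    and \<rho>T: "\<And>a b. a \<in> carr A \<Longrightarrow> b \<in> carr C \<Longrightarrow> \<rho> (T a b) = T (f a) (g b)"
    and D: "plain_galg D" and \<kappa>: "real_form D C g \<kappa>"
    and bD: "fin_basis D J d \<delta>'" and bC: "fin_basis C J (\<lambda>j. \<kappa> (d j)) \<delta>"
    and \<delta>: "\<And>j x. j \<in> J \<Longrightarrow> x \<in> carr D \<Longrightarrow> \<delta> j (\<kappa> x) = complex_of_real (\<delta>' j x)"
  shows "tensor_model (fixed_alg A f) D (fixed_alg X \<rho>) (\<lambda>a x. T a (\<kappa> x))"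
proof -
  interpret tensor_model A C X T by fact
  interpret D: plain_galg D by fact
  interpret Af: plain_galg "fixed_alg A f" by (rule plain_galg_fixed[OF A.plain_galg_axioms f])
  interpret X\<rho>: plain_galg "fixed_alg X \<rho>" by (rule plain_galg_fixed[OF X.plain_galg_axioms \<rho>])
  interpret R: tensor_coords "fixed_alg A f" D J d \<delta>' by unfold_locales fact
  interpret K: tensor_coords A C J "\<lambda>j. \<kappa> (d j)" \<delta> by unfold_locales fact
  have k: "x \<in> carr D \<Longrightarrow> \<kappa> x \<in> carr C" "x \<in> carr D \<Longrightarrow> g (\<kappa> x) = \<kappa> x"
      "x \<in> carr D \<Longrightarrow> y \<in> carr D \<Longrightarrow> \<kappa> (x + y) = \<kappa> x + \<kappa> y"
      "x \<in> carr D \<Longrightarrow> \<kappa> (scl D t x) = scl C (complex_of_real t) (\<kappa> x)"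
      "x \<in> carr D \<Longrightarrow> y \<in> carr D \<Longrightarrow> \<kappa> (mul D x y) = mul C (\<kappa> x) (\<kappa> y)"
      "x \<in> carr D \<Longrightarrow> \<kappa> (adj D x) = adj C (\<kappa> x)" "x \<in> carr D \<Longrightarrow> \<kappa> (grd D x) = grd C (\<kappa> x)" for x y t
    using \<kappa> by (simp_all add: real_form_def)
  have parts: "\<kappa> (even_part D x) = even_part C (\<kappa> x)" "\<kappa> (odd_part D x) = odd_part C (\<kappa> x)"
    if "x \<in> carr D" for x
    using that k(4)[of _ "1/2"] k(4)[of _ "-1"] unfolding even_part_def odd_part_def
    by (simp_all add: k del: D.scl_minus_one C.scl_minus_one)
  have ff: "a \<in> carr A \<Longrightarrow> a' \<in> carr A \<Longrightarrow> f (a + a') = f a + f a'"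
      "a \<in> carr A \<Longrightarrow> f (scl A c a) = scl A (cnj c) (f a)" "a \<in> carr A \<Longrightarrow> f a \<in> carr A" for a a' c
    using f by (auto simp: real_structure_def bij_betw_def)
  have rr: "x \<in> carr X \<Longrightarrow> y \<in> carr X \<Longrightarrow> \<rho> (x + y) = \<rho> x + \<rho> y" "x \<in> carr X \<Longrightarrow> \<rho> x \<in> carr X" for x y
    using \<rho> by (auto simp: real_structure_def bij_betw_def)
  have gg: "b \<in> carr C \<Longrightarrow> b' \<in> carr C \<Longrightarrow> g (b + b') = g b + g b'"
      "b \<in> carr C \<Longrightarrow> g (scl C c b) = scl C (cnj c) (g b)" "b \<in> carr C \<Longrightarrow> g b \<in> carr C" for b b' c
    using g by (auto simp: real_structure_def bij_betw_def)
  have g0: "g 0 = 0" using gg(1)[of 0 0] by simp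
  have g_sum: "g (sum v I) = (\<Sum>i\<in>I. g (v i))" if "finite I" "\<And>i. i \<in> I \<Longrightarrow> v i \<in> carr C" for v and I
      :: "'e set"
    using that by (induction I rule: finite_induct) (auto simp: g0 gg C.carr_sum)
  have \<delta>_sum: "\<delta> j (sum v I) = (\<Sum>i\<in>I. \<delta> j (v i))"
    if "finite I" "j \<in> J" "\<And>i. i \<in> I \<Longrightarrow> v i \<in> carr C" for v j and I :: "'e set"
  proof -
    have z: "\<delta> j 0 = 0" using K.basis_facts(3)[OF that(2), of 0 0] by simp
    show ?thesis using that(1,3)
      by (induction I rule: finite_induct) (auto simp: z K.basis_facts(3) that(2) C.carr_sum)
  qed
  have dJ: "d j \<in> carr D" if "j \<in> J" for j using R.basis_facts(2) that by blast
  \<comment> \<open>The basis vectors are fixed by \<open>g\<close>, so \<open>g\<close> conjugates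
    the coordinates.\<close>
  have \<delta>g: "\<delta> j (g b) = cnj (\<delta> j b)" if j: "j \<in> J" and b: "b \<in> carr C" for j b
  proof -
    have "g b = g (\<Sum>i\<in>J. scl C (\<delta> i b) (\<kappa> (d i)))" using K.basis_facts(6)[OF b] by simp
    also have "\<dots> = (\<Sum>i\<in>J. scl C (cnj (\<delta> i b)) (\<kappa> (d i)))"
      using dJ by (subst g_sum) (auto simp: K.basis_facts(1) k gg intro!: sum.cong)
    finally have "\<delta> j (g b) = (\<Sum>i\<in>J. \<delta> j (scl C (cnj (\<delta> i b)) (\<kappa> (d i))))"
      using dJ j by (simp add: \<delta>_sum K.basis_facts(1) k)
    also have "\<dots> = (\<Sum>i\<in>J. if i = j then cnj (\<delta> i b) else 0)"
      using dJ j by (intro sum.cong) (auto simp: K.basis_facts(4,5) k)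
    finally show ?thesis using j K.basis_facts(1) by simp
  qed
  from coordinates[OF bC] obtain p where p':
    "(\<forall>j\<in>J. \<forall>x\<in>carr X. p j x \<in> carr A) \<and>
     (\<forall>j\<in>J. \<forall>x\<in>carr X. \<forall>y\<in>carr X. p j (x + y) = p j x + p j y) \<and>
     (\<forall>j\<in>J. \<forall>a\<in>carr A. \<forall>b\<in>carr C. p j (T a b) = scl A (\<delta> j b) a) \<and>
     (\<forall>x\<in>carr X. x = (\<Sum>j\<in>J. T (p j x) (\<kappa> (d j))))" by (elim exE)
  then have p: "\<And>j x. j \<in> J \<Longrightarrow> x \<in> carr X \<Longrightarrow> p j x \<in> carr A"
    "\<And>j x y. j \<in> J \<Longrightarrow> x \<in> carr X \<Longrightarrow> y \<in> carr X \<Longrightarrow> p j (x + y) = p j x + p j y"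
    "\<And>j a b. j \<in> J \<Longrightarrow> a \<in> carr A \<Longrightarrow> b \<in> carr C \<Longrightarrow> p j (T a b) = scl A (\<delta> j b) a"
    "\<And>x. x \<in> carr X \<Longrightarrow> x = (\<Sum>j\<in>J. T (p j x) (\<kappa> (d j)))" by blast+
  have p\<rho>: "p j (\<rho> x) = f (p j x)" if j: "j \<in> J" and x: "x \<in> carr X" for j x
  proof -
    obtain M where M: "set_mset M \<subseteq> carr A \<times> carr C" "tsum T M = x" using T_surj[OF x] by blast
    have z: "\<rho> 0 = 0" "f 0 = 0" "p j 0 = 0" using rr(1)[of 0 0] ff(1)[of 0 0] p(2)[OF j, of 0 0] by simp_all
    have "p j (\<rho> (tsum T M)) = f (p j (tsum T M))"
      using M(1)
    proof (induction M)
      case (add q M)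
      then show ?case
        by (cases q) (simp add: rr ff p(1-3) j tsum_carr \<rho>T \<delta>g gg)
    qed (simp add: z)
    then show ?thesis by (simp add: M)
  qed
  have car: "a \<in> carr (fixed_alg A f) \<longleftrightarrow> a \<in> carr A \<and> f a = a"
      "x \<in> carr (fixed_alg X \<rho>) \<longleftrightarrow> x \<in> carr X \<and> \<rho> x = x" for a x
    by (simp_all add: fixed_alg_def)
  have Tc: "T a (\<kappa> x) \<in> carr (fixed_alg X \<rho>)" if "a \<in> carr (fixed_alg A f)" "x \<in> carr D" for a x
    using that by (simp add: car k \<rho>T)
  have pf: "f (p j x) = p j x" if "j \<in> J" "x \<in> carr X" "\<rho> x = x" for j x
    using p\<rho>[OF that(1,2)] that(3) by simp
  show ?thesis
  proof
    show "\<exists>M. set_mset M \<subseteq> carr (fixed_alg A f) \<times> carr D \<and> tsum (\<lambda>a x. T a (\<kappa> x)) M = x"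
      if "x \<in> carr (fixed_alg X \<rho>)" for x
      by (rule R.coords_T_surj[of p]) (use that p(1) pf p(4)[of x] in \<open>auto simp: car\<close>)
    show "tensor_eq (fixed_alg A f) D M N"
      if "set_mset M \<subseteq> carr (fixed_alg A f) \<times> carr D" "set_mset N \<subseteq> carr (fixed_alg A f) \<times> carr D"
        "tsum (\<lambda>a x. T a (\<kappa> x)) M = tsum (\<lambda>a x. T a (\<kappa> x)) N" for M N
      by (rule R.coords_T_inj[OF X\<rho>.plain_galg_axioms Tc _ _ that, of p])
        (auto simp: car p k \<delta> fixed_alg_def)
    show "T a (\<kappa> x) \<in> carr (fixed_alg X \<rho>)" if "a \<in> carr (fixed_alg A f)" "x \<in> carr D" for a x
      by (rule Tc[OF that])
  qed (simp_all add: fixed_alg_def k parts T_add_left T_add_right T_scl_left T_scl_right T_mul T_adj T_grd)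
qed

section \<open>Adjoining one Clifford generator\<close>

text \<open>The pair \<open>(x, y)\<close> stands for \<open>x + y \<epsilon>\<close>, with an odd self-adjoint \<open>\<epsilon>\<close> of square \<open>1\<close> that
  graded-commutes with \<open>B\<close>.\<close>

definition cl1x :: "('b, 'k::field) galg \<Rightarrow> ('b \<times> 'b, 'k) galg"
  where "cl1x B =
    \<lparr>carr = carr B \<times> carr B, nul = (nul B, nul B),
     add = (\<lambda>x y. (add B (fst x) (fst y), add B (snd x) (snd y))),
     scl = (\<lambda>c x. (scl B c (fst x), scl B c (snd x))),
     mul = (\<lambda>x y. (add B (mul B (fst x) (fst y)) (mul B (snd x) (grd B (snd y))),
                   add B (mul B (fst x) (snd y)) (mul B (snd x) (grd B (fst y))))),
     adj = (\<lambda>x. (adj B (fst x), grd B (adj B (snd x)))),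
     grd = (\<lambda>x. (grd B (fst x), scl B (-1) (grd B (snd x))))\<rparr>"

lemma cl1x_simps [simp]:
  "carr (cl1x B) = carr B \<times> carr B" "nul (cl1x B) = (nul B, nul B)"
  "add (cl1x B) (x, y) (x', y') = (add B x x', add B y y')"
  "scl (cl1x B) c (x, y) = (scl B c x, scl B c y)"
  "mul (cl1x B) (x, y) (x', y') =
    (add B (mul B x x') (mul B y (grd B y')), add B (mul B x y') (mul B y (grd B x')))"
  "adj (cl1x B) (x, y) = (adj B x, grd B (adj B y))"
  "grd (cl1x B) (x, y) = (grd B x, scl B (-1) (grd B y))"
  by (simp_all add: cl1x_def)

lemma (in plain_galg) scl_minus_left: "x \<in> carr B \<Longrightarrow> scl B (- c) x = - scl B c x"
  using scl_add_left[of x c "- c"] by (simp add: eq_neg_iff_add_eq_0 add.commute)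

lemma plain_cl1x:
  assumes "plain_galg B" shows "plain_galg (cl1x B)"
proof -
  interpret plain_galg B by fact
  have "add (cl1x B) = (+)" by (auto simp: cl1x_def plus_prod_def fun_eq_iff)
  then show ?thesis
    by unfold_locales (auto simp: scl_add_right scl_add_left scl_scl mul_add_left mul_add_right
      mul_scl_left mul_scl_right adj_add grd_add grd_scl grd_adj grd_minus adj_minus scl_minus
          scl_minus_left zero_prod_def)
qed

text \<open>The generator is odd, so it reverses the parity of the second component.\<close>

lemma cl1x_parts:
  assumes "plain_galg B" "x \<in> carr B" "y \<in> carr B"
  shows "even_part (cl1x B) (x, y) = (even_part B x, odd_part B y)"
    "odd_part (cl1x B) (x, y) = (odd_part B x, even_part B y)"
proof -
  interpret plain_galg B by fact
  show "even_part (cl1x B) (x, y) = (even_part B x, odd_part B y)"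
    "odd_part (cl1x B) (x, y) = (odd_part B x, even_part B y)"
    using assms(2,3) by (simp_all add: even_part_def odd_part_def)
qed

lemma cl1x_graded_iso:
  assumes "plain_galg B" "graded_iso B C \<phi>" shows "graded_iso (cl1x B) (cl1x C) (map_prod \<phi> \<phi>)"
proof -
  interpret plain_galg B by fact
  note h = graded_isoD[OF assms(2)]
  have a: "add B x y \<in> carr B" if "x \<in> carr B" "y \<in> carr B" for x y using that by simp
  have "bij_betw (map_prod \<phi> \<phi>) (carr B \<times> carr B) (carr C \<times> carr C)"
    using h(1) by (auto simp: bij_betw_def inj_on_def map_prod_surj_on)
  then show ?thesis
    by (auto simp: graded_iso_def star_iso_def h a simp del: add_eq scl_minus_one)
qed

text \<open>Adjoining \<open>\<epsilon>\<close> to the second factor amounts to adjoining it to the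
  tensor product, as \<open>\<epsilon>\<close> stands to the right of everything.\<close>

lemma cl1x_model:
  assumes "tensor_model A C X T"
  shows "tensor_model A (cl1x C) (cl1x X) (\<lambda>a b. (T a (fst b), T a (snd b)))"
proof -
  interpret tensor_model A C X T by fact
  interpret C1: plain_galg "cl1x C" by (rule plain_cl1x[OF C.plain_galg_axioms])
  interpret X1: plain_galg "cl1x X" by (rule plain_cl1x[OF X.plain_galg_axioms])
  let ?T = "\<lambda>a b. (T a (fst b), T a (snd b))"
  let ?p = "\<lambda>p. image_mset (map_prod id p)"
  have T_minus: "T a (- b) = - T a b" if "a \<in> carr A" "b \<in> carr C" for a b
    using T_scl_right[of a b "-1"] that by simp
  have tsum: "tsum ?T M = (tsum T (?p fst M), tsum T (?p snd M))" for M
    by (induction M) (auto simp: zero_prod_def)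
  show ?thesis
  proof
    fix a b a' b' assume h: "a \<in> carr A" "b \<in> carr (cl1x C)" "a' \<in> carr A" "b' \<in> carr (cl1x C)"
    obtain x y x' y' where b: "b = (x, y)" "b' = (x', y')" by fastforce
    show "mul (cl1x X) (?T a b) (?T a' b') =
        ?T (mul A a a') (mul (cl1x C) (even_part (cl1x C) b) b') +
        ?T (mul A a (grd A a')) (mul (cl1x C) (odd_part (cl1x C) b) b')"
      using h unfolding b by (simp add: cl1x_parts C.plain_galg_axioms T_mul T_grd T_add_right add_ac)
  next
    fix a b assume h: "a \<in> carr A" "b \<in> carr (cl1x C)"
    obtain x y where b: "b = (x, y)" by fastforce
    show "adj (cl1x X) (?T a b) = ?T (adj A a) (adj (cl1x C) (even_part (cl1x C) b)) +
        ?T (adj A (grd A a)) (adj (cl1x C) (odd_part (cl1x C) b))"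
      using h unfolding b
      by (simp add: cl1x_parts C.plain_galg_axioms T_adj T_grd X.grd_add A.grd_adj add_ac)
    show "grd (cl1x X) (?T a b) = ?T (grd A a) (grd (cl1x C) b)"
      using h unfolding b by (simp add: T_grd T_minus)
  next
    fix x assume "x \<in> carr (cl1x X)"
    then obtain M N where MN: "set_mset M \<subseteq> carr A \<times> carr C" "tsum T M = fst x"
      "set_mset N \<subseteq> carr A \<times> carr C" "tsum T N = snd x"
      using T_surj[of "fst x"] T_surj[of "snd x"] by auto
    have "tsum ?T (?p (\<lambda>b. (b, 0)) M) = (tsum T M, 0)" "tsum ?T (?p (\<lambda>b. (0, b)) M) = (0, tsum T M)"
      if "set_mset M \<subseteq> carr A \<times> carr C" for M
      using that by (induction M) (auto simp: zero_prod_def)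
    then have "tsum ?T (?p (\<lambda>b. (b, 0)) M + ?p (\<lambda>b. (0, b)) N) = x" (is "tsum ?T ?M = x")
      using MN by simp
    moreover have "set_mset ?M \<subseteq> carr A \<times> carr (cl1x C)" using MN by auto
    ultimately show "\<exists>M. set_mset M \<subseteq> carr A \<times> carr (cl1x C) \<and> tsum ?T M = x" by blast
  next
    fix M N assume h: "set_mset M \<subseteq> carr A \<times> carr (cl1x C)" "set_mset N \<subseteq> carr A \<times> carr (cl1x C)"
      "tsum ?T M = tsum ?T N"
    \<comment> \<open>Splitting \<open>(x, y)\<close> as \<open>(x, 0) + (0, y)\<close> reduces
      injectivity to that of \<open>T\<close> in each component.\<close>
    have split: "tensor_eq A (cl1x C) M (?p (\<lambda>b. (b, 0)) (?p fst M) + ?p (\<lambda>b. (0, b)) (?p snd M))"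
      if "set_mset M \<subseteq> carr A \<times> carr (cl1x C)" for M
      using that
    proof (induction M)
      case empty
      then show ?case by (simp add: tensor_eq.refl)
    next
      case (add q M)
      obtain a x y where q: "q = (a, (x, y))" by (metis prod.exhaust)
      have "tensor_eq A (cl1x C) {#(a, add (cl1x C) (x, 0) (0, y))#} {#(a, (x, 0)), (a, (0, y))#}"
        using add.prems by (intro tensor_eq.add_right) (auto simp: q)
      then have "tensor_eq A (cl1x C) {#q#} {#(a, (x, 0)), (a, (0, y))#}"
        by (simp add: q)
      from tensor_eq.plus[OF this add.IH] add.prems show ?case
        by (simp add: q add_mset_commute)
    qed
    have "tensor_eq A (cl1x C) (?p (\<lambda>b. (b, 0)) (?p fst M)) (?p (\<lambda>b. (b, 0)) (?p fst N))"
      using h by (intro tensor_eq_map[OF T_inj]) (auto simp: tsum)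
    moreover have "tensor_eq A (cl1x C) (?p (\<lambda>b. (0, b)) (?p snd M)) (?p (\<lambda>b. (0, b)) (?p snd N))"
      using h by (intro tensor_eq_map[OF T_inj]) (auto simp: tsum)
    ultimately show "tensor_eq A (cl1x C) M N"
      using split[OF h(1)] split[OF h(2)] by (meson tensor_eq.plus tensor_eq.sym tensor_eq.trans)
  qed (auto simp: T_add_left T_add_right T_scl_left T_scl_right)
qed

section \<open>Tensor products with the complex Clifford algebra on one generator\<close>

lemma plain_complex: "plain_galg (graded_alg (id :: complex \<Rightarrow> complex))"
  by unfold_locales (auto simp: scaleC_complex_def star_complex_def algebra_simps)

text \<open>The base case from which generators are adjoined. Antilinearity of \<open>adj\<close> is
  a separate hypothesis because \<open>plain_galg\<close> has no conjugation of scalars.\<close>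

lemma scalar_model:
  assumes "plain_galg B" and adj_scl: "\<And>c x. x \<in> carr B \<Longrightarrow> adj B (scl B c x) = scl B (cnj c) (adj B x)"
  shows "tensor_model B (graded_alg (id :: complex \<Rightarrow> complex)) B (\<lambda>x c. scl B c x)"
proof -
  interpret plain_galg B by fact
  interpret S: plain_galg "graded_alg (id :: complex \<Rightarrow> complex)" by (rule plain_complex)
  interpret tensor_coords B "graded_alg (id :: complex \<Rightarrow> complex)" "{()}" "\<lambda>_. 1" "\<lambda>_ c. c"
    by unfold_locales (auto simp: fin_basis_def scaleC_complex_def)
  have parts: "even_part (graded_alg id) c = c" "odd_part (graded_alg id) c = 0" for c :: complex
    by (simp_all add: even_part_def odd_part_def scaleC_complex_def)
  show ?thesis
  proof
    show "\<exists>M. set_mset M \<subseteq> carr B \<times> carr (graded_alg (id :: complex \<Rightarrow> complex)) \<and> tsum (\<lambda>x c. scl B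
        c x) M = x"
      if "x \<in> carr B" for x
      by (rule coords_T_surj[of "\<lambda>_ x. x"]) (use that in auto)
    show "tensor_eq B (graded_alg id) M N"
      if "set_mset M \<subseteq> carr B \<times> carr (graded_alg (id :: complex \<Rightarrow> complex))"
        "set_mset N \<subseteq> carr B \<times> carr (graded_alg (id :: complex \<Rightarrow> complex))"
        "tsum (\<lambda>x c. scl B c x) M = tsum (\<lambda>x c. scl B c x) N" for M N
      by (rule coords_T_inj[OF plain_galg_axioms _ _ _ that, of "\<lambda>_ x. x"]) auto
  qed (auto simp: scl_add_right scl_add_left scl_scl mul_scl_left mul_scl_right grd_scl adj_scl parts
      scaleC_complex_def star_complex_def mult.commute)
qed

lemma CCl1_alg_simps [simp]:
  "carr CCl1_alg = UNIV" "nul CCl1_alg = 0" "add CCl1_alg = (+)"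
  "scl CCl1_alg c (a, b) = (c * a, c * b)" "mul CCl1_alg (a, b) (a', b') = (a * a', b * b')"
  "adj CCl1_alg (a, b) = (cnj a, cnj b)" "grd CCl1_alg (a, b) = (b, a)"
  by (simp_all add: CCl1_alg_def)

lemma plain_CCl1: "plain_galg CCl1_alg"
  by unfold_locales (auto simp: algebra_simps)

text \<open>Here \<open>\<epsilon>\<close> is \<open>(1, -1)\<close>, which the exchange of the two
  summands negates; the coordinates are half sum and half difference.\<close>

lemma CCl1_graded_iso:
  "graded_iso CCl1_alg (cl1x (graded_alg (id :: complex \<Rightarrow> complex)))
    (\<lambda>x. ((fst x + snd x) / 2, (fst x - snd x) / 2))"
proof -
  have "bij (\<lambda>x :: complex \<times> complex. ((fst x + snd x) / 2, (fst x - snd x) / 2))"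
    by (rule o_bij[of "\<lambda>x. (fst x + snd x, fst x - snd x)"]) (auto simp: fun_eq_iff field_simps)
  then show ?thesis
    by (auto simp: graded_iso_def star_iso_def scaleC_complex_def star_complex_def field_simps)
qed

definition TCCl1 :: "('b, complex) galg \<Rightarrow> 'b \<Rightarrow> complex \<times> complex \<Rightarrow> 'b \<times> 'b"
  where "TCCl1 B x p = (scl B ((fst p + snd p) / 2) x, scl B ((fst p - snd p) / 2) x)"

lemma TCCl1_model:
  assumes "plain_galg B" "\<And>c x. x \<in> carr B \<Longrightarrow> adj B (scl B c x) = scl B (cnj c) (adj B x)"
  shows "tensor_model B CCl1_alg (cl1x B) (TCCl1 B)"
  using tensor_model.pullback[OF cl1x_model[OF scalar_model[OF assms]] plain_CCl1 CCl1_graded_iso]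
  by (simp add: TCCl1_def[abs_def])

section \<open>Inner conjugacy on isomorphic algebras\<close>

text \<open>A unitary multiplier of \<open>Z\<close> is given by its actions \<open>L, R\<close> on
  an isomorphic \<open>B\<close>, and \<open>L', R'\<close> are those of its adjoint. For a tensor
  product \<open>Z\<close> this avoids defining maps on classes of multisets.\<close>

lemma inner_conjugate_transport:
  assumes "plain_galg B" and \<psi>: "graded_iso B Z \<psi>"
    and adj: "\<And>x. x \<in> carr B \<Longrightarrow> adj B (adj B x) = x"
    and car: "\<And>x. x \<in> carr B \<Longrightarrow> L x \<in> carr B \<and> R x \<in> carr B \<and> L' x \<in> carr B \<and> R' x \<in> carr B"
    and add: "\<And>x y. x \<in> carr B \<Longrightarrow> y \<in> carr B \<Longrightarrow> L (x + y) = L x + L y \<and> R (x + y) = R x + R y"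
    and scl: "\<And>c x. x \<in> carr B \<Longrightarrow> L (scl B c x) = scl B c (L x) \<and> R (scl B c x) = scl B c (R x)"
    and mul: "\<And>x y. x \<in> carr B \<Longrightarrow> y \<in> carr B \<Longrightarrow>
      L (mul B x y) = mul B (L x) y \<and> R (mul B x y) = mul B x (R y) \<and> mul B x (L y) = mul B (R x) y"
    and star: "\<And>x. x \<in> carr B \<Longrightarrow> adj B (R (adj B x)) = L' x \<and> adj B (L (adj B x)) = R' x"
    and inv: "\<And>x. x \<in> carr B \<Longrightarrow> L (L' x) = x \<and> L' (L x) = x \<and> R (R' x) = x \<and> R' (R x) = x"
    and even: "\<And>x. x \<in> carr B \<Longrightarrow> L (R' (grd B x)) = grd B (L (R' x))"
    and \<rho>: "\<And>x. x \<in> carr B \<Longrightarrow> \<rho> x \<in> carr B \<and> r (\<psi> x) = \<psi> (\<rho> x)"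
    and \<rho>': "\<And>x. x \<in> carr B \<Longrightarrow> \<rho>' x \<in> carr B \<and> s (\<psi> x) = \<psi> (\<rho>' x)"
    and conj: "\<And>x. x \<in> carr B \<Longrightarrow> \<rho>' (L (R' x)) = L (R' (\<rho> x))"
  shows "inner_conjugate Z r s"
proof -
  interpret plain_galg B by fact
  note h = graded_isoD[OF \<psi>]
  define i where "i = inv_into (carr B) \<psi>"
  have i: "i (\<psi> x) = x" if "x \<in> carr B" for x using h(1) that by (simp add: i_def bij_betw_def)
  have surj: "\<exists>x\<in>carr B. z = \<psi> x" if "z \<in> carr Z" for z using h(1) that by (auto simp: bij_betw_def)
  have hs: "add Z (\<psi> x) (\<psi> y) = \<psi> (x + y)" "mul Z (\<psi> x) (\<psi> y) = \<psi> (mul B x y)"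
    "scl Z c (\<psi> x) = \<psi> (scl B c x)" "adj Z (\<psi> x) = \<psi> (adj B x)" "grd Z (\<psi> x) = \<psi> (grd B x)"
    if "x \<in> carr B" "y \<in> carr B" for x y c
    using h(3)[OF that] h(4)[OF that(1)] h(5)[OF that] h(6,7)[OF that(1)] by simp_all
  note hs = hs(1,2) hs(3-5)[OF _ carr_zero]
  define lift where "lift K = (\<lambda>z\<in>carr Z. \<psi> (K (i z)))" for K :: "'a \<Rightarrow> 'a"
  have lift: "lift K (\<psi> x) = \<psi> (K x)" if "x \<in> carr B" for K x
    using that by (simp add: lift_def i h(2))
  have lift_ext: "lift K \<in> carr Z \<rightarrow>\<^sub>E carr Z" if "\<And>x. x \<in> carr B \<Longrightarrow> K x \<in> carr B" for K
  proof -
    have "\<psi> (K (i z)) \<in> carr Z" if "z \<in> carr Z" for z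
      using surj[OF that] \<open>\<And>x. x \<in> carr B \<Longrightarrow> K x \<in> carr B\<close> h(2) i by force
    then show ?thesis by (simp add: lift_def)
  qed
  have dc: "(lift K, lift K') \<in> double_centralizers Z"
    if "\<And>x. x \<in> carr B \<Longrightarrow> K x \<in> carr B \<and> K' x \<in> carr B"
      "\<And>x y. x \<in> carr B \<Longrightarrow> y \<in> carr B \<Longrightarrow> K (x + y) = K x + K y \<and> K' (x + y) = K' x + K' y"
      "\<And>c x. x \<in> carr B \<Longrightarrow> K (scl B c x) = scl B c (K x) \<and> K' (scl B c x) = scl B c (K' x)"
      "\<And>x y. x \<in> carr B \<Longrightarrow> y \<in> carr B \<Longrightarrow>
        K (mul B x y) = mul B (K x) y \<and> K' (mul B x y) = mul B x (K' y) \<and> mul B x (K y) = mul B (K' x) y"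
    for K K'
    unfolding double_centralizers_def linear_map_on_def
    using lift_ext that by (auto dest!: surj simp: lift hs)
  let ?w = "(lift L, lift R)"
  have w: "?w \<in> carr (mult_alg Z)"
    using dc[of L R] car add scl mul by (simp add: mult_alg_def)
  have w': "adj (mult_alg Z) ?w = (lift L', lift R')"
  proof -
    have "(\<lambda>z\<in>carr Z. adj Z (lift K (adj Z z))) = lift K'"
      if "\<And>x. x \<in> carr B \<Longrightarrow> K x \<in> carr B \<and> adj B (K (adj B x)) = K' x" for K K'
    proof
      fix z
      show "(\<lambda>z\<in>carr Z. adj Z (lift K (adj Z z))) z = lift K' z"
      proof (cases "z \<in> carr Z")
        case True
        then obtain x where x: "x \<in> carr B" "z = \<psi> x" using surj by blast
        then have "adj Z (lift K (adj Z z)) = \<psi> (adj B (K (adj B x)))"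
          using that by (simp add: hs lift)
        then show ?thesis using True x that by (simp add: lift)
      qed (simp add: lift_def)
    qed
    then show ?thesis using star car by (simp add: mult_alg_def)
  qed
  have one: "compose (carr Z) (lift K) (lift K') = (\<lambda>z\<in>carr Z. z)"
    if "\<And>x. x \<in> carr B \<Longrightarrow> K' x \<in> carr B \<and> K (K' x) = x" for K K'
  proof
    fix z
    show "compose (carr Z) (lift K) (lift K') z = (\<lambda>z\<in>carr Z. z) z"
      using surj[of z] that by (cases "z \<in> carr Z") (auto simp: compose_def lift)
  qed
  have unitary: "mult_unitary Z ?w"
    unfolding mult_unitary_def w'
    using w one[of L L'] one[of L' L] one[of R R'] one[of R' R] inv car
    by (simp add: mult_alg_def mult_one_def)
  have Ad: "Ad Z ?w (\<psi> x) = \<psi> (L (R' x))" if "x \<in> carr B" for x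
    unfolding Ad_def w' using that car by (simp add: lift)
  \<comment> \<open>Conjugation is \<open>L\<close> after \<open>R'\<close>, so its inverse is
    \<open>R\<close> after \<open>L'\<close>.\<close>
  have Ad_inv: "inv_into (carr Z) (Ad Z ?w) (\<psi> x) = \<psi> (R (L' x))" if x: "x \<in> carr B" for x
  proof (rule inv_into_f_eq)
    show "inj_on (Ad Z ?w) (carr Z)"
    proof (rule inj_onI)
      fix z z' assume z: "z \<in> carr Z" "z' \<in> carr Z" "Ad Z ?w z = Ad Z ?w z'"
      then obtain y y' where y: "y \<in> carr B" "z = \<psi> y" "y' \<in> carr B" "z' = \<psi> y'"
        using surj by metis
      then have "\<psi> (L (R' y)) = \<psi> (L (R' y'))" using z(3) by (simp add: Ad)
      then have "L (R' y) = L (R' y')" using i y car by metis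
      then have "y = y'" using inv car y by metis
      then show "z = z'" using y by simp
    qed
    show "\<psi> (R (L' x)) \<in> carr Z" using car h(2) x by blast
    show "Ad Z ?w (\<psi> (R (L' x))) = \<psi> x" using Ad car inv x by simp
  qed
  show ?thesis
    unfolding inner_conjugate_def
  proof (intro exI[of _ ?w] conjI ballI)
    show "mult_unitary Z ?w" by (rule unitary)
  next
    fix z assume "z \<in> carr Z"
    then obtain x where x: "x \<in> carr B" "z = \<psi> x" using surj by blast
    have "s z = \<psi> (\<rho>' (L (R' (R (L' x)))))" using x \<rho>' inv car by simp
    also have "\<dots> = \<psi> (L (R' (\<rho> (R (L' x)))))" using x car conj by simp
    also have "\<dots> = Ad Z ?w (r (\<psi> (R (L' x))))" using x car \<rho> Ad by simp
    finally show "s z = Ad Z ?w (r (inv_into (carr Z) (Ad Z ?w) z))" using x Ad_inv by simp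
    show "Ad Z ?w (grd Z z) = grd Z (Ad Z ?w z)"
      using x even car by (simp add: hs Ad)
  qed
qed

text \<open>All content sits in \<open>\<Phi>\<close>: once \<open>B\<close> is carried to the
  tensor product the two real structures agree, and the conjugating unitary is
  \<open>1\<close>.\<close>

lemma conj_tensor_assemble:
  assumes \<Phi>: "real_iso B r X \<rho> \<Phi>" and T: "tensor_model A C X T"
    and adj: "\<And>x. x \<in> carr X \<Longrightarrow> adj X (adj X x) = x"
    and \<rho>: "real_structure X \<rho>"
    and f: "\<And>a. a \<in> carr A \<Longrightarrow> f a \<in> carr A" and g: "\<And>b. b \<in> carr C \<Longrightarrow> g b \<in> carr C"
    and \<rho>T: "\<And>a b. a \<in> carr A \<Longrightarrow> b \<in> carr C \<Longrightarrow> \<rho> (T a b) = T (f a) (g b)"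
    and D: "tensor_model (fixed_alg A f) D (fixed_alg X \<rho>) T'"
  shows "inner_conjugate_triples B r (A \<otimes>\<^sub>g C) (tmap A C f g) \<and>
    graded_isomorphic (fixed_alg B r) (fixed_alg A f \<otimes>\<^sub>g D)"
proof
  interpret tensor_model A C X T by fact
  have \<rho>': "x \<in> carr X \<Longrightarrow> \<rho> x \<in> carr X" "x \<in> carr X \<Longrightarrow> y \<in> carr X \<Longrightarrow> \<rho> (x + y) = \<rho> x + \<rho> y" for x y
    using \<rho> by (auto simp: real_structure_def bij_betw_def)
  have c: "x \<in> carr X \<Longrightarrow> tmap A C f g (cls x) = cls (\<rho> x)" for x
    by (rule tmap_cls) (use f g \<rho>' \<rho>T in auto)
  let ?\<phi> = "cls \<circ> \<Phi>"
  have \<phi>: "graded_iso B (A \<otimes>\<^sub>g C) ?\<phi>"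
    using \<Phi> cls_graded_iso graded_iso_trans by (auto simp: real_iso_def)
  have \<Phi>': "x \<in> carr B \<Longrightarrow> r x \<in> carr B \<and> \<Phi> (r x) = \<rho> (\<Phi> x)" "x \<in> carr B \<Longrightarrow> \<Phi> x \<in> carr X" for x
    using \<Phi> graded_isoD(2) by (auto simp: real_iso_def)
  have "?\<phi> (r (inv_into (carr B) ?\<phi> (cls x))) = cls (\<rho> x)" if x: "x \<in> carr X" for x
  proof -
    define y where "y = inv_into (carr B) ?\<phi> (cls x)"
    have bij: "bij_betw ?\<phi> (carr B) (carr (A \<otimes>\<^sub>g C))" using \<phi> by (rule graded_isoD)
    have "cls x \<in> ?\<phi> ` carr B" using bij x by (simp add: bij_betw_def gtensor_simps)
    then have y: "y \<in> carr B" "cls (\<Phi> y) = cls x"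
      using inv_into_into f_inv_into_f unfolding y_def by (metis, metis comp_apply)
    have "cls (\<Phi> (r y)) = cls (\<rho> (\<Phi> y))" using y \<Phi>' by simp
    also have "\<dots> = cls (\<rho> x)" using c[of "\<Phi> y"] c[of x] \<Phi>' y x by simp
    finally show ?thesis by (simp add: y_def)
  qed
  then have "inner_conjugate (A \<otimes>\<^sub>g C) (\<lambda>z. ?\<phi> (r (inv_into (carr B) ?\<phi> z))) (tmap A C f g)"
    by (intro inner_conjugate_transport[OF X.plain_galg_axioms cls_graded_iso,
        of "\<lambda>x. x" "\<lambda>x. x" "\<lambda>x. x" "\<lambda>x. x" \<rho> _ \<rho>])
      (use c \<rho>' adj in \<open>auto\<close>)
  then show "inner_conjugate_triples B r (A \<otimes>\<^sub>g C) (tmap A C f g)"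
    unfolding inner_conjugate_triples_def using \<phi> by blast
  show "graded_isomorphic (fixed_alg B r) (fixed_alg A f \<otimes>\<^sub>g D)"
    unfolding graded_isomorphic_def
    using graded_iso_trans[OF real_iso_fixed[OF \<Phi>] tensor_model.cls_graded_iso[OF D]] by blast
qed

section \<open>Clifford algebras\<close>

lemma clifford_simps:
  "carr (clifford_alg cj r s) = {x. \<forall>S. x S \<noteq> 0 \<longrightarrow> S \<subseteq> {..<r + s}}"
  "nul (clifford_alg cj r s) = 0" "add (clifford_alg cj r s) = (+)"
  "scl (clifford_alg cj r s) c x = (\<lambda>S. c * x S)"
  "mul (clifford_alg cj r s) x y = (\<lambda>U. \<Sum>S\<in>Pow {..<r + s}. \<Sum>T\<in>Pow {..<r + s}.
       if (S - T) \<union> (T - S) = U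
       then (-1) ^ (card {(i, j). i \<in> S \<and> j \<in> T \<and> j < i} + card (S \<inter> T \<inter> {r..})) * x S * y T
       else 0)"
  "adj (clifford_alg cj r s) x =
    (\<lambda>S. (-1) ^ (card S * (card S - 1) div 2 + card (S \<inter> {r..})) * cj (x S))"
  "grd (clifford_alg cj r s) x = (\<lambda>S. (-1) ^ card S * x S)"
  by (simp_all add: clifford_alg_def fun_eq_iff)

lemma plain_clifford:
  assumes cj: "\<And>x y. cj (x + y) = cj x + cj y" "\<And>k x. cj ((-1) ^ k * x) = (-1) ^ k * cj x"
  shows "plain_galg (clifford_alg cj r s)"
proof -
  have cj0: "cj 0 = 0" using cj(1)[of 0 0] by (metis add.right_neutral add_left_cancel)
  show ?thesis
  proof
    fix x y :: "nat set \<Rightarrow> 'a" assume xy: "x \<in> carr (clifford_alg cj r s)" "y \<in> carr (clifford_alg cj r s)"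
    have "mul (clifford_alg cj r s) x y U = 0" if "\<not> U \<subseteq> {..<r + s}" for U
      unfolding clifford_simps using that by (intro sum.neutral ballI) auto
    then show "mul (clifford_alg cj r s) x y \<in> carr (clifford_alg cj r s)"
      by (auto simp: clifford_simps(1))
    have "x S + y S = 0" if "\<not> S \<subseteq> {..<r + s}" for S
    proof -
      have "x S = 0" "y S = 0" using xy that unfolding clifford_simps(1) by blast+
      then show ?thesis by simp
    qed
    then show "x + y \<in> carr (clifford_alg cj r s)"
      by (auto simp: clifford_simps(1))
  next
    fix x y z :: "nat set \<Rightarrow> 'a" and c
    let ?m = "mul (clifford_alg cj r s)"
    show "?m (x + y) z = ?m x z + ?m y z" "?m x (y + z) = ?m x y + ?m x z"
      unfolding clifford_simps plus_fun_def sum.distrib[symmetric]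
      by (intro ext sum.cong HOL.refl; simp add: algebra_simps)+
    show "?m (scl (clifford_alg cj r s) c x) y = scl (clifford_alg cj r s) c (?m x y)"
      "?m x (scl (clifford_alg cj r s) c y) = scl (clifford_alg cj r s) c (?m x y)"
      unfolding clifford_simps sum_distrib_left
      by (intro ext sum.cong HOL.refl; simp)+
  next
    fix x :: "nat set \<Rightarrow> 'a" assume "x \<in> carr (clifford_alg cj r s)"
    then show "adj (clifford_alg cj r s) x \<in> carr (clifford_alg cj r s)"
      unfolding clifford_simps mem_Collect_eq by (metis cj0 mult_zero_right)
    show "grd (clifford_alg cj r s) (adj (clifford_alg cj r s) x) =
        adj (clifford_alg cj r s) (grd (clifford_alg cj r s) x)"
      by (simp only: clifford_simps cj(2) mult.left_commute)
  qed (auto simp: clifford_simps fun_eq_iff cj algebra_simps simp flip: power_add)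
qed

lemma CCl_alg_eq: "CCl_alg n = clifford_alg cnj n 0"
  and Cl_alg_eq: "Cl_alg r s = clifford_alg id r s"
  by (simp_all add: CCl_alg_def Cl_alg_def)

lemma plain_CCl: "plain_galg (CCl_alg n)"
  unfolding CCl_alg_eq by (rule plain_clifford) auto

lemma plain_Cl: "plain_galg (Cl_alg r s)"
  unfolding Cl_alg_eq by (rule plain_clifford) auto

text \<open>Makes \<open>(-1) ^ card (S \<inter> R)\<close> multiplicative under symmetric
  difference. With \<open>\<i>\<close> for \<open>-1\<close>, the doubled term leaves the sign
  \<open>(-1) ^ card (S \<inter> T \<inter> R)\<close>.\<close>

lemma card_sym_diff:
  assumes "finite S" "finite T"
  shows "card (S \<inter> R) + card (T \<inter> R) = card (((S - T) \<union> (T - S)) \<inter> R) + 2 * card (S \<inter> T \<inter> R)"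
proof -
  have "card (S \<inter> R) = card ((S - T) \<inter> R) + card (S \<inter> T \<inter> R)"
    using assms by (subst card_Un_disjoint[symmetric]) (auto intro!: arg_cong[where f = card])
  moreover have "card (T \<inter> R) = card ((T - S) \<inter> R) + card (S \<inter> T \<inter> R)"
    using assms by (subst card_Un_disjoint[symmetric]) (auto intro!: arg_cong[where f = card])
  moreover have "card (((S - T) \<union> (T - S)) \<inter> R) = card ((S - T) \<inter> R) + card ((T - S) \<inter> R)"
    using assms by (subst card_Un_disjoint[symmetric]) (auto intro!: arg_cong[where f = card])
  ultimately show ?thesis by simp
qed

section \<open>Real forms of the complex Clifford algebras\<close>

lemma sum_fun_apply: "sum f I x = (\<Sum>i\<in>I. f i x)" for f :: "'i \<Rightarrow> 'c \<Rightarrow> 'b::comm_monoid_add"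
  by (induction I rule: infinite_finite_induct) auto

text \<open>A generator of square \<open>-1\<close> is \<open>\<i>\<close> times a generator of the
  complex algebra, so a monomial collects one \<open>\<i>\<close> for each of them.\<close>

definition cl_embed :: "nat \<Rightarrow> (nat set \<Rightarrow> real) \<Rightarrow> nat set \<Rightarrow> complex"
  where "cl_embed r x = (\<lambda>S. \<i> ^ card (S \<inter> {r..}) * complex_of_real (x S))"

lemma Int_atLeast: "S \<subseteq> {..<r + s} \<Longrightarrow> S \<inter> {r..<r + s} = S \<inter> {r..}"
  "S \<subseteq> {..<n} \<Longrightarrow> S \<inter> {n..} = {}" for r s n :: nat
  by auto

lemma i_power_minus: "(-1) ^ k * cnj (\<i> ^ k) = \<i> ^ k" "cnj (\<i> ^ k) = (-1) ^ k * \<i> ^ k"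
  by (simp_all add: power_mult_distrib[symmetric])

lemma cl_embed_real_form: "real_form (Cl_alg r s) (CCl_alg (r + s)) (l_cl r s) (cl_embed r)"
proof -
  let ?D = "Cl_alg r s" and ?C = "CCl_alg (r + s)"
  have "cl_embed r (mul ?D x y) U = mul ?C (cl_embed r x) (cl_embed r y) U" for x y U
  proof -
    \<comment> \<open>Where the real algebra has the sign of a repeated generator of square
      \<open>-1\<close>, the complex one has two factors \<open>\<i>\<close>. All complex generators
      have square \<open>1\<close>, so the set \<open>S \<inter> T \<inter> {r + s..}\<close> is
      empty.\<close>
    have *: "\<i> ^ card (U \<inter> {r..}) * complex_of_real ((-1) ^ (k + card (S \<inter> T \<inter> {r..})) * x S * y T) =
        (-1) ^ (k + card (S \<inter> T \<inter> {r + s..})) * (\<i> ^ card (S \<inter> {r..}) * complex_of_real (x S)) *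
          (\<i> ^ card (T \<inter> {r..}) * complex_of_real (y T))"
      if "S \<subseteq> {..<r + s}" "T \<subseteq> {..<r + s}" "(S - T) \<union> (T - S) = U" for S T k
    proof -
      have fin: "finite S" "finite T" using that finite_subset by blast+
      have "\<i> ^ card (S \<inter> {r..}) * \<i> ^ card (T \<inter> {r..}) =
          \<i> ^ card (U \<inter> {r..}) * (-1) ^ card (S \<inter> T \<inter> {r..})"
        using card_sym_diff[OF fin, of "{r..}"] that(3) by (simp add: power_add[symmetric]) (simp
            add: power_add power_mult)
      moreover have "S \<inter> T \<inter> {r + s..} = {}" using that by auto
      ultimately show ?thesis by (simp add: power_add mult_ac)
    qed
    show ?thesis
      unfolding cl_embed_def Cl_alg_eq CCl_alg_eq clifford_simps of_real_sum sum_distrib_left add_0_right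
    proof (intro sum.cong HOL.refl)
      fix S T assume "S \<in> Pow {..<r + s}" "T \<in> Pow {..<r + s}"
      then show "\<i> ^ card (U \<inter> {r..}) * complex_of_real (if (S - T) \<union> (T - S) = U
          then (-1) ^ (card {(i, j). i \<in> S \<and> j \<in> T \<and> j < i} + card (S \<inter> T \<inter> {r..})) * x S * y T else 0) =
        (if (S - T) \<union> (T - S) = U
          then (-1) ^ (card {(i, j). i \<in> S \<and> j \<in> T \<and> j < i} + card (S \<inter> T \<inter> {r + s..})) *
            (\<i> ^ card (S \<inter> {r..}) * complex_of_real (x S)) * (\<i> ^ card (T \<inter> {r..}) * complex_of_real (y T))
          else 0)"
        using *[of S T "card {(i, j). i \<in> S \<and> j \<in> T \<and> j < i}"]
        by (cases "(S - T) \<union> (T - S) = U") (simp_all only: if_True if_False of_real_0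
            mult_zero_right Pow_iff simp_thms)
    qed
  qed
  moreover have "cl_embed r (adj ?D x) S = adj ?C (cl_embed r x) S" if "x \<in> carr ?D" for x S
  proof (cases "S \<subseteq> {..<r + s}")
    case True
    then show ?thesis
      by (simp add: cl_embed_def Cl_alg_eq CCl_alg_eq clifford_simps Int_atLeast i_power_minus
          power_add del: complex_cnj_power)
  next
    case False
    then have "x S = 0" using that by (auto simp: Cl_alg_eq clifford_simps)
    then show ?thesis by (simp add: cl_embed_def Cl_alg_eq CCl_alg_eq clifford_simps)
  qed
  moreover have "l_cl r s (cl_embed r x) S = cl_embed r x S" if "x \<in> carr ?D" for x S
  proof (cases "S \<subseteq> {..<r + s}")
    case True
    then show ?thesis
      by (simp add: cl_embed_def l_cl_def Int_atLeast i_power_minus(1) mult.assoc[symmetric] del: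
          complex_cnj_power)
  next
    case False
    then have "x S = 0" using that by (auto simp: Cl_alg_eq clifford_simps)
    then show ?thesis by (simp add: cl_embed_def l_cl_def)
  qed
  ultimately show ?thesis
    unfolding real_form_def
    by (auto simp: fun_eq_iff) (auto simp: cl_embed_def Cl_alg_eq CCl_alg_eq clifford_simps algebra_simps)
qed

lemma Cl_basis:
  "fin_basis (Cl_alg r s) (Pow {..<r + s}) (\<lambda>S U. if U = S then 1 else 0) (\<lambda>S x. x S)"
proof -
  have "x = (\<Sum>S\<in>Pow {..<r + s}. (\<lambda>U. x S * (if U = S then 1 else 0)))"
    if "\<forall>S. x S \<noteq> 0 \<longrightarrow> S \<subseteq> {..<r + s}" for x :: "nat set \<Rightarrow> real"
  proof
    fix U
    have "(\<Sum>S\<in>Pow {..<r + s}. x S * (if U = S then 1 else 0)) = (\<Sum>S\<in>Pow {..<r + s}. if U = S then x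
        U else 0)"
      by (intro sum.cong) auto
    then show "x U = (\<Sum>S\<in>Pow {..<r + s}. (\<lambda>U. x S * (if U = S then 1 else 0))) U"
      using that by (auto simp: sum_fun_apply)
  qed
  then show ?thesis
    by (auto simp: fin_basis_def Cl_alg_eq clifford_simps)
qed

text \<open>The images of the real monomials, indexed as in \<open>Cl_basis\<close>; the coordinate
  divides by the phase of the monomial.\<close>

lemma CCl_basis:
  "fin_basis (CCl_alg (r + s)) (Pow {..<r + s}) (\<lambda>S. cl_embed r (\<lambda>U. if U = S then 1 else 0))
    (\<lambda>S x. x S / \<i> ^ card (S \<inter> {r..}))"
proof -
  have "x = (\<Sum>S\<in>Pow {..<r + s}. (\<lambda>U. x S / \<i> ^ card (S \<inter> {r..}) * cl_embed r (\<lambda>U. if U = S then 1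
      else 0) U))"
    if "\<forall>S. x S \<noteq> 0 \<longrightarrow> S \<subseteq> {..<r + s}" for x :: "nat set \<Rightarrow> complex"
  proof
    fix U
    have "(\<Sum>S\<in>Pow {..<r + s}. x S / \<i> ^ card (S \<inter> {r..}) * cl_embed r (\<lambda>U. if U = S then 1 else 0) U) =
        (\<Sum>S\<in>Pow {..<r + s}. if U = S then x U else 0)"
      by (intro sum.cong) (auto simp: cl_embed_def)
    then show "x U = (\<Sum>S\<in>Pow {..<r + s}. (\<lambda>U. x S / \<i> ^ card (S \<inter> {r..}) * cl_embed r (\<lambda>U. if U = S
        then 1 else 0) U)) U"
      using that by (auto simp: sum_fun_apply)
  qed
  then show ?thesis
    by (auto simp: fin_basis_def CCl_alg_eq clifford_simps cl_embed_def add_divide_distrib)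
qed

lemma l_cl_real_structure: "real_structure (CCl_alg (r + s)) (l_cl r s)"
proof -
  let ?C = "CCl_alg (r + s)"
  have inv: "l_cl r s (l_cl r s x) = x" for x
    by (simp add: l_cl_def fun_eq_iff power_add[symmetric] mult.assoc[symmetric]
        power_mult_distrib[symmetric])
  have car: "l_cl r s x \<in> carr ?C" if "x \<in> carr ?C" for x
    using that by (auto simp: CCl_alg_eq clifford_simps l_cl_def)
  have "bij_betw (l_cl r s) (carr ?C) (carr ?C)"
    by (rule bij_betw_byWitness[of _ "l_cl r s"]) (use inv car in auto)
  moreover have "l_cl r s (mul ?C x y) U = mul ?C (l_cl r s x) (l_cl r s y) U" for x y U
  proof -
    let ?R = "{r..<r + s}"
    have "(-1) ^ card (U \<inter> ?R) * cnj ((-1) ^ k * x S * y T) =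
        (-1) ^ k * ((-1) ^ card (S \<inter> ?R) * cnj (x S)) * ((-1) ^ card (T \<inter> ?R) * cnj (y T))"
      if "S \<subseteq> {..<r + s}" "T \<subseteq> {..<r + s}" "(S - T) \<union> (T - S) = U" for S T k
    proof -
      have fin: "finite S" "finite T" using that finite_subset by blast+
      have "(-1 :: complex) ^ card (S \<inter> ?R) * (-1) ^ card (T \<inter> ?R) = (-1) ^ card (U \<inter> ?R)"
        using card_sym_diff[OF fin, of ?R] that(3) by (simp add: power_add[symmetric]) (simp add:
            power_add power_mult)
      then show ?thesis by (simp add: mult_ac)
    qed
    then show ?thesis
      unfolding l_cl_def CCl_alg_eq clifford_simps cnj_sum sum_distrib_left
      by (intro sum.cong) auto
  qed
  ultimately show ?thesis
    unfolding real_structure_def using inv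
    by (auto simp: fun_eq_iff) (auto simp: l_cl_def CCl_alg_eq clifford_simps algebra_simps)
qed

lemma clifford_real_form_model:
  assumes T: "tensor_model A (CCl_alg (r + s)) X T" and f: "real_structure A f" and \<rho>: "real_structure X \<rho>"
    and \<rho>T: "\<And>a b. a \<in> carr A \<Longrightarrow> b \<in> carr (CCl_alg (r + s)) \<Longrightarrow> \<rho> (T a b) = T (f a) (l_cl r s b)"
  shows "tensor_model (fixed_alg A f) (Cl_alg r s) (fixed_alg X \<rho>) (\<lambda>a x. T a (cl_embed r x))"
  by (rule real_form_model[where \<kappa> = "cl_embed r" and d = "\<lambda>S U. if U = S then 1 else 0",
        OF T f \<rho> l_cl_real_structure \<rho>T plain_Cl cl_embed_real_form Cl_basis CCl_basis])
    (simp_all add: cl_embed_def)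

section \<open>Splitting off the last Clifford generator\<close>

lemma Pow_lessThan_Suc: "Pow {..<Suc n} = Pow {..<n} \<union> insert n ` Pow {..<n}"
  by (simp add: lessThan_Suc Pow_insert)

lemma sum_Pow_Suc:
  "(\<Sum>S\<in>Pow {..<Suc n}. F S) = (\<Sum>S\<in>Pow {..<n}. F S + (F (insert n S) :: 'b::comm_monoid_add))"
proof -
  have "inj_on (insert n) (Pow {..<n})" by (auto simp: inj_on_def)
  moreover have "Pow {..<n} \<inter> insert n ` Pow {..<n} = {}" by auto
  ultimately show ?thesis
    unfolding Pow_lessThan_Suc by (subst sum.union_disjoint) (auto simp: sum.reindex sum.distrib)
qed

definition cl_split :: "nat \<Rightarrow> (nat set \<Rightarrow> complex) \<Rightarrow> (nat set \<Rightarrow> complex) \<times> (nat set \<Rightarrow> complex)"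
  where "cl_split n x = ((\<lambda>S. if n \<in> S then 0 else x S), (\<lambda>S. if n \<in> S then 0 else x (insert n S)))"

text \<open>Multiplying \<open>e S\<close> by the last generator from the right keeps the monomial sorted, and moving
  that generator past \<open>e T\<close> contributes the grading sign of \<open>e T\<close>.\<close>

lemma cl_split_graded_iso: "graded_iso (CCl_alg (Suc n)) (cl1x (CCl_alg n)) (cl_split n)"
proof -
  let ?C = "CCl_alg (Suc n)" and ?B = "CCl_alg n"
  define join where "join y = (\<lambda>S. if n \<in> S then snd y (S - {n}) else fst y S)"
    for y :: "(nat set \<Rightarrow> complex) \<times> (nat set \<Rightarrow> complex)"
  have mem: "S \<subseteq> {..<Suc n} \<longleftrightarrow> S - {n} \<subseteq> {..<n}" "n \<notin> S \<Longrightarrow> S \<subseteq> {..<Suc n} \<longleftrightarrow> S \<subseteq> {..<n}"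
    "insert n S \<subseteq> {..<Suc n} \<longleftrightarrow> S \<subseteq> {..<Suc n}" for S
    by (auto simp: less_Suc_eq)
  have car: "x \<in> carr ?C \<longleftrightarrow> (\<forall>S. x S \<noteq> 0 \<longrightarrow> S \<subseteq> {..<Suc n})" "y \<in> carr ?B \<longleftrightarrow> (\<forall>S. y S \<noteq> 0 \<longrightarrow> S \<subseteq>
      {..<n})" for x y
    by (simp_all add: CCl_alg_eq clifford_simps)
  have "bij_betw (cl_split n) (carr ?C) (carr (cl1x ?B))"
  proof (rule bij_betw_byWitness[of _ join])
    show "\<forall>x\<in>carr ?C. join (cl_split n x) = x"
      by (auto simp: join_def cl_split_def fun_eq_iff insert_absorb)
    show "\<forall>y\<in>carr (cl1x ?B). cl_split n (join y) = y"
    proof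
      fix y assume y: "y \<in> carr (cl1x ?B)"
      have "fst y S = 0" "snd y S = 0" if "n \<in> S" for S
        using y that by (cases y, force simp: car)+
      then show "cl_split n (join y) = y"
        by (auto simp: join_def cl_split_def fun_eq_iff prod_eq_iff)
    qed
    show "cl_split n ` carr ?C \<subseteq> carr (cl1x ?B)"
      by (auto simp: car cl_split_def mem(2,3)) (metis lessThan_iff less_SucE subsetD insert_subset)+
    show "join ` carr (cl1x ?B) \<subseteq> carr ?C"
    proof
      fix x assume "x \<in> join ` carr (cl1x ?B)"
      then obtain y where y: "x = join y" "fst y \<in> carr ?B" "snd y \<in> carr ?B" by auto
      have "S \<subseteq> {..<Suc n}" if "join y S \<noteq> 0" for S
      proof (cases "n \<in> S")
        case True
        then have "S - {n} \<subseteq> {..<n}" using that y(3) by (simp add: join_def car)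
        then show ?thesis using mem(1) by blast
      next
        case False
        then have "S \<subseteq> {..<n}" using that y(2) by (simp add: join_def car)
        then show ?thesis using mem(2) False by blast
      qed
      then show "x \<in> carr ?C" by (simp add: car y(1))
    qed
  qed
  moreover have "cl_split n (mul ?C x y) = mul (cl1x ?B) (cl_split n x) (cl_split n y)"
    if "x \<in> carr ?C" "y \<in> carr ?C" for x y
  proof -
    define iv where "iv S T = card {(i, j). i \<in> S \<and> j \<in> T \<and> j < i}" for S T :: "nat set"
    \<comment> \<open>\<open>n\<close> exceeds all elements of \<open>S\<close> and
      \<open>T\<close>: in the right factor it causes no inversion, in the left factor one for each
      element of \<open>T\<close>.\<close>
    have iv: "iv S (insert n T) = iv S T" "iv (insert n S) T = iv S T + card T"
      "iv (insert n S) (insert n T) = iv S T + card T"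
      if "S \<subseteq> {..<n}" "T \<subseteq> {..<n}" for S T
    proof -
      have fin: "finite S" "finite T" using that finite_subset by blast+
      have 1: "{(i, j). i \<in> S \<and> j \<in> insert n T \<and> j < i} = {(i, j). i \<in> S \<and> j \<in> T \<and> j < i}"
        "{(i, j). i \<in> insert n S \<and> j \<in> T \<and> j < i} = {(i, j). i \<in> S \<and> j \<in> T \<and> j < i} \<union> Pair n ` T"
        "{(i, j). i \<in> insert n S \<and> j \<in> insert n T \<and> j < i} = {(i, j). i \<in> S \<and> j \<in> T \<and> j < i} \<union> Pair n ` T"
        using that by auto
      have 2: "finite {(i, j). i \<in> S \<and> j \<in> T \<and> j < i}"
        by (rule finite_subset[of _ "S \<times> T"]) (use fin in auto)
      have "{(i, j). i \<in> S \<and> j \<in> T \<and> j < i} \<inter> Pair n ` T = {}" using that by auto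
      then have "card ({(i, j). i \<in> S \<and> j \<in> T \<and> j < i} \<union> Pair n ` T) =
          card {(i, j). i \<in> S \<and> j \<in> T \<and> j < i} + card T"
        using 2 fin by (subst card_Un_disjoint) (auto simp: card_image inj_on_def)
      then show "iv S (insert n T) = iv S T" "iv (insert n S) T = iv S T + card T"
        "iv (insert n S) (insert n T) = iv S T + card T"
        unfolding iv_def 1 by simp_all
    qed
    have mulC: "mul (CCl_alg k) x y U = (\<Sum>S\<in>Pow {..<k}. \<Sum>T\<in>Pow {..<k}.
        if (S - T) \<union> (T - S) = U then (-1) ^ iv S T * x S * y T else 0)" for k x y U
      unfolding CCl_alg_eq clifford_simps iv_def
      by (intro sum.cong) (auto simp: Int_atLeast le_infI1)
    have nS: "n \<notin> S" if "S \<subseteq> {..<n}" for S using that by auto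
    \<comment> \<open>\<open>S\<close> and \<open>T\<close> occur with and without \<open>n\<close>.
      The symmetric difference contains \<open>n\<close> only in the two mixed cases, so two of the
      four terms survive for each \<open>U\<close>.\<close>
    have e: "(if (S - T) \<union> (T - S) = U then (-1) ^ iv S T * x S * y T else 0) +
        (if (S - insert n T) \<union> (insert n T - S) = U then (-1) ^ iv S (insert n T) * x S * y (insert
            n T) else 0) +
        ((if (insert n S - T) \<union> (T - insert n S) = U then (-1) ^ iv (insert n S) T * x (insert n S)
            * y T else 0) +
        (if (insert n S - insert n T) \<union> (insert n T - insert n S) = U
          then (-1) ^ iv (insert n S) (insert n T) * x (insert n S) * y (insert n T) else 0)) =
        (if n \<in> U then
          (if (S - T) \<union> (T - S) = U - {n} then (-1) ^ iv S T * x S * y (insert n T) else 0) +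
          (if (S - T) \<union> (T - S) = U - {n} then (-1) ^ iv S T * x (insert n S) * ((-1) ^ card T * y
              T) else 0)
        else
          (if (S - T) \<union> (T - S) = U then (-1) ^ iv S T * x S * y T else 0) +
          (if (S - T) \<union> (T - S) = U then (-1) ^ iv S T * x (insert n S) * ((-1) ^ card T * y (insert
              n T)) else 0))"
      if S: "S \<subseteq> {..<n}" "T \<subseteq> {..<n}" for S T U
    proof -
      have n: "n \<notin> S" "n \<notin> T" using S by auto
      have d: "(insert n S - insert n T) \<union> (insert n T - insert n S) = (S - T) \<union> (T - S)"
        "(S - insert n T) \<union> (insert n T - S) = insert n ((S - T) \<union> (T - S))"
        "(insert n S - T) \<union> (T - insert n S) = insert n ((S - T) \<union> (T - S))"
        using n by auto
      have u: "insert n ((S - T) \<union> (T - S)) = U \<longleftrightarrow> n \<in> U \<and> (S - T) \<union> (T - S) = U - {n}"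
        using n by auto
      have u': "(S - T) \<union> (T - S) = U \<Longrightarrow> n \<notin> U" using n by auto
      show ?thesis
        unfolding d u iv[OF S] using u' by (auto simp: power_add mult_ac)
    qed
    show ?thesis
    proof -
      have split: "mul ?C x y U = (\<Sum>S\<in>Pow {..<n}. \<Sum>T\<in>Pow {..<n}.
        (if n \<in> U then
          (if (S - T) \<union> (T - S) = U - {n} then (-1) ^ iv S T * x S * y (insert n T) else 0) +
          (if (S - T) \<union> (T - S) = U - {n} then (-1) ^ iv S T * x (insert n S) * ((-1) ^ card T * y
              T) else 0)
        else
          (if (S - T) \<union> (T - S) = U then (-1) ^ iv S T * x S * y T else 0) +
          (if (S - T) \<union> (T - S) = U then (-1) ^ iv S T * x (insert n S) * ((-1) ^ card T * y (insert
              n T)) else 0)))" for U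
        unfolding mulC sum_Pow_Suc sum.distrib[symmetric] using e
        by (intro sum.cong HOL.refl) auto
      have cong: "mul ?B p q U = (\<Sum>S\<in>Pow {..<n}. \<Sum>T\<in>Pow {..<n}.
        if (S - T) \<union> (T - S) = U then (-1) ^ iv S T * p' S * q' T else 0)"
        if "\<And>S. n \<notin> S \<Longrightarrow> p S = p' S" "\<And>S. n \<notin> S \<Longrightarrow> q S = q' S" for p q p' q' U
        unfolding mulC by (intro sum.cong) (auto simp: nS that)
      have zero: "mul ?B p q U = 0" if "n \<in> U" for p q U
        unfolding mulC using that by (intro sum.neutral ballI) auto
      have grd: "grd ?B p = (\<lambda>S. (-1) ^ card S * p S)" for p
        by (simp add: CCl_alg_eq clifford_simps)
      let ?x = "\<lambda>S. if n \<in> S then 0 else x S" and ?x' = "\<lambda>S. if n \<in> S then 0 else x (insert n S)"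
      let ?y = "\<lambda>S. if n \<in> S then 0 else y S" and ?y' = "\<lambda>S. if n \<in> S then 0 else y (insert n S)"
      have "(if n \<in> U then 0 else mul ?C x y U) = mul ?B ?x ?y U + mul ?B ?x' (grd ?B ?y') U" for U
      proof (cases "n \<in> U")
        case False
        then show ?thesis
          by (simp add: split sum.distrib cong[of ?x x ?y y] grd
            cong[of ?x' "\<lambda>S. x (insert n S)" "\<lambda>S. (-1) ^ card S * ?y' S" "\<lambda>S. (-1) ^ card S * y
                (insert n S)"])
      qed (simp add: zero)
      moreover have "(if n \<in> U then 0 else mul ?C x y (insert n U)) = mul ?B ?x ?y' U + mul ?B ?x'
          (grd ?B ?y) U" for U
      proof (cases "n \<in> U")
        case False
        then show ?thesis
          by (simp add: split sum.distrib cong[of ?x x ?y' "\<lambda>S. y (insert n S)"] grd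
            cong[of ?x' "\<lambda>S. x (insert n S)" "\<lambda>S. (-1) ^ card S * ?y S" "\<lambda>S. (-1) ^ card S * y S"])
      qed (simp add: zero)
      ultimately show ?thesis
        unfolding cl_split_def cl1x_simps by (auto simp: fun_eq_iff CCl_alg_eq clifford_simps(3))
    qed
  qed
  moreover have "cl_split n (adj ?C x) = adj (cl1x ?B) (cl_split n x)" if "x \<in> carr ?C" for x
  proof -
    \<comment> \<open>Reversing one more generator takes \<open>k\<close> further transpositions;
      this is the grading sign in the adjoint of \<open>cl1x\<close>.\<close>
    have tri: "(-1 :: complex) ^ (Suc k * k div 2) = (-1) ^ (k * (k - 1) div 2) * (-1) ^ k" for k :: nat
    proof -
      have "Suc k * k = k * (k - 1) + 2 * k" by (cases k) (auto simp: algebra_simps)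
      moreover have "(m + 2 * k) div 2 = m div 2 + k" for m by simp
      ultimately show ?thesis by (simp only: power_add)
    qed
    have fin: "finite S \<and> S \<inter> {n..} = {} \<and> S \<inter> {Suc n..} = {} \<and> insert n S \<inter> {Suc n..} = {}"
      if "n \<notin> S" "x S \<noteq> 0 \<or> x (insert n S) \<noteq> 0" for S
    proof -
      have "S \<subseteq> {..<Suc n}" using that \<open>x \<in> carr ?C\<close> by (auto simp: car)
      moreover from this have "S \<subseteq> {..<n}" using that(1) mem(2) by blast
      ultimately show ?thesis using finite_subset by auto
    qed
    have A: "(-1) ^ (card S * (card S - 1) div 2 + card (S \<inter> {Suc n..})) * cnj (x S) =
        (-1) ^ (card S * (card S - 1) div 2 + card (S \<inter> {n..})) * cnj (x S)" if "n \<notin> S" for S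
      using fin[OF that] by (cases "x S = 0") auto
    have B: "(-1) ^ (card (insert n S) * (card (insert n S) - 1) div 2 + card (insert n S \<inter> {Suc
        n..})) * cnj (x (insert n S)) =
        (-1) ^ card S * ((-1) ^ (card S * (card S - 1) div 2 + card (S \<inter> {n..})) * cnj (x (insert n S)))"
      if "n \<notin> S" for S
    proof (cases "x (insert n S) = 0")
      case False
      then have "finite S" "card (S \<inter> {n..}) = 0" "card (insert n S \<inter> {Suc n..}) = 0"
        using fin[OF that] by auto
      moreover from this have "card (insert n S) = Suc (card S)" using that by simp
      ultimately show ?thesis
        using tri[of "card S"] by (simp only: diff_Suc_1 add_0_right mult.assoc mult.left_commute)
    qed simp
    show ?thesis
      unfolding cl_split_def cl1x_simps CCl_alg_eq clifford_simps
      using A B by (auto simp: fun_eq_iff)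
  qed
  moreover have "cl_split n (grd ?C x) = grd (cl1x ?B) (cl_split n x)" if "x \<in> carr ?C" for x
  proof -
    have "finite S" if "x (insert n S) \<noteq> 0" for S
    proof -
      have "insert n S \<subseteq> {..<Suc n}" using that \<open>x \<in> carr ?C\<close> by (auto simp: car)
      then show ?thesis by (meson finite_insert finite_lessThan finite_subset)
    qed
    then have "(-1) ^ card (insert n S) * x (insert n S) = - ((-1) ^ card S * x (insert n S))"
      if "n \<notin> S" for S
      using that by (cases "x (insert n S) = 0") auto
    then show ?thesis by (auto simp: cl_split_def CCl_alg_eq clifford_simps fun_eq_iff)
  qed
  ultimately show ?thesis
    unfolding graded_iso_def star_iso_def
    by (auto simp: cl_split_def CCl_alg_eq clifford_simps fun_eq_iff)
qed

lemma CCl_0_graded_iso: "graded_iso (CCl_alg 0) (graded_alg (id :: complex \<Rightarrow> complex)) (\<lambda>x. x {})"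
proof -
  have "bij_betw (\<lambda>x. x {}) (carr (CCl_alg 0)) (UNIV :: complex set)"
    by (rule bij_betw_byWitness[of _ "\<lambda>c S. if S = {} then c else 0"])
      (auto simp: CCl_alg_eq clifford_simps fun_eq_iff split: if_splits)
  then show ?thesis
    by (auto simp: graded_iso_def star_iso_def CCl_alg_eq clifford_simps scaleC_complex_def
        star_complex_def)
qed

section \<open>Matrix models\<close>

lemma plain_graded_alg:
  assumes "star_invol \<gamma> (\<lambda>c. c)" shows "plain_galg (graded_alg \<gamma>)"
proof -
  interpret star_invol \<gamma> "\<lambda>c. c" by fact
  show ?thesis
    by unfold_locales (auto simp: scaleC_add_right scaleC_add_left scaleC_scaleC mult_scaleC_left
      mult_scaleC_right distrib_left distrib_right star_add add scale star)
qed

lemma grade2_nth [simp]: "grade2 h x $ i $ j = (if i = j then h (x $ i $ j) else - h (x $ i $ j))"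
  using exhaust_2[of i] exhaust_2[of j] by (auto simp: grade2_def)

lemma plain_mat2:
  assumes "star_invol \<gamma> (\<lambda>c. c)"
  shows "plain_galg (mat2_alg (entrywise \<gamma>))" "plain_galg (mat2_alg (grade2 \<gamma>))"
proof -
  interpret star_invol \<gamma> "\<lambda>c. c" by fact
  show "plain_galg (mat2_alg (entrywise \<gamma>))" "plain_galg (mat2_alg (grade2 \<gamma>))"
    by (unfold_locales; simp add: vec_eq_iff scaleC_add_right scaleC_add_left scaleC_scaleC mult_scaleC_left
      mult_scaleC_right scaleC_minus_right distrib_left distrib_right star_add star_minus add scale
          star minus add_ac)+
qed

lemma mat2_adj_scl:
  "adj (mat2_alg g) (scl (mat2_alg g) c x) = scl (mat2_alg g) (cnj c) (adj (mat2_alg g) x)"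
  "adj (mat2_alg g) (adj (mat2_alg g) x) = x"
  by (simp_all add: vec_eq_iff star_scaleC)

lemma star_invol_complex: "star_invol (id :: complex \<Rightarrow> complex) (\<lambda>c. c)"
  by unfold_locales auto

lemma entrywise_id: "entrywise id = id"
  by (auto simp: vec_eq_iff)

lemma sigma_z_grade: "Ad_mat sigma_z = grade2 id"
  by (auto simp: fun_eq_iff mat22_eq_iff Ad_mat_def sigma_z_def matrix_matrix_mult_def sum_2
    transpose_def entrywise_def)

lemma CCl2_alg_eq: "CCl2_alg = mat2_alg (grade2 id)"
  by (simp add: CCl2_alg_def sigma_z_grade)

lemma l20_eq: "l20 = realx cnj" and l02_eq: "l02 = realy cnj"
proof -
  have i: "\<i> * z * \<i> = - z" for z by (simp add: mult.commute[of _ \<i>])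
  show "l20 = realx cnj" "l02 = realy cnj"
  by (auto simp: i fun_eq_iff mat22_eq_iff Ad_mat_def sigma_x_def sigma_y_def matrix_matrix_mult_def sum_2
    transpose_def entrywise_def l20_def l02_def realx_def realy_def)
qed

lemma sum_UNIV_2_2:
  "(\<Sum>p\<in>(UNIV :: (2 \<times> 2) set). F p) = F (1, 1) + F (1, 2) + (F (2, 1) + F (2, 2))"
proof -
  have "sum F UNIV = (\<Sum>i\<in>UNIV. \<Sum>j\<in>UNIV. F (i, j))"
    by (simp add: sum.cartesian_product)
  then show ?thesis by (simp add: sum_2)
qed

lemma mat2_basis:
  "fin_basis (mat2_alg g) UNIV (\<lambda>(i, j). \<chi> k l. if k = i \<and> l = j then 1 else (0::complex))
    (\<lambda>(i, j) b. b $ i $ j)"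
proof -
  have "b = (\<Sum>(i, j)\<in>UNIV. entrywise (scaleC (b $ i $ j)) (\<chi> k l. if k = i \<and> l = j then 1 else 0))"
    for b :: "complex^2^2"
    unfolding sum_UNIV_2_2
    by (simp add: mat22_eq_iff sum_2 scaleC_complex_def)
  then show ?thesis
    by (auto simp: fin_basis_def scaleC_complex_def split_def)
qed

text \<open>The diagonal matrix with entries \<open>a\<close> and \<open>h a\<close>, times the
  scalar matrix \<open>b\<close>. For \<open>h = \<gamma>\<close>, moving the diagonal matrix past
  an off-diagonal \<open>b\<close> replaces \<open>a\<close> by \<open>\<gamma> a\<close>, which is
  the sign rule.\<close>

definition TM2 :: "('a::cstar_algebra \<Rightarrow> 'a) \<Rightarrow> 'a \<Rightarrow> complex^2^2 \<Rightarrow> 'a^2^2"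
  where "TM2 h a b = (\<chi> i j. scaleC (b $ i $ j) (if i = 1 then a else h a))"

lemma TM2_nth [simp]: "TM2 h a b $ i $ j = scaleC (b $ i $ j) (if i = 1 then a else h a)"
  by (simp add: TM2_def)

lemma TM2_model:
  fixes \<gamma> :: "'a::cstar_algebra \<Rightarrow> 'a"
  assumes g: "star_invol \<gamma> (\<lambda>c. c)"
  shows TM2_even: "tensor_model (graded_alg \<gamma>) (mat2_alg id) (mat2_alg (entrywise \<gamma>)) (TM2 id)"
    and TM2_odd: "tensor_model (graded_alg \<gamma>) CCl2_alg (mat2_alg (grade2 \<gamma>)) (TM2 \<gamma>)"
proof -
  interpret star_invol \<gamma> "\<lambda>c. c" by fact
  interpret A: plain_galg "graded_alg \<gamma>" by (rule plain_graded_alg[OF g])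
  interpret X1: plain_galg "mat2_alg (entrywise \<gamma>)" by (rule plain_mat2[OF g])
  interpret X2: plain_galg "mat2_alg (grade2 \<gamma>)" by (rule plain_mat2[OF g])
  interpret C1: plain_galg "mat2_alg (id :: complex^2^2 \<Rightarrow> _)"
    using plain_mat2(1)[OF star_invol_complex] by (simp add: entrywise_id)
  interpret C2: plain_galg CCl2_alg
    using plain_mat2(2)[OF star_invol_complex] by (simp add: CCl2_alg_eq)
  let ?e = "\<lambda>(i, j). \<chi> k l. if k = i \<and> l = j then 1 else (0::complex)" and ?d = "\<lambda>(i, j) b. b $ i $ j"
  have coords: "tensor_coords (graded_alg \<gamma>) (mat2_alg id) UNIV ?e ?d"
    "tensor_coords (graded_alg \<gamma>) CCl2_alg UNIV ?e ?d"
    unfolding CCl2_alg_eq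
    by (intro tensor_coords.intro tensor_coords_axioms.intro mat2_basis A.plain_galg_axioms
      C1.plain_galg_axioms C2.plain_galg_axioms[unfolded CCl2_alg_eq])+
  have sum: "x = (\<Sum>j\<in>UNIV. TM2 h ((case j of (i, j) \<Rightarrow> if i = 1 then x $ i $ j else h (x $ i $ j))) (?e j))"
    if "\<And>a. h (h a) = a" "h 0 = 0" for h and x :: "'a^2^2"
    unfolding sum_UNIV_2_2 by (simp add: mat22_eq_iff that)
  have parts1: "even_part (mat2_alg id) b = b" "odd_part (mat2_alg id) b = 0" for b :: "complex^2^2"
    by (simp_all add: even_part_def odd_part_def vec_eq_iff scaleC_complex_def)
  have parts2: "even_part CCl2_alg b = mat22 (b $ 1 $ 1) 0 0 (b $ 2 $ 2)"
    "odd_part CCl2_alg b = mat22 0 (b $ 1 $ 2) (b $ 2 $ 1) 0" for b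
    by (simp_all add: CCl2_alg_eq even_part_def odd_part_def mat22_eq_iff scaleC_complex_def)
  note scaleC_simps = scaleC_add_right scaleC_add_left scaleC_scaleC mult_scaleC_left
    mult_scaleC_right scaleC_minus_right scaleC_minus_left
  show "tensor_model (graded_alg \<gamma>) (mat2_alg id) (mat2_alg (entrywise \<gamma>)) (TM2 id)"
  proof
    interpret tensor_coords "graded_alg \<gamma>" "mat2_alg id" UNIV ?e ?d by (rule coords)
    show "\<exists>M. set_mset M \<subseteq> carr (graded_alg \<gamma>) \<times> carr (mat2_alg id) \<and> tsum (TM2 id) M = x" for x
      by (rule coords_T_surj[OF _ sum]) auto
    show "tensor_eq (graded_alg \<gamma>) (mat2_alg id) M N"
      if "set_mset M \<subseteq> carr (graded_alg \<gamma>) \<times> carr (mat2_alg id)"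
        "set_mset N \<subseteq> carr (graded_alg \<gamma>) \<times> carr (mat2_alg id)" "tsum (TM2 id) M = tsum (TM2 id) N" for M N
      by (rule coords_T_inj[OF X1.plain_galg_axioms _ _ _ that, of "\<lambda>(i, j) x. x $ i $ j"]) auto
  qed (simp_all add: mat22_eq_iff scaleC_simps parts1 star_add star_scaleC star scale
      scaleC_complex_def star_complex_def mult_ac)
  show "tensor_model (graded_alg \<gamma>) CCl2_alg (mat2_alg (grade2 \<gamma>)) (TM2 \<gamma>)"
  proof
    interpret tensor_coords "graded_alg \<gamma>" CCl2_alg UNIV ?e ?d by (rule coords)
    show "\<exists>M. set_mset M \<subseteq> carr (graded_alg \<gamma>) \<times> carr CCl2_alg \<and> tsum (TM2 \<gamma>) M = x" for x
      by (rule coords_T_surj[OF _ sum]) (auto simp: CCl2_alg_eq)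
    show "tensor_eq (graded_alg \<gamma>) CCl2_alg M N"
      if "set_mset M \<subseteq> carr (graded_alg \<gamma>) \<times> carr CCl2_alg"
        "set_mset N \<subseteq> carr (graded_alg \<gamma>) \<times> carr CCl2_alg" "tsum (TM2 \<gamma>) M = tsum (TM2 \<gamma>) N" for M N
      by (rule coords_T_inj[OF X2.plain_galg_axioms _ _ _ that, of "\<lambda>(i, j) x. if i = 1 then x $ i $
          j else \<gamma> (x $ i $ j)"])
        (auto simp: add scale)
  qed (simp_all add: mat22_eq_iff scaleC_simps parts2 star_add star_scaleC star scale add mult
      CCl2_alg_eq[symmetric], (simp_all add: CCl2_alg_eq mat22_eq_iff scaleC_simps star_scaleC star
          scale add mult scaleC_complex_def star_complex_def mult_ac)?)
qed

lemma realx_nth: "realx h x $ 1 $ 1 = h (x $ 2 $ 2)" "realx h x $ 1 $ 2 = h (x $ 2 $ 1)"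
    "realx h x $ 2 $ 1 = h (x $ 1 $ 2)" "realx h x $ 2 $ 2 = h (x $ 1 $ 1)"
  and realy_nth: "realy h x $ 1 $ 1 = h (x $ 2 $ 2)" "realy h x $ 1 $ 2 = - h (x $ 2 $ 1)"
    "realy h x $ 2 $ 1 = - h (x $ 1 $ 2)" "realy h x $ 2 $ 2 = h (x $ 1 $ 1)"
  by (simp_all add: realx_def realy_def)

lemma mat2_real_structures:
  fixes \<gamma> :: "'a::cstar_algebra \<Rightarrow> 'a"
  assumes g: "star_invol \<gamma> (\<lambda>c. c)" and f: "real_structure (graded_alg \<gamma>) f"
  shows "real_structure (mat2_alg (entrywise \<gamma>)) (entrywise f)"
    "real_structure (mat2_alg (entrywise \<gamma>)) (realy f)"
    "real_structure (mat2_alg (grade2 \<gamma>)) (realx f)"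
    "real_structure (mat2_alg (grade2 \<gamma>)) (realy f)"
proof -
  interpret star_invol f cnj by (rule real_structure_star_invol[OF f])
  interpret g: star_invol \<gamma> "\<lambda>c. c" by fact
  have c: "f (\<gamma> a) = \<gamma> (f a)" for a using f by (simp add: real_structure_def)
  have "entrywise f (entrywise f x) = x" "realx f (realx f x) = x" "realy f (realy f x) = x" for x
    by (simp_all add: mat22_eq_iff realx_nth realy_nth minus)
  then have "bij (entrywise f)" "bij (realx f)" "bij (realy f)"
    by (auto intro!: o_bij simp: fun_eq_iff)
  then show "real_structure (mat2_alg (entrywise \<gamma>)) (entrywise f)"
    "real_structure (mat2_alg (entrywise \<gamma>)) (realy f)"
    "real_structure (mat2_alg (grade2 \<gamma>)) (realx f)"
    "real_structure (mat2_alg (grade2 \<gamma>)) (realy f)"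
    by (simp_all add: real_structure_def mat22_eq_iff realx_nth realy_nth add scale mult star star_minus
      minus g.minus c scaleC_minus_right)
qed

text \<open>For \<open>h = \<gamma>\<close> the exchange of the diagonal entries puts
  \<open>f (\<gamma> a)\<close> first and \<open>f a = \<gamma> (f (\<gamma> a))\<close> second,
  again a matrix of the required shape.\<close>

lemma TM2_real:
  assumes "star_invol f cnj" "star_invol \<gamma> (\<lambda>c. c)" "\<And>a. f (\<gamma> a) = \<gamma> (f a)"
  shows "entrywise f (TM2 id a b) = TM2 id (f a) (l11 b)"
    "realy f (TM2 id a b) = TM2 id (f a) (l02 b)"
    "realx f (TM2 \<gamma> a b) = TM2 \<gamma> ((f \<circ> \<gamma>) a) (l20 b)"
    "realy f (TM2 \<gamma> a b) = TM2 \<gamma> ((f \<circ> \<gamma>) a) (l02 b)"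
proof -
  interpret star_invol f cnj by fact
  interpret g: star_invol \<gamma> "\<lambda>c. c" by fact
  show "entrywise f (TM2 id a b) = TM2 id (f a) (l11 b)"
    "realy f (TM2 id a b) = TM2 id (f a) (l02 b)"
    "realx f (TM2 \<gamma> a b) = TM2 \<gamma> ((f \<circ> \<gamma>) a) (l20 b)"
    "realy f (TM2 \<gamma> a b) = TM2 \<gamma> ((f \<circ> \<gamma>) a) (l02 b)"
    by (simp_all add: mat22_eq_iff l11_def l20_eq l02_eq realx_nth realy_nth scale assms(3)
        scaleC_minus_left)
qed

lemma real_structure_comp_grading:
  assumes "star_invol \<gamma> (\<lambda>c. c)" "real_structure (graded_alg \<gamma>) f"
  shows "real_structure (graded_alg \<gamma>) (f \<circ> \<gamma>)"
proof -
  interpret f: star_invol f cnj by (rule real_structure_star_invol[OF assms(2)])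
  interpret g: star_invol \<gamma> "\<lambda>c. c" by fact
  have c: "f (\<gamma> a) = \<gamma> (f a)" for a using assms(2) by (simp add: real_structure_def)
  have "bij (f \<circ> \<gamma>)" by (rule o_bij[of "f \<circ> \<gamma>"]) (auto simp: fun_eq_iff c)
  then show ?thesis
    by (simp add: real_structure_def f.add g.add f.scale g.scale f.mult g.mult f.star g.star c)
qed

section \<open>Real matrices and quaternions as real forms\<close>

lemma complex_mat2_real_structures:
  "real_structure (mat2_alg id) l11" "real_structure (mat2_alg id) l02"
proof -
  have "real_structure (graded_alg (id :: complex \<Rightarrow> complex)) cnj"
    unfolding real_structure_def
    by (auto simp: scaleC_complex_def star_complex_def intro!: o_bij[of cnj])
  from mat2_real_structures(1,2)[OF star_invol_complex this]
  show "real_structure (mat2_alg id) l11" "real_structure (mat2_alg id) l02"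
    by (simp_all add: entrywise_id l11_def l02_eq)
qed

lemma real_mat2_model:
  assumes T: "tensor_model A (mat2_alg id) X T" and f: "real_structure A f" and \<rho>: "real_structure X \<rho>"
    and \<rho>T: "\<And>a b. a \<in> carr A \<Longrightarrow> \<rho> (T a b) = T (f a) (l11 b)"
  shows "\<exists>T'. tensor_model (fixed_alg A f) real_mat2_alg (fixed_alg X \<rho>) T'"
proof -
  let ?k = "entrywise complex_of_real"
  have D: "plain_galg real_mat2_alg"
    by unfold_locales (simp_all add: real_mat2_alg_def mat22_eq_iff matrix_matrix_mult_def
        transpose_def sum_2 algebra_simps)
  have k: "real_form real_mat2_alg (mat2_alg id) l11 ?k"
    by (simp add: real_form_def real_mat2_alg_def mat22_eq_iff matrix_matrix_mult_def transpose_def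
        sum_2 l11_def
      scaleC_complex_def star_complex_def)
  let ?e = "\<lambda>(i, j). \<chi> k l. if k = i \<and> l = j then 1 else 0"
  have "b = (\<Sum>(i, j)\<in>UNIV. (b $ i $ j) *\<^sub>R ?e (i, j))" for b :: "real^2^2"
    unfolding sum_UNIV_2_2
    by (simp add: mat22_eq_iff sum_2)
  then have bD: "fin_basis real_mat2_alg UNIV ?e (\<lambda>(i, j) b. b $ i $ j)"
    by (auto simp: fin_basis_def real_mat2_alg_def split_def)
  have "?k (?e j) = (case j of (i, j) \<Rightarrow> \<chi> k l. if k = i \<and> l = j then 1 else 0)" for j
    by (auto simp: vec_eq_iff split: prod.split)
  then have bC: "fin_basis (mat2_alg id) UNIV (\<lambda>j. ?k (?e j)) (\<lambda>(i, j) b. b $ i $ j)"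
    using mat2_basis by (simp add: split_def)
  show ?thesis
    by (rule exI, rule real_form_model[where \<kappa> = ?k and d = ?e, OF T f \<rho>
        complex_mat2_real_structures(1) \<rho>T D k bD bC])
      auto
qed

lemma quaternion_model:
  assumes T: "tensor_model A (mat2_alg id) X T" and f: "real_structure A f" and \<rho>: "real_structure X \<rho>"
    and \<rho>T: "\<And>a b. a \<in> carr A \<Longrightarrow> \<rho> (T a b) = T (f a) (l02 b)"
  shows "\<exists>T'. tensor_model (fixed_alg A f) quaternion_alg (fixed_alg X \<rho>) T'"
proof -
  interpret tensor_model A "mat2_alg id" X T by fact
  let ?k = "\<lambda>x. x :: complex^2^2"
  have D: "plain_galg quaternion_alg"
    unfolding quaternion_alg_def by (rule plain_galg_fixed[OF C.plain_galg_axioms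
        complex_mat2_real_structures(2)])
  have k: "real_form quaternion_alg (mat2_alg id) l02 ?k"
    by (simp add: real_form_def quaternion_alg_def fixed_alg_def)
  \<comment> \<open>The quaternion units \<open>1, \<i> \<sigma>\<^sub>x, \<i> \<sigma>\<^sub>y,
    \<i> \<sigma>\<^sub>z\<close>, which also form a complex basis of the two by two matrices;
    \<open>d\<close> is the dual basis.\<close>
  define e :: "nat \<Rightarrow> complex^2^2" where
    "e = (!) [mat22 1 0 0 1, mat22 0 \<i> \<i> 0, mat22 0 1 (-1) 0, mat22 \<i> 0 0 (-\<i>)]"
  define d :: "nat \<Rightarrow> complex^2^2 \<Rightarrow> complex" where
    "d j x = [(x $ 1 $ 1 + x $ 2 $ 2) / 2, - \<i> * (x $ 1 $ 2 + x $ 2 $ 1) / 2, (x $ 1 $ 2 - x $ 2 $ 1) / 2,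
      - \<i> * (x $ 1 $ 1 - x $ 2 $ 2) / 2] ! j" for j x
  have J: "{..<4} = {0, 1, 2, 3 :: nat}" by auto
  have ed: "e 0 = mat22 1 0 0 1" "e 1 = mat22 0 \<i> \<i> 0" "e 2 = mat22 0 1 (-1) 0" "e 3 = mat22 \<i> 0 0 (-\<i>)"
    "d 0 x = (x $ 1 $ 1 + x $ 2 $ 2) / 2" "d 1 x = - \<i> * (x $ 1 $ 2 + x $ 2 $ 1) / 2"
    "d 2 x = (x $ 1 $ 2 - x $ 2 $ 1) / 2" "d 3 x = - \<i> * (x $ 1 $ 1 - x $ 2 $ 2) / 2" for x
    by (simp_all add: e_def d_def)
  have bC: "fin_basis (mat2_alg id) {..<4} (\<lambda>j. ?k (e j)) d"
    unfolding fin_basis_def J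
    by (simp add: ed One_nat_def[symmetric] del: One_nat_def) (simp add: mat22_eq_iff
        scaleC_complex_def field_simps)
  have fixed: "Re (x $ 1 $ 1) = Re (x $ 2 $ 2)" "Im (x $ 1 $ 1) = - Im (x $ 2 $ 2)"
      "Re (x $ 2 $ 1) = - Re (x $ 1 $ 2)" "Im (x $ 2 $ 1) = Im (x $ 1 $ 2)"
    if "x \<in> carr quaternion_alg" for x
  proof -
    have "l02 x $ 1 $ 1 = x $ 1 $ 1" "l02 x $ 2 $ 1 = x $ 2 $ 1"
      using that by (simp_all add: quaternion_alg_def fixed_alg_def)
    then have "x $ 1 $ 1 = cnj (x $ 2 $ 2)" "x $ 2 $ 1 = - cnj (x $ 1 $ 2)"
      by (simp_all add: l02_eq realy_nth)
    then show "Re (x $ 1 $ 1) = Re (x $ 2 $ 2)" "Im (x $ 1 $ 1) = - Im (x $ 2 $ 2)"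
      "Re (x $ 2 $ 1) = - Re (x $ 1 $ 2)" "Im (x $ 2 $ 1) = Im (x $ 1 $ 2)" by simp_all
  qed
  have four: "P j" if "j < 4" "P 0" "P 1" "P 2" "P 3" for P and j :: nat
  proof -
    have "j = 0 \<or> j = 1 \<or> j = 2 \<or> j = 3" using that(1) by arith
    then show ?thesis using that(2-5) by (elim disjE) simp_all
  qed
  have real: "d j x = complex_of_real (Re (d j x))" if j: "j < 4" and x: "x \<in> carr quaternion_alg" for j x
    by (rule four[OF j, of "\<lambda>j. d j x = complex_of_real (Re (d j x))"]; unfold ed)
      (simp_all add: complex_eq_iff fixed[OF x])
  have ec: "e j \<in> carr quaternion_alg" if j: "j < 4" for j
    by (rule four[OF j, of "\<lambda>j. e j \<in> carr quaternion_alg"]; unfold ed)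
      (simp_all add: quaternion_alg_def fixed_alg_def l02_eq mat22_eq_iff realy_nth)
  note bC' = bC[unfolded fin_basis_def]
  have bD: "fin_basis quaternion_alg {..<4} e (\<lambda>j x. Re (d j x))"
    unfolding fin_basis_def
  proof (intro conjI ballI allI)
    fix x assume x: "x \<in> carr quaternion_alg"
    have "x = (\<Sum>j\<in>{..<4}. scl (mat2_alg id) (d j x) (e j))" using bC' by simp
    also have "\<dots> = (\<Sum>j\<in>{..<4}. scl quaternion_alg (Re (d j x)) (e j))"
      by (intro sum.cong HOL.refl) (simp add: quaternion_alg_def fixed_alg_def flip: real[OF _ x])
    finally show "x = (\<Sum>j\<in>{..<4}. scl quaternion_alg (Re (d j x)) (e j))" .
  next
    fix j x c assume "j \<in> {..<4::nat}" "x \<in> carr quaternion_alg"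
    then have "d j (scl (mat2_alg id) (complex_of_real c) x) = complex_of_real c * d j x" using bC' by simp
    then show "Re (d j (scl quaternion_alg c x)) = c * Re (d j x)"
      by (simp add: quaternion_alg_def fixed_alg_def)
  qed (use bC' ec in auto)
  show ?thesis
    by (rule exI, rule real_form_model[where \<kappa> = ?k and d = e and \<delta> = d and \<delta>' = "\<lambda>j x. Re (d j x)",
        OF T f \<rho> complex_mat2_real_structures(2) \<rho>T D k bD bC])
      (use real in auto)
qed

section \<open>Clifford algebras on two and three generators as matrix algebras\<close>

text \<open>The matrix with coordinates \<open>a, b, c, d\<close> with respect to \<open>1, \<sigma>\<^sub>x, \<sigma>\<^sub>y, \<sigma>\<^sub>z\<close>.\<close>

definition pm :: "complex \<Rightarrow> complex \<Rightarrow> complex \<Rightarrow> complex \<Rightarrow> complex^2^2"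
  where "pm a b c d = mat22 (a + d) (b - \<i> * c) (b + \<i> * c) (a - d)"

lemma pm_inject [simp]: "pm a b c d = pm a' b' c' d' \<longleftrightarrow> a = a' \<and> b = b' \<and> c = c' \<and> d = d'"
proof
  assume "pm a b c d = pm a' b' c' d'"
  then have *: "a + d = a' + d'" "b - \<i> * c = b' - \<i> * c'" "b + \<i> * c = b' + \<i> * c'" "a - d = a' - d'"
    by (simp_all add: pm_def mat22_eq_iff)
  have "(a + d) + (a - d) = (a' + d') + (a' - d')" "(b - \<i> * c) + (b + \<i> * c) = (b' - \<i> * c') + (b'
      + \<i> * c')"
    by (simp_all only: *)
  then have "a = a'" "b = b'" by simp_all
  then show "a = a' \<and> b = b' \<and> c = c' \<and> d = d'" using * by simp
qed simp

lemma pm_surj: "\<exists>a b c d. m = pm a b c d"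
  by (rule exI[of _ "(m $ 1 $ 1 + m $ 2 $ 2) / 2"], rule exI[of _ "(m $ 1 $ 2 + m $ 2 $ 1) / 2"],
      rule exI[of _ "\<i> * (m $ 1 $ 2 - m $ 2 $ 1) / 2"], rule exI[of _ "(m $ 1 $ 1 - m $ 2 $ 2) / 2"])
    (simp add: pm_def mat22_eq_iff field_simps)

lemma pm_ops:
  "pm a b c d + pm a' b' c' d' = pm (a + a') (b + b') (c + c') (d + d')"
  "- pm a b c d = pm (- a) (- b) (- c) (- d)"
  "entrywise (scaleC k) (pm a b c d) = pm (k * a) (k * b) (k * c) (k * d)"
  "mm (pm a b c d) (pm a' b' c' d') = pm (a * a' + b * b' + c * c' + d * d')
    (a * b' + b * a' + \<i> * (c * d' - d * c')) (a * c' + c * a' + \<i> * (d * b' - b * d'))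
    (a * d' + d * a' + \<i> * (b * c' - c * b'))"
  "(\<chi> i j. cnj (pm a b c d $ j $ i)) = pm (cnj a) (cnj b) (cnj c) (cnj d)"
  "grade2 id (pm a b c d) = pm a (- b) (- c) d"
  "l11 (pm a b c d) = pm (cnj a) (cnj b) (- cnj c) (cnj d)"
  "l02 (pm a b c d) = pm (cnj a) (- cnj b) (- cnj c) (- cnj d)"
  "l20 (pm a b c d) = pm (cnj a) (cnj b) (cnj c) (- cnj d)"
  by (simp_all add: pm_def mat22_eq_iff scaleC_complex_def star_complex_def l11_def l02_eq l20_eq
    realx_nth realy_nth algebra_simps)

abbreviation "C0 \<equiv> graded_alg (id :: complex \<Rightarrow> complex)"

lemma plain_C0: "plain_galg (cl1x C0)" "plain_galg (cl1x (cl1x C0))" "plain_galg (cl1x (cl1x (cl1x C0)))"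
  by (intro plain_cl1x plain_complex)+

text \<open>Iterated \<open>cl_split\<close>: the outermost pair records whether the last generator
  occurs.\<close>

definition split2 :: "(nat set \<Rightarrow> complex) \<Rightarrow> (complex \<times> complex) \<times> complex \<times> complex"
  where "split2 x = ((x {}, x {0}), (x {1}, x {0, 1}))"

definition split3 :: "(nat set \<Rightarrow> complex) \<Rightarrow>
    ((complex \<times> complex) \<times> complex \<times> complex) \<times> (complex \<times> complex) \<times> complex \<times> complex"
  where "split3 x = (((x {}, x {0}), (x {1}, x {0, 1})), ((x {2}, x {0, 2}), (x {1, 2}, x {0, 1, 2})))"

lemma CCl_Suc_graded_iso:
  "graded_iso (CCl_alg n) Z \<phi> \<Longrightarrow> graded_iso (CCl_alg (Suc n)) (cl1x Z) (map_prod \<phi> \<phi> \<circ> cl_split n)"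
  by (rule graded_iso_trans[OF cl_split_graded_iso cl1x_graded_iso[OF plain_CCl]])

lemma split_graded_iso:
  "graded_iso (CCl_alg 2) (cl1x (cl1x C0)) split2"
  "graded_iso (CCl_alg 3) (cl1x (cl1x (cl1x C0))) split3"
proof -
  have s: "{Suc 0, 0} = {0, Suc 0}" "{2, Suc 0} = {Suc 0, 2}" "{2, 0} = {0, 2 :: nat}"
    "{2, 0, Suc 0} = {0, Suc 0, 2}" by auto
  have "map_prod (map_prod (\<lambda>x. x {}) (\<lambda>x. x {}) \<circ> cl_split 0) (map_prod (\<lambda>x. x {}) (\<lambda>x. x {}) \<circ> cl_split 0)
      \<circ> cl_split (Suc 0) = split2"
    by (simp add: fun_eq_iff cl_split_def split2_def s)
  with CCl_Suc_graded_iso[OF CCl_Suc_graded_iso[OF CCl_0_graded_iso]]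
  show 2: "graded_iso (CCl_alg 2) (cl1x (cl1x C0)) split2"
    by (simp add: numeral_2_eq_2)
  have "map_prod split2 split2 \<circ> cl_split 2 = split3"
    by (simp add: fun_eq_iff cl_split_def split2_def split3_def s)
  with CCl_Suc_graded_iso[OF 2]
  show "graded_iso (CCl_alg 3) (cl1x (cl1x (cl1x C0))) split3"
    by (simp add: numeral_3_eq_3 numeral_2_eq_2)
qed

text \<open>\<open>e\<^sub>0, e\<^sub>1\<close> are sent to \<open>\<sigma>\<^sub>x, \<sigma>\<^sub>y\<close>.\<close>

definition k2 :: "(complex \<times> complex) \<times> complex \<times> complex \<Rightarrow> complex^2^2"
  where "k2 = (\<lambda>((a, b), (c, d)). pm a b c (\<i> * d))"

text \<open>\<open>e\<^sub>0, e\<^sub>1, e\<^sub>2\<close> are sent to \<open>\<sigma>\<^sub>x \<epsilon>, \<sigma>\<^sub>z \<epsilon>, \<sigma>\<^sub>y \<epsilon>\<close>, to \<open>\<sigma>\<^sub>y \<epsilon>, \<sigma>\<^sub>x \<epsilon>, \<sigma>\<^sub>z \<epsilon>\<close> and to \<open>\<epsilon>, \<sigma>\<^sub>x, \<sigma>\<^sub>y\<close>,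
  respectively.\<close>

definition k3_xzy where "k3_xzy = (\<lambda>(((a0, a1), (a2, a3)), ((b0, b1), (b2, b3))).
  (pm a0 (- \<i> * b2) (- \<i> * a3) (\<i> * b1), pm (- \<i> * b3) a1 b0 a2))"

definition k3_yxz where "k3_yxz = (\<lambda>(((a0, a1), (a2, a3)), ((b0, b1), (b2, b3))).
  (pm a0 (\<i> * b1) (- \<i> * b2) (- \<i> * a3), pm (- \<i> * b3) a2 a1 b0))"

definition k3_exy where "k3_exy = (\<lambda>(((a0, a1), (a2, a3)), ((b0, b1), (b2, b3))).
  (pm a0 a2 b0 (\<i> * b2), pm a1 (- a3) (- b1) (\<i> * b3)))"

text \<open>The factor \<open>\<i>\<close> in \<open>k2\<close> reflects
  \<open>\<sigma>\<^sub>x \<sigma>\<^sub>y = \<i> \<sigma>\<^sub>z\<close>.\<close>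

lemma k2_graded_iso: "graded_iso (cl1x (cl1x C0)) CCl2_alg k2"
proof -
  have "bij k2"
  proof (rule bijI')
    fix m
    obtain a b c d where "m = pm a b c d" using pm_surj by blast
    then have "m = k2 ((a, b), (c, - \<i> * d))" by (simp add: k2_def)
    then show "\<exists>x. m = k2 x" by blast
  qed (auto simp: k2_def)
  then show ?thesis
    by (auto simp: graded_iso_def star_iso_def CCl2_alg_eq k2_def pm_ops scaleC_complex_def
        star_complex_def algebra_simps)
qed

text \<open>In trivially graded matrices the Pauli matrices are even and commute with
  \<open>\<epsilon>\<close>; their products with \<open>\<epsilon>\<close> are odd and anticommute.
  With the other grading \<open>\<sigma>\<^sub>x, \<sigma>\<^sub>y\<close> are odd and anticommute
  with \<open>\<epsilon>\<close> already.\<close>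

lemma k3_graded_iso:
  "graded_iso (cl1x (cl1x (cl1x C0))) (cl1x (mat2_alg id)) k3_xzy"
  "graded_iso (cl1x (cl1x (cl1x C0))) (cl1x (mat2_alg id)) k3_yxz"
  "graded_iso (cl1x (cl1x (cl1x C0))) (cl1x CCl2_alg) k3_exy"
proof -
  have pms: "\<exists>a b c d a' b' c' d'. m = (pm a b c d, pm a' b' c' d')" for m
    using pm_surj[of "fst m"] pm_surj[of "snd m"] by (metis prod.collapse)
  have "bij k3_xzy"
  proof (rule bijI')
    fix m
    obtain a b c d a' b' c' d' where "m = (pm a b c d, pm a' b' c' d')" using pms by metis
    then have "m = k3_xzy (((a, b'), (d', \<i> * c)), ((c', - \<i> * d), (\<i> * b, \<i> * a')))" by (simp add:
        k3_xzy_def)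
    then show "\<exists>x. m = k3_xzy x" by blast
  qed (auto simp: k3_xzy_def)
  then show "graded_iso (cl1x (cl1x (cl1x C0))) (cl1x (mat2_alg id)) k3_xzy"
    by (auto simp: graded_iso_def star_iso_def k3_xzy_def pm_ops scaleC_complex_def star_complex_def
        algebra_simps)
  have "bij k3_yxz"
  proof (rule bijI')
    fix m
    obtain a b c d a' b' c' d' where "m = (pm a b c d, pm a' b' c' d')" using pms by metis
    then have "m = k3_yxz (((a, c'), (b', \<i> * d)), ((d', - \<i> * b), (\<i> * c, \<i> * a')))" by (simp add:
        k3_yxz_def)
    then show "\<exists>x. m = k3_yxz x" by blast
  qed (auto simp: k3_yxz_def)
  then show "graded_iso (cl1x (cl1x (cl1x C0))) (cl1x (mat2_alg id)) k3_yxz"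
    by (auto simp: graded_iso_def star_iso_def k3_yxz_def pm_ops scaleC_complex_def star_complex_def
        algebra_simps)
  have "bij k3_exy"
  proof (rule bijI')
    fix m
    obtain a b c d a' b' c' d' where "m = (pm a b c d, pm a' b' c' d')" using pms by metis
    then have "m = k3_exy (((a, a'), (b, - b')), ((c, - c'), (- \<i> * d, - \<i> * d')))" by (simp add:
        k3_exy_def)
    then show "\<exists>x. m = k3_exy x" by blast
  qed (auto simp: k3_exy_def)
  then show "graded_iso (cl1x (cl1x (cl1x C0))) (cl1x CCl2_alg) k3_exy"
    by (auto simp: graded_iso_def star_iso_def CCl2_alg_eq k3_exy_def pm_ops scaleC_complex_def
        star_complex_def algebra_simps)
qed

text \<open>The sign says whether \<open>\<epsilon>\<close> is fixed or negated.\<close>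

definition cl1x_real :: "bool \<Rightarrow> ('b::uminus \<Rightarrow> 'b) \<Rightarrow> 'b \<times> 'b \<Rightarrow> 'b \<times> 'b"
  where "cl1x_real p \<rho> x = (\<rho> (fst x), if p then \<rho> (snd x) else - \<rho> (snd x))"

lemma nat_intervals: "{2..<2 + 1} = {2::nat}" "{0..<0 + 3} = {0, 1, 2::nat}" "{3..<3 + 0} = ({} :: nat set)"
    "{1..<1 + 2} = {1, 2::nat}" "{0..<0 + 2} = {0, 1::nat}" "{2..<2 + 0} = ({} :: nat set)"
  by auto

lemma k2_real:
  "k2 (split2 (l_cl 2 0 x)) = l20 (k2 (split2 x))"
  "k2 (split2 (l_cl 0 2 x)) = l02 (k2 (split2 x))"
  by (simp_all only: split2_def l_cl_def nat_intervals k2_def split_conv pm_ops)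
    (simp_all add: Int_insert_left)

text \<open>\<open>l11\<close> negates only \<open>\<sigma>\<^sub>y\<close>, \<open>l02\<close>
  negates all three Pauli matrices, and the flag gives the sign of \<open>\<epsilon>\<close>. The
  signature counts the fixed and the negated images of generators; their order is chosen to put the
  fixed ones first, as \<open>l_cl\<close> demands.\<close>

lemma k3_real:
  "k3_xzy (split3 (l_cl 2 1 x)) = cl1x_real True l11 (k3_xzy (split3 x))"
  "k3_xzy (split3 (l_cl 0 3 x)) = cl1x_real True l02 (k3_xzy (split3 x))"
  "k3_xzy (split3 (l_cl 3 0 x)) = cl1x_real False l02 (k3_xzy (split3 x))"
  "k3_yxz (split3 (l_cl 1 2 x)) = cl1x_real False l11 (k3_yxz (split3 x))"
  "k3_exy (split3 (l_cl 1 2 x)) = cl1x_real True l02 (k3_exy (split3 x))"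
  by (simp_all only: split3_def l_cl_def nat_intervals k3_xzy_def k3_yxz_def k3_exy_def split_conv
      cl1x_real_def
      fst_conv snd_conv if_True if_False pm_ops)
    (simp_all add: Int_insert_left)

text \<open>Now the generators are \<open>\<sigma>\<^sub>x, \<sigma>\<^sub>y, \<epsilon>\<close>.
  \<open>l20\<close> fixes and \<open>l02\<close> negates the two matrices, so a negated
  \<open>\<epsilon>\<close> may come last.\<close>

lemma k2_k2_real:
  "map_prod k2 k2 (split3 (l_cl 3 0 x)) = cl1x_real True l20 (map_prod k2 k2 (split3 x))"
  "map_prod k2 k2 (split3 (l_cl 2 1 x)) = cl1x_real False l20 (map_prod k2 k2 (split3 x))"
  "map_prod k2 k2 (split3 (l_cl 0 3 x)) = cl1x_real False l02 (map_prod k2 k2 (split3 x))"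
  by (simp_all only: split3_def l_cl_def nat_intervals k2_def map_prod_simp split_conv cl1x_real_def
      fst_conv snd_conv if_True if_False pm_ops)
    (simp_all add: Int_insert_left)

section \<open>Conjugacy of the real structures\<close>

lemma real_structureD:
  assumes "plain_galg B" "real_structure B r"
  shows "x \<in> carr B \<Longrightarrow> r x \<in> carr B" "x \<in> carr B \<Longrightarrow> y \<in> carr B \<Longrightarrow> r (x + y) = r x + r y"
    "x \<in> carr B \<Longrightarrow> r (scl B c x) = scl B (cnj c) (r x)"
    "x \<in> carr B \<Longrightarrow> y \<in> carr B \<Longrightarrow> r (mul B x y) = mul B (r x) (r y)"
    "x \<in> carr B \<Longrightarrow> r (adj B x) = adj B (r x)" "x \<in> carr B \<Longrightarrow> r (r x) = x"
    "x \<in> carr B \<Longrightarrow> r (grd B x) = grd B (r x)" "x \<in> carr B \<Longrightarrow> r (- x) = - r x"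
proof -
  interpret plain_galg B by fact
  show *: "x \<in> carr B \<Longrightarrow> r x \<in> carr B" "x \<in> carr B \<Longrightarrow> y \<in> carr B \<Longrightarrow> r (x + y) = r x + r y"
    "x \<in> carr B \<Longrightarrow> r (scl B c x) = scl B (cnj c) (r x)"
    "x \<in> carr B \<Longrightarrow> y \<in> carr B \<Longrightarrow> r (mul B x y) = mul B (r x) (r y)"
    "x \<in> carr B \<Longrightarrow> r (adj B x) = adj B (r x)" "x \<in> carr B \<Longrightarrow> r (r x) = x"
    "x \<in> carr B \<Longrightarrow> r (grd B x) = grd B (r x)" for x y c
    using assms(2) by (auto simp: real_structure_def bij_betw_def)
  show "x \<in> carr B \<Longrightarrow> r (- x) = - r x"
    using *(1)[of x] *(3)[of x "-1"] by simp
qed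

lemma cl1x_real_structure:
  assumes B: "plain_galg B" and r: "real_structure B r"
  shows "real_structure (cl1x B) (cl1x_real p r)"
proof -
  interpret plain_galg B by fact
  note h = real_structureD[OF B r]
  have "bij_betw (cl1x_real p r) (carr (cl1x B)) (carr (cl1x B))"
    by (rule bij_betw_byWitness[of _ "cl1x_real p r"]) (auto simp: cl1x_real_def h)
  then show ?thesis
    by (auto simp: real_structure_def cl1x_real_def h mul_minus grd_minus adj_minus scl_minus)
qed

lemma cl1x_real_iso:
  assumes B: "plain_galg B" and X: "plain_galg X" and \<Phi>: "real_iso B r X \<rho> \<Phi>"
  shows "real_iso (cl1x B) (cl1x_real p r) (cl1x X) (cl1x_real p \<rho>) (map_prod \<Phi> \<Phi>)"
proof -
  interpret B: plain_galg B by fact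
  interpret X: plain_galg X by fact
  have g: "graded_iso B X \<Phi>" and r: "\<And>x. x \<in> carr B \<Longrightarrow> r x \<in> carr B \<and> \<Phi> (r x) = \<rho> (\<Phi> x)"
    using \<Phi> by (auto simp: real_iso_def)
  have "\<Phi> (- x) = - \<Phi> x" if "x \<in> carr B" for x
    using graded_isoD(4)[OF g that, of "-1"] graded_isoD(2)[OF g that] that by simp
  then show ?thesis
    using cl1x_graded_iso[OF B g] r by (auto simp: real_iso_def cl1x_real_def)
qed

text \<open>\<open>\<epsilon> = (1, -1)\<close> is fixed by \<open>l10\<close> and negated by
  \<open>l01\<close>.\<close>

lemma TCCl1_real:
  assumes B: "plain_galg B" and r: "real_structure B r" and x: "x \<in> carr B"
  shows "cl1x_real p r (TCCl1 B x q) = TCCl1 B (r x) ((if p then l10 else l01) q)"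
proof -
  interpret plain_galg B by fact
  note h = real_structureD[OF B r]
  have "- scl B ((cnj (fst q) - cnj (snd q)) / 2) (r x) = scl B ((cnj (snd q) - cnj (fst q)) / 2) (r x)"
    using scl_minus_left[of "r x" "(cnj (fst q) - cnj (snd q)) / 2"] h(1)[OF x]
    by (simp add: minus_divide_left)
  then show ?thesis
    using x by (auto simp: cl1x_real_def TCCl1_def h l10_def l01_def split_def add.commute)
qed

lemma CCl1_real_iso:
  assumes B: "plain_galg B" and adj: "\<And>c x. x \<in> carr B \<Longrightarrow> adj B (scl B c x) = scl B (cnj c) (adj B x)"
    and r: "real_structure B r"
  shows "real_iso (cl1x B) (cl1x_real p r) (B \<otimes>\<^sub>g CCl1_alg) (tmap B CCl1_alg r (if p then l10 else l01))
    (tensor_model.cls B CCl1_alg (TCCl1 B))"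
proof -
  interpret tensor_model B CCl1_alg "cl1x B" "TCCl1 B" by (rule TCCl1_model[OF B adj])
  note h = real_structureD[OF X.plain_galg_axioms cl1x_real_structure[OF B r, of p]]
  show ?thesis
    unfolding real_iso_def
    by (rule cls_real_iso) (use h real_structureD[OF B r] TCCl1_real[OF B r] in auto)
qed

text \<open>Adjoining \<open>\<epsilon>\<close> is functorial: \<open>\<Phi>\<close> extends
  componentwise to \<open>cl1x B\<close>, which is \<open>B \<otimes>\<^sub>g CCl1_alg\<close>, and
  \<open>cl1x X\<close> is a tensor product of \<open>A\<close> with \<open>cl1x C\<close>, a
  Clifford algebra through \<open>\<kappa>\<close>.\<close>

lemma CCl1_conj_tensor:
  assumes \<Phi>: "real_iso B rB X \<rho> \<Phi>" and B: "plain_galg B" and rB: "real_structure B rB"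
    and adjB: "\<And>c x. x \<in> carr B \<Longrightarrow> adj B (scl B c x) = scl B (cnj c) (adj B x)"
    and adjX: "\<And>x. x \<in> carr X \<Longrightarrow> adj X (adj X x) = x"
    and \<rho>: "real_structure X \<rho>" and T: "tensor_model A C X T" and f: "real_structure A f"
    and \<rho>T: "\<And>a b. a \<in> carr A \<Longrightarrow> b \<in> carr C \<Longrightarrow> \<rho> (T a b) = T (f a) (g b)"
    and g: "\<And>b. b \<in> carr C \<Longrightarrow> g b \<in> carr C"
    and \<kappa>: "graded_iso (CCl_alg n) (cl1x C) \<kappa>"
    and n: "n = i + j" and \<kappa>_real: "\<And>x. \<kappa> (l_cl i j x) = cl1x_real p g (\<kappa> x)"
  shows "inner_conjugate_triples (B \<otimes>\<^sub>g CCl1_alg) (tmap B CCl1_alg rB (if p then l10 else l01))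
      (A \<otimes>\<^sub>g CCl_alg n) (tmap A (CCl_alg n) f (l_cl i j)) \<and>
    graded_isomorphic (fixed_alg (B \<otimes>\<^sub>g CCl1_alg) (tmap B CCl1_alg rB (if p then l10 else l01)))
      (fixed_alg A f \<otimes>\<^sub>g Cl_alg i j)"
proof -
  interpret T: tensor_model A C X T by fact
  let ?T = "\<lambda>a b. (T a (fst (\<kappa> b)), T a (snd (\<kappa> b)))"
  have T': "tensor_model A (CCl_alg (i + j)) (cl1x X) ?T"
    using tensor_model.pullback[OF cl1x_model[OF T] plain_CCl \<kappa>] n by simp
  have \<rho>': "real_structure (cl1x X) (cl1x_real p \<rho>)"
    by (rule cl1x_real_structure[OF T.X.plain_galg_axioms \<rho>])
  have fc: "a \<in> carr A \<Longrightarrow> f a \<in> carr A" for a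
    using real_structureD(1)[OF T.A.plain_galg_axioms f] .
  have T_minus: "T a (- b) = - T a b" if "a \<in> carr A" "b \<in> carr C" for a b
    using T.T_scl_right[of a b "-1"] that by simp
  have \<kappa>c: "fst (\<kappa> b) \<in> carr C" "snd (\<kappa> b) \<in> carr C" if "b \<in> carr (CCl_alg (i + j))" for b
    using graded_isoD(2)[OF \<kappa>, of b] that n by auto
  have \<rho>T': "cl1x_real p \<rho> (?T a b) = ?T (f a) (l_cl i j b)" if "a \<in> carr A" "b \<in> carr (CCl_alg (i +
      j))" for a b
    using that \<kappa>c[OF that(2)] by (simp add: \<kappa>_real cl1x_real_def \<rho>T T_minus g fc)
  have iso: "real_iso (B \<otimes>\<^sub>g CCl1_alg) (tmap B CCl1_alg rB (if p then l10 else l01)) (cl1x X)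
      (cl1x_real p \<rho>)
      (map_prod \<Phi> \<Phi> \<circ> inv_into (carr (cl1x B)) (tensor_model.cls B CCl1_alg (TCCl1 B)))"
    by (rule real_iso_trans[OF real_iso_inv[OF plain_cl1x[OF B] CCl1_real_iso[OF B adjB rB]]
          cl1x_real_iso[OF B T.X.plain_galg_axioms \<Phi>]])
  have D: "tensor_model (fixed_alg A f) (Cl_alg i j) (fixed_alg (cl1x X) (cl1x_real p \<rho>))
      (\<lambda>a x. ?T a (cl_embed i x))"
    by (rule clifford_real_form_model[OF T' f \<rho>']) (rule \<rho>T')
  show ?thesis
    unfolding n
  proof (rule conj_tensor_assemble[OF iso T'])
    show "adj (cl1x X) (adj (cl1x X) x) = x" if "x \<in> carr (cl1x X)" for x
      using that adjX by (cases x) (simp add: T.X.grd_adj)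
    show "l_cl i j b \<in> carr (CCl_alg (i + j))" if "b \<in> carr (CCl_alg (i + j))" for b
      using real_structureD(1)[OF plain_CCl l_cl_real_structure that] .
  qed (use \<rho>' fc \<rho>T' D in blast)+
qed

text \<open>Both actions of the even unitary \<open>u\<close> commute with \<open>\<gamma>\<close>.
  Applied to the two components of \<open>x + y \<epsilon>\<close> they still form a unitary
  multiplier, which does not affect the sign a real structure gives to
  \<open>\<epsilon>\<close>.\<close>

lemma trivially_conjugate:
  fixes \<gamma> :: "'a::cstar_algebra \<Rightarrow> 'a"
  assumes g: "star_invol \<gamma> (\<lambda>c. c)" and f: "real_structure (graded_alg \<gamma>) f" and r: "real_structure
      (graded_alg \<gamma>) r"
    and u: "munitary u" and G: "mext_inv \<gamma> u = u" and conj: "\<And>a. AdM u (r a) = f (AdM u a)"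
  shows "inner_conjugate (graded_alg \<gamma>) r f"
    and "inner_conjugate (graded_alg \<gamma> \<otimes>\<^sub>g CCl1_alg)
      (tmap (graded_alg \<gamma>) CCl1_alg r (if p then l10 else l01)) (tmap (graded_alg \<gamma>) CCl1_alg f (if
          p then l10 else l01))"
proof -
  interpret g: star_invol \<gamma> "\<lambda>c. c" by fact
  interpret A: plain_galg "graded_alg \<gamma>" by (rule plain_graded_alg[OF g])
  have uu: "u * mstar u = 1" "mstar u * u = 1" using u by (auto simp: munitary_def)
  have inv: "lm u (lm (mstar u) a) = a" "lm (mstar u) (lm u a) = a"
    "rm u (rm (mstar u) a) = a" "rm (mstar u) (rm u a) = a" for a
    using uu by (metis lm_simps(2,6), metis lm_simps(2,6), metis rm_simps(2,6), metis rm_simps(2,6))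
  have G': "mext_inv \<gamma> (mstar u) = mstar u" using G by simp
  have even: "lm u (\<gamma> a) = \<gamma> (lm u a)" "rm (mstar u) (\<gamma> a) = \<gamma> (rm (mstar u) a)" "rm u (\<gamma> a) = \<gamma> (rm
      u a)" for a
    using g.ext_lm[of u "\<gamma> a"] g.ext_rm[of "mstar u" "\<gamma> a"] g.ext_rm[of u "\<gamma> a"]
    unfolding G G' by simp_all
  \<comment> \<open>The product of \<open>cl1x\<close> twists the right factor by
    \<open>\<gamma>\<close>; this is the centralizer identity for the twisted terms.\<close>
  have cross: "b * \<gamma> (lm u a) = rm u b * \<gamma> a" and "\<gamma> (lm (mstar u) (\<gamma> a)) = lm (mstar u) a"
    "\<gamma> (rm (mstar u) (\<gamma> a)) = rm (mstar u) a" for a b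
    using g.ext_lm[of "mstar u" a] g.ext_rm[of "mstar u" a] unfolding G'
    by (simp_all del: mstar_lm mstar_rm flip: even lm_rm)
  note even = even this
  have conj': "f (lm u (rm (mstar u) a)) = lm u (rm (mstar u) (r a))" for a
    using conj[of a] by (simp only: AdM_def)
  have star: "star (rm u (star a)) = lm (mstar u) a" "star (lm u (star a)) = rm (mstar u) a" for a
    by (simp_all add: mstar_lm mstar_rm)
  have id: "graded_iso (graded_alg \<gamma>) (graded_alg \<gamma>) (\<lambda>x. x)"
    by (simp add: graded_iso_def star_iso_def bij_betw_def)
  show "inner_conjugate (graded_alg \<gamma>) r f"
    by (rule inner_conjugate_transport[OF A.plain_galg_axioms id,
        where L = "lm u" and R = "rm u" and L' = "lm (mstar u)" and R' = "rm (mstar u)" and \<rho> = r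
            and \<rho>' = f])
      (simp_all add: lm_add rm_add lm_scaleC rm_scaleC lm_mult rm_mult lm_rm star inv even conj'
          del: mstar_lm mstar_rm)
  have adj: "adj (graded_alg \<gamma>) (scl (graded_alg \<gamma>) c x) = scl (graded_alg \<gamma>) (cnj c) (adj
      (graded_alg \<gamma>) x)" for c x
    by (simp add: star_scaleC)
  let ?A = "cl1x (graded_alg \<gamma>)"
  have iso: "real_iso ?A (cl1x_real p s) (graded_alg \<gamma> \<otimes>\<^sub>g CCl1_alg) (tmap (graded_alg \<gamma>) CCl1_alg s
      (if p then l10 else l01))
    (tensor_model.cls (graded_alg \<gamma>) CCl1_alg (TCCl1 (graded_alg \<gamma>)))" if "real_structure
        (graded_alg \<gamma>) s" for s
    by (rule CCl1_real_iso[OF A.plain_galg_axioms adj that])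
  have minus: "f (- a) = - f a" for a using real_structureD(8)[OF A.plain_galg_axioms f] by simp
  show "inner_conjugate (graded_alg \<gamma> \<otimes>\<^sub>g CCl1_alg)
      (tmap (graded_alg \<gamma>) CCl1_alg r (if p then l10 else l01)) (tmap (graded_alg \<gamma>) CCl1_alg f (if
          p then l10 else l01))"
  proof (rule inner_conjugate_transport[OF plain_cl1x[OF A.plain_galg_axioms],
        where L = "map_prod (lm u) (lm u)" and R = "map_prod (rm u) (rm u)" and L' = "map_prod (lm
            (mstar u)) (lm (mstar u))"
          and R' = "map_prod (rm (mstar u)) (rm (mstar u))" and \<rho> = "cl1x_real p r" and \<rho>' =
              "cl1x_real p f"])
    show "graded_iso ?A (graded_alg \<gamma> \<otimes>\<^sub>g CCl1_alg) (tensor_model.cls (graded_alg \<gamma>) CCl1_alg (TCCl1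
        (graded_alg \<gamma>)))"
      using iso[OF f] by (simp add: real_iso_def)
  qed (use iso[OF f] iso[OF r] in \<open>auto simp: real_iso_def lm_add rm_add lm_scaleC rm_scaleC lm_mult
      rm_mult lm_rm star inv
      even conj' cl1x_real_def lm_minus rm_minus g.star g.minus scaleC_minus_one minus simp del:
          mstar_lm mstar_rm\<close>)
qed

theorem theorem4p13:
  fixes \<gamma> f r :: "'a::cstar_algebra \<Rightarrow> 'a" and \<eta> :: "complex \<times> complex"
  assumes "grading (graded_alg \<gamma>)"
    and "real_structure (graded_alg \<gamma>) f"
    and "connected_space (gelfand_spectrum (graded_alg \<gamma>))"
    and "balanced (graded_alg \<gamma>) f \<or> \<gamma> = id"
    and "real_structure (graded_alg \<gamma>) r"
    and "inner_related (graded_alg \<gamma>) r f"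
    and "condA1 (graded_alg \<gamma>) f \<and> condA2 (graded_alg \<gamma>) r f \<or> condB2 (graded_alg \<gamma>) r f"
    and "relative_signs (graded_alg \<gamma>) r f \<eta>"
  shows
    "(\<eta> = (1, 1) \<longrightarrow>
        mat2_conj_tensor \<gamma> r f (mat2_alg id) l11 real_mat2_alg)
     \<and> (\<eta> = (-1, 1) \<longrightarrow>
        mat2_conj_tensor \<gamma> r f (mat2_alg id) l02 quaternion_alg)
     \<and> (\<eta> = (1, -1) \<longrightarrow>
        mat2_conj_tensor \<gamma> r (f \<circ> \<gamma>) CCl2_alg l20 (Cl_alg 2 0))
     \<and> (\<eta> = (-1, -1) \<longrightarrow>
        mat2_conj_tensor \<gamma> r (f \<circ> \<gamma>) CCl2_alg l02 (Cl_alg 0 2))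
     \<and> (\<eta> = (1, 1) \<longrightarrow> inner_conjugate (graded_alg \<gamma>) r f)
     \<and> (\<eta> = (1, 1) \<longrightarrow>
        mat2_Cl1_conj_tensor \<gamma> r l10 f (CCl_alg 3) (l_cl 2 1) (Cl_alg 2 1))
     \<and> (\<eta> = (-1, 1) \<longrightarrow>
        mat2_Cl1_conj_tensor \<gamma> r l10 f (CCl_alg 3) (l_cl 0 3) (Cl_alg 0 3))
     \<and> (\<eta> = (1, 1) \<longrightarrow>
        mat2_Cl1_conj_tensor \<gamma> r l01 f (CCl_alg 3) (l_cl 1 2) (Cl_alg 1 2))
     \<and> (\<eta> = (-1, 1) \<longrightarrow>
        mat2_Cl1_conj_tensor \<gamma> r l01 f (CCl_alg 3) (l_cl 3 0) (Cl_alg 3 0))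
     \<and> (\<eta> = (1, -1) \<longrightarrow>
        mat2_Cl1_conj_tensor \<gamma> r l10 (f \<circ> \<gamma>) (CCl_alg 3) (l_cl 3 0) (Cl_alg 3 0))
     \<and> (\<eta> = (-1, -1) \<longrightarrow>
        mat2_Cl1_conj_tensor \<gamma> r l10 (f \<circ> \<gamma>) (CCl_alg 3) (l_cl 1 2) (Cl_alg 1 2))
     \<and> (\<eta> = (1, -1) \<longrightarrow>
        mat2_Cl1_conj_tensor \<gamma> r l01 (f \<circ> \<gamma>) (CCl_alg 3) (l_cl 2 1) (Cl_alg 2 1))
     \<and> (\<eta> = (-1, -1) \<longrightarrow>
        mat2_Cl1_conj_tensor \<gamma> r l01 (f \<circ> \<gamma>) (CCl_alg 3) (l_cl 0 3) (Cl_alg 0 3))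
     \<and> (\<eta> = (1, 1) \<longrightarrow> (\<forall>l\<in>{l10, l01}.
        inner_conjugate (graded_alg \<gamma> \<otimes>\<^sub>g CCl1_alg)
          (tmap (graded_alg \<gamma>) CCl1_alg r l) (tmap (graded_alg \<gamma>) CCl1_alg f l)))"
proof -
  note f = assms(2) and r = assms(5)
  have g: "star_invol \<gamma> (\<lambda>c. c)" by (rule grading_star_invol[OF assms(1)])
  have f': "star_invol f cnj" by (rule real_structure_star_invol[OF f])
  have f\<gamma>: "real_structure (graded_alg \<gamma>) (f \<circ> \<gamma>)" by (rule real_structure_comp_grading[OF g f])
  have comm: "f (\<gamma> a) = \<gamma> (f a)" for a using f by (simp add: real_structure_def)
  note con = conjugating_unitary[OF assms(1,2,7)]
  let ?B = "mat2_alg (entrywise \<gamma>)" and ?r = "entrywise r"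
  note rs = mat2_real_structures[OF g f] and rB = mat2_real_structures(1)[OF g r]
    and B = plain_mat2(1)[OF g] and TR = TM2_real[OF f' g comm]
    and even = TM2_even[OF g] and odd = TM2_odd[OF g]
  have conj2: "inner_conjugate_triples ?B ?r (graded_alg \<gamma> \<otimes>\<^sub>g C) (tmap (graded_alg \<gamma>) C h s) \<and>
      graded_isomorphic (fixed_alg ?B ?r) (fixed_alg (graded_alg \<gamma>) h \<otimes>\<^sub>g D)"
    if "real_iso ?B ?r (mat2_alg G) \<rho> \<Phi>" "tensor_model (graded_alg \<gamma>) C (mat2_alg G) T"
      "real_structure (mat2_alg G) \<rho>" "\<And>a b. \<rho> (T a b) = T (h a) (s b)" "carr C = UNIV"
      "\<exists>T'. tensor_model (fixed_alg (graded_alg \<gamma>) h) D (fixed_alg (mat2_alg G) \<rho>) T'"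
    for C :: "(complex^2^2, complex) galg" and D :: "('d::ab_group_add, real) galg" and G \<rho> \<Phi> T h s
  proof -
    from that(6) obtain T' where "tensor_model (fixed_alg (graded_alg \<gamma>) h) D (fixed_alg (mat2_alg
        G) \<rho>) T'" ..
    note D = this
    show ?thesis
      by (rule conj_tensor_assemble[OF that(1,2) mat2_adj_scl(2) that(3)])
        (use that(4,5) in simp, use that(4,5) in simp, rule that(4), rule D)
  qed
  \<comment> \<open>\<open>\<kappa>\<close> expresses the three Clifford generators by Pauli
    matrices and \<open>\<epsilon>\<close>, and \<open>p\<close> selects the real structure on the
    factor \<open>CCl1_alg\<close>.\<close>
  have conj3: "inner_conjugate_triples (?B \<otimes>\<^sub>g CCl1_alg) (tmap ?B CCl1_alg ?r (if p then l10 else l01))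
      (graded_alg \<gamma> \<otimes>\<^sub>g CCl_alg 3) (tmap (graded_alg \<gamma>) (CCl_alg 3) h (l_cl i j)) \<and>
    graded_isomorphic (fixed_alg (?B \<otimes>\<^sub>g CCl1_alg) (tmap ?B CCl1_alg ?r (if p then l10 else l01)))
      (fixed_alg (graded_alg \<gamma>) h \<otimes>\<^sub>g Cl_alg i j)"
    if "real_iso ?B ?r (mat2_alg G) \<rho> \<Phi>" "tensor_model (graded_alg \<gamma>) C (mat2_alg G) T"
      "real_structure (mat2_alg G) \<rho>" "\<And>a b. \<rho> (T a b) = T (h a) (s b)" "carr C = UNIV"
      "real_structure (graded_alg \<gamma>) h"
      "graded_iso (cl1x (cl1x (cl1x C0))) (cl1x C) \<kappa>" "3 = i + j"
      "\<And>x. \<kappa> (split3 (l_cl i j x)) = cl1x_real p s (\<kappa> (split3 x))"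
    for C :: "(complex^2^2, complex) galg" and G \<rho> \<Phi> T h s \<kappa> i j p
    by (rule CCl1_conj_tensor[OF that(1) B rB mat2_adj_scl(1) mat2_adj_scl(2) that(3,2,6)])
      (rule that(4), use that(5) in simp, rule graded_iso_trans[OF split_graded_iso(2) that(7)],
        rule that(8), use that(9) in simp)
  have C: "carr (mat2_alg id) = (UNIV :: (complex^2^2) set)" "carr CCl2_alg = UNIV"
    by (simp_all add: CCl2_alg_eq)
  have kk: "graded_iso (cl1x (cl1x (cl1x C0))) (cl1x CCl2_alg) (map_prod k2 k2)"
    by (rule cl1x_graded_iso[OF plain_C0(2) k2_graded_iso])
  \<comment> \<open>The real subalgebra is to be \<open>Cl_alg i j\<close> itself, so the matrix
    model is pulled back along \<open>k2\<close> before passing to fixed points.\<close>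
  have cl2: "\<exists>T'. tensor_model (fixed_alg (graded_alg \<gamma>) (f \<circ> \<gamma>)) (Cl_alg i j) (fixed_alg (mat2_alg
      (grade2 \<gamma>)) \<rho>) T'"
    if "real_structure (mat2_alg (grade2 \<gamma>)) \<rho>" "\<And>a b. \<rho> (TM2 \<gamma> a b) = TM2 \<gamma> ((f \<circ> \<gamma>) a) (s b)"
      "2 = i + j" "\<And>x. k2 (split2 (l_cl i j x)) = s (k2 (split2 x))" for \<rho> s i j
  proof -
    have "tensor_model (graded_alg \<gamma>) (CCl_alg (i + j)) (mat2_alg (grade2 \<gamma>)) (\<lambda>a b. TM2 \<gamma> a (k2
        (split2 b)))"
      using tensor_model.pullback[OF odd plain_CCl graded_iso_trans[OF split_graded_iso(1)
          k2_graded_iso]] that(3)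
      by simp
    then show ?thesis
      by (intro exI, rule clifford_real_form_model[OF _ f\<gamma> that(1)]) (simp_all only: that(2,4))
  qed
  obtain s t where \<eta>: "\<eta> = (s, t)" by fastforce
  note con = con[OF assms(8)[unfolded \<eta>], folded \<eta>]
  note ct = mat2_conj_tensor_def and ct1 = mat2_Cl1_conj_tensor_def
  have 1: "mat2_conj_tensor \<gamma> r f (mat2_alg id) l11 real_mat2_alg \<and>
      inner_conjugate (graded_alg \<gamma>) r f \<and>
      mat2_Cl1_conj_tensor \<gamma> r l10 f (CCl_alg 3) (l_cl 2 1) (Cl_alg 2 1) \<and>
      mat2_Cl1_conj_tensor \<gamma> r l01 f (CCl_alg 3) (l_cl 1 2) (Cl_alg 1 2) \<and>
      (\<forall>l\<in>{l10, l01}. inner_conjugate (graded_alg \<gamma> \<otimes>\<^sub>g CCl1_alg)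
          (tmap (graded_alg \<gamma>) CCl1_alg r l) (tmap (graded_alg \<gamma>) CCl1_alg f l))" if e: "\<eta> = (1, 1)"
  proof -
    obtain u where u: "munitary u" "mext_inv \<gamma> u = u" "\<And>a. AdM u (r a) = f (AdM u a)"
      using con(1)[OF e] by blast
    \<comment> \<open>For the signs \<open>(1, 1)\<close> the unitary \<open>u\<close> on the
      diagonal conjugates the entrywise extensions and keeps the grading.\<close>
    let ?w = "mat22 u 0 0 u"
    have w: "unitary2 ?w" using u(1) by (simp add: unitary2_def munitary_def mat22_eq_iff)
    have wx: "Ad2 ?w x = entrywise (AdM u) x" for x
      by (simp add: mat22_eq_iff Ad2_def AdM_def sum_2 del: mstar_rm)
    have "AdM u (\<gamma> a) = \<gamma> (AdM u a)" for a
    proof -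
      interpret star_invol \<gamma> "\<lambda>c. c" by (rule g)
      have "emb (AdM u (\<gamma> a)) = emb (\<gamma> (AdM u a))"
        by (simp only: ext_simps(9)[symmetric] emb_AdM ext_simps(6,8) u(2))
      then show ?thesis by simp
    qed
    then have iso: "real_iso ?B ?r ?B (entrywise f) (Ad2 ?w)"
      using Ad2_graded_iso[OF w, of "entrywise \<gamma>" "entrywise \<gamma>"] u(3)
      by (simp add: real_iso_def wx mat22_eq_iff)
    have "\<exists>T'. tensor_model (fixed_alg (graded_alg \<gamma>) f) real_mat2_alg (fixed_alg ?B (entrywise f)) T'"
      by (rule real_mat2_model[OF even f rs(1)]) (rule TR(1))
    note c2 = conj2[OF iso even rs(1) TR(1) C(1) this] and c3 = conj3[OF iso even rs(1) TR(1) C(1) f]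
    show ?thesis
      using c2 trivially_conjugate(1)[OF g f r u] c3[OF k3_graded_iso(1) _ k3_real(1)]
        c3[OF k3_graded_iso(2) _ k3_real(4)] trivially_conjugate(2)[OF g f r u, of True]
        trivially_conjugate(2)[OF g f r u, of False]
      by (simp add: ct ct1)
  qed
  have 2: "mat2_conj_tensor \<gamma> r f (mat2_alg id) l02 quaternion_alg \<and>
      mat2_Cl1_conj_tensor \<gamma> r l10 f (CCl_alg 3) (l_cl 0 3) (Cl_alg 0 3) \<and>
      mat2_Cl1_conj_tensor \<gamma> r l01 f (CCl_alg 3) (l_cl 3 0) (Cl_alg 3 0)" if e: "\<eta> = (-1, 1)"
  proof -
    obtain w where w: "unitary2 w" "\<And>x. Ad2 w (entrywise \<gamma> x) = entrywise \<gamma> (Ad2 w x)"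
      "\<And>x. Ad2 w (entrywise r x) = realy f (Ad2 w x)" using con(2)[OF e] unfolding conj2_to_def by blast
    have iso: "real_iso ?B ?r ?B (realy f) (Ad2 w)"
      by (simp add: real_iso_def w(3)) (rule Ad2_graded_iso[OF w(1)], rule w(2))
    have "\<exists>T'. tensor_model (fixed_alg (graded_alg \<gamma>) f) quaternion_alg (fixed_alg ?B (realy f)) T'"
      by (rule quaternion_model[OF even f rs(2)]) (rule TR(2))
    note c2 = conj2[OF iso even rs(2) TR(2) C(1) this]
      and c3 = conj3[OF iso even rs(2) TR(2) C(1) f]
    show ?thesis
      using c2 c3[OF k3_graded_iso(1) _ k3_real(2)] c3[OF k3_graded_iso(1) _ k3_real(3)]
      by (simp add: ct ct1)
  qed
  have 3: "mat2_conj_tensor \<gamma> r (f \<circ> \<gamma>) CCl2_alg l20 (Cl_alg 2 0) \<and>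
      mat2_Cl1_conj_tensor \<gamma> r l10 (f \<circ> \<gamma>) (CCl_alg 3) (l_cl 3 0) (Cl_alg 3 0) \<and>
      mat2_Cl1_conj_tensor \<gamma> r l01 (f \<circ> \<gamma>) (CCl_alg 3) (l_cl 2 1) (Cl_alg 2 1)" if e: "\<eta> = (1, -1)"
  proof -
    obtain w where w: "unitary2 w" "\<And>x. Ad2 w (entrywise \<gamma> x) = grade2 \<gamma> (Ad2 w x)"
      "\<And>x. Ad2 w (entrywise r x) = realx f (Ad2 w x)" using con(3)[OF e] unfolding conj2_to_def by blast
    have iso: "real_iso ?B ?r (mat2_alg (grade2 \<gamma>)) (realx f) (Ad2 w)"
      by (simp add: real_iso_def w(3)) (rule Ad2_graded_iso[OF w(1)], rule w(2))
    note c2 = conj2[OF iso odd rs(3) TR(3) C(2) cl2[OF rs(3) TR(3) _ k2_real(1)]]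
      and c3 = conj3[OF iso odd rs(3) TR(3) C(2) f\<gamma>]
    show ?thesis
      using c2 c3[OF kk _ k2_k2_real(1)] c3[OF kk _ k2_k2_real(2)]
      by (simp add: ct ct1)
  qed
  have 4: "mat2_conj_tensor \<gamma> r (f \<circ> \<gamma>) CCl2_alg l02 (Cl_alg 0 2) \<and>
      mat2_Cl1_conj_tensor \<gamma> r l10 (f \<circ> \<gamma>) (CCl_alg 3) (l_cl 1 2) (Cl_alg 1 2) \<and>
      mat2_Cl1_conj_tensor \<gamma> r l01 (f \<circ> \<gamma>) (CCl_alg 3) (l_cl 0 3) (Cl_alg 0 3)" if e: "\<eta> = (-1, -1)"
  proof -
    obtain w where w: "unitary2 w" "\<And>x. Ad2 w (entrywise \<gamma> x) = grade2 \<gamma> (Ad2 w x)"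
      "\<And>x. Ad2 w (entrywise r x) = realy f (Ad2 w x)" using con(4)[OF e] unfolding conj2_to_def by blast
    have iso: "real_iso ?B ?r (mat2_alg (grade2 \<gamma>)) (realy f) (Ad2 w)"
      by (simp add: real_iso_def w(3)) (rule Ad2_graded_iso[OF w(1)], rule w(2))
    note c2 = conj2[OF iso odd rs(4) TR(4) C(2) cl2[OF rs(4) TR(4) _ k2_real(2)]]
      and c3 = conj3[OF iso odd rs(4) TR(4) C(2) f\<gamma>]
    \<comment> \<open>With \<open>l10\<close> the only fixed generator is \<open>\<epsilon>\<close>,
      which must come first, hence \<open>k3_exy\<close>. With \<open>l01\<close> all three are
      negated and \<open>\<epsilon>\<close> can stay last.\<close>
    show ?thesis
      using c2 c3[OF k3_graded_iso(3) _ k3_real(5)] c3[OF kk _ k2_k2_real(3)]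
      by (simp add: ct ct1)
  qed
  show ?thesis using 1 2 3 4 by blast
qed

end
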